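(* Let $\iota\colon C\to M$ be a submanifold of a manifold $M$ and $D\subseteq TC$ an integrable smooth (possibly singular) distribution. Let $\mathcal{P}$ be a finitely generated regular projective coisotropic module over the coisotropic algebra $C^\infty(M,C,D)$. Assume that $M$ is connected and that $C/D$ is connected with respect to the final topology induced by the projection $C\to C/D$. Then there exist a vector bundle $E_{\mathrm{tot}}\to M$, vector subbundles $E_N\subseteq E_{\mathrm{tot}}$ and $E_0\subseteq\iota^\sharp E_N$, and a holonomy-free $D$-connection $\nabla$ on $\iota^\sharp E_N$ such that $E_0$ is closed under $\nabla$ and the coisotropic module $\mathcal{P}$ is isomorphic to the triple of invariant sections $\Gamma^\infty(E_{\mathrm{tot}},E_N,E_0,\nabla)$. Moreover, $(E_{\mathrm{tot}},E_N,E_0,\nabla)$ can be chosen in such a way that there exists a decomposition $\iota^\sharp E_N=E_0\oplus E_0^\perp$ and $\nabla=\nabla^0\oplus\nabla^\perp$, where $\nabla^0$ and $\nabla^\perp$ are holonomy-free $D$-connections on the subbundles $E_0$ and $E_0^\perp$, respectively.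
   Context: Manifolds and functions are smooth; functions are real-valued, the ground ring is $\mathbb{R}$. $\Gamma^\infty(E)$ denotes smooth sections, and $\iota^\sharp$ denotes restriction of vector bundles on $M$ and their sections to $C$. $C/D$ is the set of leaves of $D$. Coisotropic algebras and modules. A coisotropic algebra is a triple $\mathcal{A}=(\mathcal{A}_{\mathrm{tot}},\mathcal{A}_{N},\mathcal{A}_0)$ of unital associative algebras $\mathcal{A}_{\mathrm{tot}},\mathcal{A}_N$ and a two-sided ideal $\mathcal{A}_0\subseteq\mathcal{A}_N$, together with a unital algebra homomorphism $\iota_{\mathcal{A}}\colon\mathcal{A}_N\to\mathcal{A}_{\mathrm{tot}}$. A coisotropic (right) $\mathcal{A}$-module is a triple $\mathcal{E}=(\mathcal{E}_{\mathrm{tot}},\mathcal{E}_N,\mathcal{E}_0)$ with $\mathcal{E}_{\mathrm{tot}}$ a right $\mathcal{A}_{\mathrm{tot}}$-module, $\mathcal{E}_N$ a right $\mathcal{A}_N$-module, $\mathcal{E}_0\subseteq\mathcal{E}_N$ an $\mathcal{A}_N$-submodule with $\mathcal{E}_N\cdot\mathcal{A}_0\subseteq\mathcal{E}_0$, and a module morphism $\iota_{\mathcal{E}}\colon\mathcal{E}_N\to\mathcal{E}_{\mathrm{tot}}$ along $\iota_{\mathcal{A}}$. A morphism $\Phi\colon\mathcal{E}\to\mathcal{F}$ is a pair $(\Phi_{\mathrm{tot}},\Phi_N)$ of an $\mathcal{A}_{\mathrm{tot}}$-linear map and an $\mathcal{A}_N$-linear map with $\Phi_{\mathrm{tot}}\circ\iota_{\mathcal{E}}=\iota_{\mathcal{F}}\circ\Phi_N$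 and $\Phi_N(\mathcal{E}_0)\subseteq\mathcal{F}_0$. It is a regular epimorphism iff $\Phi_{\mathrm{tot}},\Phi_N$ are surjective and $\Phi_N(\mathcal{E}_0)=\mathcal{F}_0$. Direct sums are componentwise. Regular projective modules. $\mathcal{P}$ is regular projective if for every morphism $\Psi\colon\mathcal{P}\to\mathcal{F}$ and every regular epimorphism $\Phi\colon\mathcal{E}\to\mathcal{F}$ there is a morphism $\chi\colon\mathcal{P}\to\mathcal{E}$ with $\Phi\circ\chi=\Psi$. A coisotropic index set is a triple of sets $S=(S_{\mathrm{tot}},S_N,S_0)$ with $S_0\subseteq S_N$ and a map $\iota_S\colon S_N\to S_{\mathrm{tot}}$. The free module $\mathcal{A}^{(S)}$ has components $\mathcal{A}_{\mathrm{tot}}^{(S_{\mathrm{tot}})}$, $\mathcal{A}_N^{(S_N)}$, $\mathcal{A}_N^{(S_0)}+\mathcal{A}_0^{(S_N)}$, with structure map sending the standard basis element indexed by $m\in S_N$ times $a$ to the one indexed by $\iota_S(m)$ times $\iota_{\mathcal{A}}(a)$. A regular projective $\mathcal{P}$ is finitely generated if $\mathcal{A}^{(S)}\simeq\mathcal{P}\oplus\mathcal{E}$ for some $\mathcal{E}$ and some $S$ consisting of finite sets with $\iota_S$ injective. The coisotropic algebra. $C^\infty(M,C,D)=(C^\infty(M),C^\infty_D(M),\mathcal{J}_C)$ with $C^\infty_D(M)=\{f\in C^\infty(M)\mid\iota^*f\in C^\infty_D(C)\}$, where $C^\infty_D(C)$ are the functions on $C$ constant along the leaves of $D$, $\mathcal{J}_C=\{f\mid\iota^*f=0\}$,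 and the structure map is the inclusion. $D$-connections. A $D$-connection on a vector bundle $E\to C$ is a map $\nabla\colon D\times\Gamma^\infty(E)\to E$ that is the restriction of a covariant derivative $TC\times\Gamma^\infty(E)\to E$. It is holonomy-free if its parallel transport along curves inside a leaf of $D$ depends only on the endpoints. A subbundle $F\subseteq E$ is closed under $\nabla$ if $\nabla_Xs\in\Gamma^\infty(F)$ for all $X\in\Gamma^\infty(D)$, $s\in\Gamma^\infty(F)$. Triple of invariant sections. For $\underline{E}=(E_{\mathrm{tot}},E_N,E_0,\nabla)$, the coisotropic $C^\infty(M,C,D)$-module $\Gamma^\infty(\underline{E})$ has components $\Gamma^\infty(\underline{E})_{\mathrm{tot}}=\Gamma^\infty(E_{\mathrm{tot}})$, $\Gamma^\infty(\underline{E})_N=\{s\in\Gamma^\infty(E_N)\mid\nabla_X\iota^\sharp s=0\ \forall X\in\Gamma^\infty(D)\}$, $\Gamma^\infty(\underline{E})_0=\{s\in\Gamma^\infty(\underline{E})_N\mid\iota^\sharp s\in\Gamma^\infty(E_0)\}$, with structure map the inclusion $\Gamma^\infty(E_N)\to\Gamma^\infty(E_{\mathrm{tot}})$. *)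

theory Defs
  imports "HOL-Analysis.Analysis" "HOL-Analysis.Finite_Function_Topology" "HOL-Algebra.Algebraic_Closure_Type"
begin

no_notation Sum_Type.Plus (infixr \<open><+>\<close> 65)

section \<open>Coisotropic algebras and modules\<close>

text \<open>
  An algebra over the reals is a ring record together with the scalar action in the field smult.
\<close>

definition real_algebra :: "(real, 'a) module \<Rightarrow> bool" where
  "real_algebra A \<longleftrightarrow> ring A \<and> Module.module (ring_of_type_algebra :: real ring) A \<and>
     (\<forall>r. \<forall>a\<in>carrier A. \<forall>b\<in>carrier A.
        (r \<odot>\<^bsub>A\<^esub> a) \<otimes>\<^bsub>A\<^esub> b = r \<odot>\<^bsub>A\<^esub> (a \<otimes>\<^bsub>A\<^esub> b) \<and>
        a \<otimes>\<^bsub>A\<^esub> (r \<odot>\<^bsub>A\<^esub> b) = r \<odot>\<^bsub>A\<^esub> (a \<otimes>\<^bsub>A\<^esub> b))"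

definition real_algebra_hom :: "(real, 'a) module \<Rightarrow> (real, 'b) module \<Rightarrow> ('a \<Rightarrow> 'b) set" where
  "real_algebra_hom A B =
     {h \<in> ring_hom A B. \<forall>r. \<forall>a\<in>carrier A. h (r \<odot>\<^bsub>A\<^esub> a) = r \<odot>\<^bsub>B\<^esub> h a}"

record ('a, 'b) coiso_alg =
  alg_tot :: "(real, 'a) module"
  alg_N :: "(real, 'b) module"
  alg_0 :: "'b set"
  alg_map :: "'b \<Rightarrow> 'a"

definition coisotropic_algebra :: "('a, 'b) coiso_alg \<Rightarrow> bool" where
  "coisotropic_algebra A \<longleftrightarrow>
     real_algebra (alg_tot A) \<and> real_algebra (alg_N A) \<and> ideal (alg_0 A) (alg_N A) \<and>
     alg_map A \<in> real_algebra_hom (alg_N A) (alg_tot A)"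

text \<open>
  Right modules: the library's locale module needs a commutative ring of scalars. The term
  a \<open>\<odot>\<close> x denotes x acted upon by a from the right. Only the additive group and the
  action of the module record are used. The real vector space structure of a module over a unital
  real algebra is the one induced by the multiples of the unit, so it is not recorded and
  module maps are automatically linear over the reals.
\<close>

locale right_module = R?: ring R + M?: abelian_group M
  for R :: "('a, 'r) ring_scheme" (structure) and M :: "('a, 'b) module" (structure) +
  assumes rsmult_closed: "\<lbrakk>a \<in> carrier R; x \<in> carrier M\<rbrakk> \<Longrightarrow> a \<odot>\<^bsub>M\<^esub> x \<in> carrier M"
    and rsmult_add_scalar: "\<lbrakk>a \<in> carrier R; b \<in> carrier R; x \<in> carrier M\<rbrakk> \<Longrightarrow>
      (a \<oplus>\<^bsub>R\<^esub> b) \<odot>\<^bsub>M\<^esub> x = a \<odot>\<^bsub>M\<^esub> x \<oplus>\<^bsub>M\<^esub> b \<odot>\<^bsub>M\<^esub> x"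
    and rsmult_add: "\<lbrakk>a \<in> carrier R; x \<in> carrier M; y \<in> carrier M\<rbrakk> \<Longrightarrow>
      a \<odot>\<^bsub>M\<^esub> (x \<oplus>\<^bsub>M\<^esub> y) = a \<odot>\<^bsub>M\<^esub> x \<oplus>\<^bsub>M\<^esub> a \<odot>\<^bsub>M\<^esub> y"
    and rsmult_assoc: "\<lbrakk>a \<in> carrier R; b \<in> carrier R; x \<in> carrier M\<rbrakk> \<Longrightarrow>
      (a \<otimes>\<^bsub>R\<^esub> b) \<odot>\<^bsub>M\<^esub> x = b \<odot>\<^bsub>M\<^esub> (a \<odot>\<^bsub>M\<^esub> x)"
    and rsmult_one: "x \<in> carrier M \<Longrightarrow> \<one>\<^bsub>R\<^esub> \<odot>\<^bsub>M\<^esub> x = x"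

record ('a, 'b, 'p, 'q) coiso_mod =
  mod_tot :: "('a, 'p) module"
  mod_N :: "('b, 'q) module"
  mod_0 :: "'q set"
  mod_map :: "'q \<Rightarrow> 'p"

definition coisotropic_module ::
  "('a, 'b) coiso_alg \<Rightarrow> ('a, 'b, 'p, 'q) coiso_mod \<Rightarrow> bool" where
  "coisotropic_module A P \<longleftrightarrow>
     coisotropic_algebra A \<and>
     right_module (alg_tot A) (mod_tot P) \<and> right_module (alg_N A) (mod_N P) \<and>
     submodule (mod_0 P) (alg_N A) (mod_N P) \<and>
     (\<forall>a\<in>alg_0 A. \<forall>x\<in>carrier (mod_N P). a \<odot>\<^bsub>mod_N P\<^esub> x \<in> mod_0 P) \<and>
     mod_map P \<in> carrier (mod_N P) \<rightarrow> carrier (mod_tot P) \<and>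
     (\<forall>x\<in>carrier (mod_N P). \<forall>y\<in>carrier (mod_N P).
        mod_map P (x \<oplus>\<^bsub>mod_N P\<^esub> y) = mod_map P x \<oplus>\<^bsub>mod_tot P\<^esub> mod_map P y) \<and>
     (\<forall>a\<in>carrier (alg_N A). \<forall>x\<in>carrier (mod_N P).
        mod_map P (a \<odot>\<^bsub>mod_N P\<^esub> x) = alg_map A a \<odot>\<^bsub>mod_tot P\<^esub> mod_map P x)"

definition module_maps ::
  "('a, 'r) ring_scheme \<Rightarrow> ('a, 'p) module \<Rightarrow> ('a, 'q) module \<Rightarrow> ('p \<Rightarrow> 'q) set" where
  "module_maps R M N = {h \<in> carrier M \<rightarrow> carrier N.
     (\<forall>x\<in>carrier M. \<forall>y\<in>carrier M. h (x \<oplus>\<^bsub>M\<^esub> y) = h x \<oplus>\<^bsub>N\<^esub> h y) \<and>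
     (\<forall>a\<in>carrier R. \<forall>x\<in>carrier M. h (a \<odot>\<^bsub>M\<^esub> x) = a \<odot>\<^bsub>N\<^esub> h x)}"

definition coiso_morphism ::
  "('a, 'b) coiso_alg \<Rightarrow> ('a, 'b, 'p, 'q) coiso_mod \<Rightarrow> ('a, 'b, 'r, 's) coiso_mod \<Rightarrow>
   ('p \<Rightarrow> 'r) \<times> ('q \<Rightarrow> 's) \<Rightarrow> bool" where
  "coiso_morphism A E F \<Phi> \<longleftrightarrow>
     fst \<Phi> \<in> module_maps (alg_tot A) (mod_tot E) (mod_tot F) \<and>
     snd \<Phi> \<in> module_maps (alg_N A) (mod_N E) (mod_N F) \<and>
     (\<forall>x\<in>carrier (mod_N E). fst \<Phi> (mod_map E x) = mod_map F (snd \<Phi> x)) \<and>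
     snd \<Phi> ` mod_0 E \<subseteq> mod_0 F"

definition regular_epi ::
  "('a, 'b) coiso_alg \<Rightarrow> ('a, 'b, 'p, 'q) coiso_mod \<Rightarrow> ('a, 'b, 'r, 's) coiso_mod \<Rightarrow>
   ('p \<Rightarrow> 'r) \<times> ('q \<Rightarrow> 's) \<Rightarrow> bool" where
  "regular_epi A E F \<Phi> \<longleftrightarrow> coiso_morphism A E F \<Phi> \<and>
     fst \<Phi> ` carrier (mod_tot E) = carrier (mod_tot F) \<and>
     snd \<Phi> ` carrier (mod_N E) = carrier (mod_N F) \<and>
     snd \<Phi> ` mod_0 E = mod_0 F"

definition coiso_isomorphic ::
  "('a, 'b) coiso_alg \<Rightarrow> ('a, 'b, 'p, 'q) coiso_mod \<Rightarrow> ('a, 'b, 'r, 's) coiso_mod \<Rightarrow> bool" where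
  "coiso_isomorphic A E F \<longleftrightarrow> (\<exists>\<Phi> \<Psi>. coiso_morphism A E F \<Phi> \<and> coiso_morphism A F E \<Psi> \<and>
     (\<forall>x\<in>carrier (mod_tot E). fst \<Psi> (fst \<Phi> x) = x) \<and>
     (\<forall>x\<in>carrier (mod_N E). snd \<Psi> (snd \<Phi> x) = x) \<and>
     (\<forall>y\<in>carrier (mod_tot F). fst \<Phi> (fst \<Psi> y) = y) \<and>
     (\<forall>y\<in>carrier (mod_N F). snd \<Phi> (snd \<Psi> y) = y))"

definition module_sum :: "('a, 'p) module \<Rightarrow> ('a, 'q) module \<Rightarrow> ('a, 'p \<times> 'q) module" where
  "module_sum M N = \<lparr> carrier = carrier M \<times> carrier N, mult = undefined, one = undefined,
     zero = (\<zero>\<^bsub>M\<^esub>, \<zero>\<^bsub>N\<^esub>),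
     add = (\<lambda>x y. (fst x \<oplus>\<^bsub>M\<^esub> fst y, snd x \<oplus>\<^bsub>N\<^esub> snd y)),
     smult = (\<lambda>a x. (a \<odot>\<^bsub>M\<^esub> fst x, a \<odot>\<^bsub>N\<^esub> snd x)) \<rparr>"

definition coiso_sum ::
  "('a, 'b, 'p, 'q) coiso_mod \<Rightarrow> ('a, 'b, 'r, 's) coiso_mod \<Rightarrow> ('a, 'b, 'p \<times> 'r, 'q \<times> 's) coiso_mod"
  where
  "coiso_sum E F = \<lparr> mod_tot = module_sum (mod_tot E) (mod_tot F),
     mod_N = module_sum (mod_N E) (mod_N F), mod_0 = mod_0 E \<times> mod_0 F,
     mod_map = map_prod (mod_map E) (mod_map F) \<rparr>"

record ('i, 'j) coiso_index =
  idx_tot :: "'i set"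
  idx_N :: "'j set"
  idx_0 :: "'j set"
  idx_map :: "'j \<Rightarrow> 'i"

definition coisotropic_index_set :: "('i, 'j) coiso_index \<Rightarrow> bool" where
  "coisotropic_index_set S \<longleftrightarrow> idx_0 S \<subseteq> idx_N S \<and> idx_map S \<in> idx_N S \<rightarrow> idx_tot S"

definition free_module :: "('a, 'r) ring_scheme \<Rightarrow> 'i set \<Rightarrow> ('a, 'i \<Rightarrow> 'a) module" where
  "free_module R I = \<lparr>
     carrier = {f. (\<forall>i\<in>I. f i \<in> carrier R) \<and> (\<forall>i. i \<notin> I \<longrightarrow> f i = \<zero>\<^bsub>R\<^esub>) \<and> finite {i. f i \<noteq> \<zero>\<^bsub>R\<^esub>}},
     mult = undefined, one = undefined, zero = (\<lambda>_. \<zero>\<^bsub>R\<^esub>),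
     add = (\<lambda>f g i. f i \<oplus>\<^bsub>R\<^esub> g i), smult = (\<lambda>a f i. f i \<otimes>\<^bsub>R\<^esub> a) \<rparr>"

definition free_coiso_module ::
  "('a, 'b) coiso_alg \<Rightarrow> ('i, 'j) coiso_index \<Rightarrow> ('a, 'b, 'i \<Rightarrow> 'a, 'j \<Rightarrow> 'b) coiso_mod" where
  "free_coiso_module A S = \<lparr>
     mod_tot = free_module (alg_tot A) (idx_tot S),
     mod_N = free_module (alg_N A) (idx_N S),
     mod_0 = carrier (free_module (alg_N A) (idx_0 S))
       <+>\<^bsub>free_module (alg_N A) (idx_N S)\<^esub>
         {f \<in> carrier (free_module (alg_N A) (idx_N S)). \<forall>j\<in>idx_N S. f j \<in> alg_0 A},
     mod_map = (\<lambda>f i. \<Oplus>\<^bsub>alg_tot A\<^esub>j\<in>{j \<in> idx_N S. idx_map S j = i \<and> f j \<noteq> \<zero>\<^bsub>alg_N A\<^esub>}. alg_map A (f j)) \<rparr>"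

text \<open>
  HOL cannot quantify over all test modules E, F of arbitrary type inside a formula, so their
  carrier types are fixed to be large enough: with P they
  determine (if 'a and 'b have more than one element) a type of test modules that contains a copy
  of P itself and the free module on the index set with components
  carrier (mod_N P) + carrier (mod_tot P), carrier (mod_N P), mod_0 P and the left injection.
  That free module has the lifting property for test modules of every type and maps onto P by a
  regular epimorphism. Hence lifting against the test modules below makes P a retract of it, and
  gives lifting against all test modules.
\<close>

definition regular_projective ::
  "('a, 'b) coiso_alg \<Rightarrow> ('a, 'b, 'p, 'q) coiso_mod \<Rightarrow> bool" where
  "regular_projective A P \<longleftrightarrow> coisotropic_module A P \<and>
     (\<forall>(E :: ('a, 'b, 'q + 'p \<Rightarrow> 'a, 'q \<Rightarrow> 'b) coiso_mod)
       (F :: ('a, 'b, 'q + 'p \<Rightarrow> 'a, 'q \<Rightarrow> 'b) coiso_mod) \<Phi> \<Psi>.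
        coisotropic_module A E \<and> coisotropic_module A F \<and>
        coiso_morphism A P F \<Psi> \<and> regular_epi A E F \<Phi> \<longrightarrow>
        (\<exists>\<Theta>. coiso_morphism A P E \<Theta> \<and>
             (\<forall>x\<in>carrier (mod_tot P). fst \<Phi> (fst \<Theta> x) = fst \<Psi> x) \<and>
             (\<forall>x\<in>carrier (mod_N P). snd \<Phi> (snd \<Theta> x) = snd \<Psi> x)))"

text \<open>
  Finite index sets can be taken inside the natural numbers, and the complement E embeds into
  the free module; so the types below are no restriction.
\<close>

definition fin_gen_regular_projective ::
  "('a, 'b) coiso_alg \<Rightarrow> ('a, 'b, 'p, 'q) coiso_mod \<Rightarrow> bool" where
  "fin_gen_regular_projective A P \<longleftrightarrow> regular_projective A P \<and>
     (\<exists>(S :: (nat, nat) coiso_index) (E :: ('a, 'b, nat \<Rightarrow> 'a, nat \<Rightarrow> 'b) coiso_mod).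
        coisotropic_index_set S \<and> finite (idx_tot S) \<and> finite (idx_N S) \<and>
        inj_on (idx_map S) (idx_N S) \<and>
        coisotropic_module A E \<and> coiso_isomorphic A (free_coiso_module A S) (coiso_sum P E))"


section \<open>Smooth manifolds\<close>

text \<open>
  The model space of dimension n (including n = 0) is the set of sequences vanishing from
  index n on, as in \<^const>\<open>Euclidean_space\<close>. The domain V below is an open subset of it.
\<close>

primrec Ck_on :: "nat \<Rightarrow> nat \<Rightarrow> (nat \<Rightarrow> real) set \<Rightarrow> ((nat \<Rightarrow> real) \<Rightarrow> real) \<Rightarrow> bool" where
  "Ck_on n 0 V f \<longleftrightarrow> continuous_on V f"
| "Ck_on n (Suc k) V f \<longleftrightarrow> continuous_on V f \<and>
     (\<forall>i<n. (\<forall>x\<in>V. (\<lambda>t. f (x(i := t))) field_differentiable (at (x i))) \<and>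
            Ck_on n k V (\<lambda>x. deriv (\<lambda>t. f (x(i := t))) (x i)))"

definition smooth_on :: "nat \<Rightarrow> (nat \<Rightarrow> real) set \<Rightarrow> ((nat \<Rightarrow> real) \<Rightarrow> real) \<Rightarrow> bool" where
  "smooth_on n V f \<longleftrightarrow> (\<forall>k. Ck_on n k V f)"

record 'm manifold =
  mtop :: "'m topology"
  mdim :: nat
  atlas :: "('m set \<times> ('m \<Rightarrow> nat \<Rightarrow> real)) set"

abbreviation points :: "'m manifold \<Rightarrow> 'm set" where
  "points M \<equiv> topspace (mtop M)"

definition smooth_manifold :: "'m manifold \<Rightarrow> bool" where
  "smooth_manifold M \<longleftrightarrow>
     Hausdorff_space (mtop M) \<and> second_countable (mtop M) \<and>
     (\<forall>(U, \<phi>)\<in>atlas M. openin (mtop M) U \<and> openin (Euclidean_space (mdim M)) (\<phi> ` U) \<and>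
        homeomorphic_map (subtopology (mtop M) U) (subtopology (Euclidean_space (mdim M)) (\<phi> ` U)) \<phi>) \<and>
     (\<Union>(U, \<phi>)\<in>atlas M. U) = points M \<and>
     (\<forall>(U, \<phi>)\<in>atlas M. \<forall>(U', \<phi>')\<in>atlas M. \<forall>i<mdim M.
        smooth_on (mdim M) (\<phi> ` (U \<inter> U')) (\<lambda>x. \<phi>' (inv_into U \<phi> x) i))"

definition smooth_fun_on :: "'m manifold \<Rightarrow> 'm set \<Rightarrow> ('m \<Rightarrow> real) \<Rightarrow> bool" where
  "smooth_fun_on M W f \<longleftrightarrow>
     (\<forall>(U, \<phi>)\<in>atlas M. smooth_on (mdim M) (\<phi> ` (U \<inter> W)) (\<lambda>x. f (inv_into U \<phi> x)))"

definition smooth_map_on :: "'m manifold \<Rightarrow> 'm set \<Rightarrow> 'n manifold \<Rightarrow> ('m \<Rightarrow> 'n) \<Rightarrow> bool" where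
  "smooth_map_on M W N F \<longleftrightarrow> continuous_map (subtopology (mtop M) W) (mtop N) F \<and>
     (\<forall>(U, \<phi>)\<in>atlas M. \<forall>(U', \<phi>')\<in>atlas N. \<forall>i<mdim N.
        smooth_on (mdim M) (\<phi> ` {p \<in> U \<inter> W. F p \<in> U'}) (\<lambda>x. \<phi>' (F (inv_into U \<phi> x)) i))"

text \<open>
  Functions and sections on a manifold are represented by total functions vanishing off it.
\<close>

definition smooth_functions :: "'m manifold \<Rightarrow> ('m \<Rightarrow> real) set" where
  "smooth_functions M = {f. smooth_fun_on M (points M) f \<and> (\<forall>p. p \<notin> points M \<longrightarrow> f p = 0)}"

definition pullback :: "'m manifold \<Rightarrow> ('m \<Rightarrow> 'n) \<Rightarrow> ('n \<Rightarrow> 'v::zero) \<Rightarrow> 'm \<Rightarrow> 'v" where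
  "pullback M F f = (\<lambda>p. if p \<in> points M then f (F p) else 0)"

text \<open>Tangent vectors at p are the derivations at p of the algebra of smooth functions.\<close>

type_synonym 'm tangent_vector = "('m \<Rightarrow> real) \<Rightarrow> real"

definition tangent_space :: "'m manifold \<Rightarrow> 'm \<Rightarrow> 'm tangent_vector set" where
  "tangent_space M p = {v.
     (\<forall>f. f \<notin> smooth_functions M \<longrightarrow> v f = 0) \<and>
     (\<forall>f\<in>smooth_functions M. \<forall>g\<in>smooth_functions M. \<forall>a b.
        v (\<lambda>q. a * f q + b * g q) = a * v f + b * v g) \<and>
     (\<forall>f\<in>smooth_functions M. \<forall>g\<in>smooth_functions M.
        v (\<lambda>q. f q * g q) = v f * g p + f p * v g)}"

definition differential ::
  "'m manifold \<Rightarrow> 'n manifold \<Rightarrow> ('m \<Rightarrow> 'n) \<Rightarrow> 'm tangent_vector \<Rightarrow> 'n tangent_vector" where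
  "differential M N F v = (\<lambda>g. if g \<in> smooth_functions N then v (pullback M F g) else 0)"

text \<open>
  Submanifolds are understood as injective immersions; embedded ones are a special case.
\<close>

definition injective_immersion :: "'m manifold \<Rightarrow> 'n manifold \<Rightarrow> ('m \<Rightarrow> 'n) \<Rightarrow> bool" where
  "injective_immersion M N F \<longleftrightarrow> smooth_map_on M (points M) N F \<and> inj_on F (points M) \<and>
     (\<forall>p\<in>points M. inj_on (differential M N F) (tangent_space M p))"

definition vector_fields :: "'m manifold \<Rightarrow> ('m \<Rightarrow> 'm tangent_vector) set" where
  "vector_fields M = {Y. (\<forall>p\<in>points M. Y p \<in> tangent_space M p) \<and>
     (\<forall>f\<in>smooth_functions M. (\<lambda>p. if p \<in> points M then Y p f else 0) \<in> smooth_functions M)}"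


section \<open>Singular distributions and their leaves\<close>

definition dist_sections ::
  "'c manifold \<Rightarrow> ('c \<Rightarrow> 'c tangent_vector set) \<Rightarrow> ('c \<Rightarrow> 'c tangent_vector) set" where
  "dist_sections C D = {Y \<in> vector_fields C. \<forall>p\<in>points C. Y p \<in> D p}"

text \<open>
  By cutting off, it is the same to ask for vector fields defined near p in the last condition.
\<close>

definition smooth_distribution :: "'c manifold \<Rightarrow> ('c \<Rightarrow> 'c tangent_vector set) \<Rightarrow> bool" where
  "smooth_distribution C D \<longleftrightarrow>
     (\<forall>p\<in>points C. D p \<subseteq> tangent_space C p \<and> (\<lambda>f. 0) \<in> D p \<and>
        (\<forall>v\<in>D p. \<forall>w\<in>D p. \<forall>a b. (\<lambda>f. a * v f + b * w f) \<in> D p) \<and>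
        (\<forall>v\<in>D p. \<exists>Y\<in>dist_sections C D. Y p = v))"

text \<open>An integral manifold is a subset of C with its own topology and smooth structure.\<close>

definition integral_manifold ::
  "'c manifold \<Rightarrow> ('c \<Rightarrow> 'c tangent_vector set) \<Rightarrow> 'c manifold \<Rightarrow> bool" where
  "integral_manifold C D L \<longleftrightarrow>
     smooth_manifold L \<and> connected_space (mtop L) \<and> points L \<noteq> {} \<and> points L \<subseteq> points C \<and>
     injective_immersion L C (\<lambda>p. p) \<and>
     (\<forall>p\<in>points L. differential L C (\<lambda>p. p) ` tangent_space L p = D p)"

text \<open>
  Maximality and integrability in the sense of Sussmann: every integral manifold that meets a
  maximal one is an open submanifold of it, and a maximal one passes through every point.
\<close>

definition maximal_integral_manifold ::
  "'c manifold \<Rightarrow> ('c \<Rightarrow> 'c tangent_vector set) \<Rightarrow> 'c manifold \<Rightarrow> bool" where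
  "maximal_integral_manifold C D L \<longleftrightarrow> integral_manifold C D L \<and>
     (\<forall>L'. integral_manifold C D L' \<and> points L' \<inter> points L \<noteq> {} \<longrightarrow>
        openin (mtop L) (points L') \<and> mtop L' = subtopology (mtop L) (points L'))"

definition integrable_distribution :: "'c manifold \<Rightarrow> ('c \<Rightarrow> 'c tangent_vector set) \<Rightarrow> bool" where
  "integrable_distribution C D \<longleftrightarrow>
     (\<forall>p\<in>points C. \<exists>L. maximal_integral_manifold C D L \<and> p \<in> points L)"

definition leaves :: "'c manifold \<Rightarrow> ('c \<Rightarrow> 'c tangent_vector set) \<Rightarrow> 'c set set" where
  "leaves C D = {points L | L. maximal_integral_manifold C D L}"

definition leaf_of :: "'c manifold \<Rightarrow> ('c \<Rightarrow> 'c tangent_vector set) \<Rightarrow> 'c \<Rightarrow> 'c set" where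
  "leaf_of C D p = (THE S. S \<in> leaves C D \<and> p \<in> S)"

lemma maximal_integral_manifold_unique:
  assumes "maximal_integral_manifold C D L" "maximal_integral_manifold C D L'"
    and "p \<in> points L" "p \<in> points L'"
  shows "points L = points L'"
proof (rule subset_antisym)
  note max = assms(1,2)[unfolded maximal_integral_manifold_def]
  have ne: "points L' \<inter> points L \<noteq> {}" "points L \<inter> points L' \<noteq> {}"
    using assms(3,4) by blast+
  have "openin (mtop L') (points L)"
    using max(2)[THEN conjunct2, rule_format, OF conjI, OF max(1)[THEN conjunct1] ne(2)] by (rule conjunct1)
  then show "points L \<subseteq> points L'" by (rule openin_subset)
  have "openin (mtop L) (points L')"
    using max(1)[THEN conjunct2, rule_format, OF conjI, OF max(2)[THEN conjunct1] ne(1)] by (rule conjunct1)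
  then show "points L' \<subseteq> points L" by (rule openin_subset)
qed

lemma leaf_of_eq:
  assumes "S \<in> leaves C D" "p \<in> S"
  shows "leaf_of C D p = S"
  unfolding leaf_of_def
proof (rule the_equality)
  fix T assume T: "T \<in> leaves C D \<and> p \<in> T"
  obtain L where L: "T = points L" "maximal_integral_manifold C D L"
    using T unfolding leaves_def by blast
  obtain L' where L': "S = points L'" "maximal_integral_manifold C D L'"
    using assms(1) unfolding leaves_def by blast
  show "T = S"
    unfolding L(1) L'(1)
    by (rule maximal_integral_manifold_unique[OF L(2) L'(2)]) (use T assms(2) L(1) L'(1) in simp_all)
qed (use assms in simp)

definition leaf_space :: "'c manifold \<Rightarrow> ('c \<Rightarrow> 'c tangent_vector set) \<Rightarrow> 'c set topology" where
  "leaf_space C D = topology (\<lambda>V. V \<subseteq> leaves C D \<and> openin (mtop C) {p \<in> points C. leaf_of C D p \<in> V})"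

lemma openin_leaf_space:
  "openin (leaf_space C D) V \<longleftrightarrow>
     V \<subseteq> leaves C D \<and> openin (mtop C) {p \<in> points C. leaf_of C D p \<in> V}"
proof -
  let ?op = "\<lambda>V. V \<subseteq> leaves C D \<and> openin (mtop C) {p \<in> points C. leaf_of C D p \<in> V}"
  have "istopology ?op"
    unfolding istopology_def
  proof (intro conjI allI impI)
    fix S T assume S: "?op S" and T: "?op T"
    show "S \<inter> T \<subseteq> leaves C D" using S by blast
    have "{p \<in> points C. leaf_of C D p \<in> S \<inter> T} =
        {p \<in> points C. leaf_of C D p \<in> S} \<inter> {p \<in> points C. leaf_of C D p \<in> T}" by blast
    then show "openin (mtop C) {p \<in> points C. leaf_of C D p \<in> S \<inter> T}"
      using S T by (simp add: openin_Int)
  next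
    fix K assume K: "\<forall>S\<in>K. ?op S"
    then show "\<Union>K \<subseteq> leaves C D" by blast
    have "openin (mtop C) (\<Union>S\<in>K. {p \<in> points C. leaf_of C D p \<in> S})"
      using K by (intro openin_Union) blast
    also have "(\<Union>S\<in>K. {p \<in> points C. leaf_of C D p \<in> S}) = {p \<in> points C. leaf_of C D p \<in> \<Union>K}"
      by blast
    finally show "openin (mtop C) {p \<in> points C. leaf_of C D p \<in> \<Union>K}" .
  qed
  then show ?thesis unfolding leaf_space_def by (rule fun_cong[OF topology_inverse'])
qed

lemma topspace_leaf_space:
  assumes "integrable_distribution C D"
  shows "topspace (leaf_space C D) = leaves C D"
proof -
  have "leaf_of C D p \<in> leaves C D" if p: "p \<in> points C" for p
  proof -
    obtain L where L: "maximal_integral_manifold C D L" "p \<in> points L"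
      using assms p unfolding integrable_distribution_def by blast
    then have S: "points L \<in> leaves C D"
      unfolding leaves_def by blast
    show ?thesis
      unfolding leaf_of_eq[OF S L(2)] by (rule S)
  qed
  then have "{p \<in> points C. leaf_of C D p \<in> leaves C D} = points C"
    by blast
  then have "openin (leaf_space C D) (leaves C D)"
    by (simp only: openin_leaf_space openin_topspace subset_refl simp_thms)
  moreover have "topspace (leaf_space C D) \<subseteq> leaves C D"
    by (rule conjunct1[OF openin_leaf_space[THEN iffD1, OF openin_topspace]])
  ultimately show ?thesis
    by (intro subset_antisym) (auto dest: openin_subset)
qed


section \<open>The coisotropic algebra of a submanifold with a distribution\<close>

definition function_algebra :: "'m manifold \<Rightarrow> ('m \<Rightarrow> real) set \<Rightarrow> (real, 'm \<Rightarrow> real) module" where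
  "function_algebra M A = \<lparr> carrier = A, mult = (\<lambda>f g p. f p * g p),
     one = (\<lambda>p. if p \<in> points M then 1 else 0), zero = (\<lambda>p. 0), add = (\<lambda>f g p. f p + g p),
     smult = (\<lambda>r f p. r * f p) \<rparr>"

definition leafwise_constant_functions ::
  "'c manifold \<Rightarrow> ('c \<Rightarrow> 'c tangent_vector set) \<Rightarrow> ('c \<Rightarrow> real) set" where
  "leafwise_constant_functions C D =
     {f \<in> smooth_functions C. \<forall>S\<in>leaves C D. \<forall>p\<in>S. \<forall>q\<in>S. f p = f q}"

definition coiso_functions ::
  "'m manifold \<Rightarrow> 'c manifold \<Rightarrow> ('c \<Rightarrow> 'm) \<Rightarrow> ('c \<Rightarrow> 'c tangent_vector set) \<Rightarrow>
   ('m \<Rightarrow> real, 'm \<Rightarrow> real) coiso_alg" where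
  "coiso_functions M C \<iota> D = \<lparr>
     alg_tot = function_algebra M (smooth_functions M),
     alg_N = function_algebra M
       {f \<in> smooth_functions M. pullback C \<iota> f \<in> leafwise_constant_functions C D},
     alg_0 = {f \<in> smooth_functions M. pullback C \<iota> f = (\<lambda>c. 0)},
     alg_map = (\<lambda>f. f) \<rparr>"


section \<open>Vector bundles\<close>

text \<open>
  The total space is the disjoint union of the fibres, each of which is (identified with) a linear
  subspace of an ambient vector space 'v that is only a container: no compatibility between
  fibres over different points is assumed. The topology and smooth structure come from the local
  trivializations: (U, t) stands for the map sending (p, v) with p in U to (p, t p v).
\<close>

record ('m, 'v) vbundle =
  rank :: nat
  fibre :: "'m \<Rightarrow> 'v set"
  trivs :: "('m set \<times> ('m \<Rightarrow> 'v \<Rightarrow> nat \<Rightarrow> real)) set"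

text \<open>
  A container with subspaces of every finite dimension (finitely supported real sequences): every
  vector bundle is isomorphic to one with fibres in it.
\<close>

type_synonym fin_seq = "(nat, real) poly_mapping"

definition frame :: "('m, 'v) vbundle \<Rightarrow> ('m \<Rightarrow> 'v \<Rightarrow> nat \<Rightarrow> real) \<Rightarrow> nat \<Rightarrow> 'm \<Rightarrow> 'v" where
  "frame E t j p = inv_into (fibre E p) (t p) (\<lambda>i. if i = j then 1 else 0)"

definition smooth_section_on ::
  "'m manifold \<Rightarrow> ('m, 'v) vbundle \<Rightarrow> 'm set \<Rightarrow> ('m \<Rightarrow> 'v) \<Rightarrow> bool" where
  "smooth_section_on M E W s \<longleftrightarrow> (\<forall>p\<in>W. s p \<in> fibre E p) \<and>
     (\<forall>(U, t)\<in>trivs E. \<forall>i<rank E. smooth_fun_on M (U \<inter> W) (\<lambda>p. t p (s p) i))"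

definition vector_bundle :: "'m manifold \<Rightarrow> ('m, 'v::real_vector) vbundle \<Rightarrow> bool" where
  "vector_bundle M E \<longleftrightarrow>
     (\<forall>p\<in>points M. subspace (fibre E p)) \<and>
     (\<forall>(U, t)\<in>trivs E. openin (mtop M) U \<and>
        (\<forall>p\<in>U. bij_betw (t p) (fibre E p) (topspace (Euclidean_space (rank E))) \<and>
          (\<forall>v\<in>fibre E p. \<forall>w\<in>fibre E p. \<forall>a b i.
             t p (a *\<^sub>R v + b *\<^sub>R w) i = a * t p v i + b * t p w i))) \<and>
     (\<Union>(U, t)\<in>trivs E. U) = points M \<and>
     (\<forall>(U, t)\<in>trivs E. \<forall>(U', t')\<in>trivs E. \<forall>j<rank E. \<forall>i<rank E.
        smooth_fun_on M (U \<inter> U') (\<lambda>p. t' p (frame E t j p) i))"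

definition sections :: "'m manifold \<Rightarrow> ('m, 'v::real_vector) vbundle \<Rightarrow> ('m \<Rightarrow> 'v) set" where
  "sections M E = {s. smooth_section_on M E (points M) s \<and> (\<forall>p. p \<notin> points M \<longrightarrow> s p = 0)}"

text \<open>The third condition says that the inclusion of F into E is smooth.\<close>

definition subbundle ::
  "'m manifold \<Rightarrow> ('m, 'v::real_vector) vbundle \<Rightarrow> ('m, 'v) vbundle \<Rightarrow> bool" where
  "subbundle M F E \<longleftrightarrow> vector_bundle M F \<and> (\<forall>p\<in>points M. fibre F p \<subseteq> fibre E p) \<and>
     (\<forall>(U, t)\<in>trivs F. \<forall>j<rank F. smooth_section_on M E U (frame F t j))"

definition pullback_bundle ::
  "'c manifold \<Rightarrow> ('c \<Rightarrow> 'm) \<Rightarrow> ('m, 'v) vbundle \<Rightarrow> ('c, 'v) vbundle" where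
  "pullback_bundle C \<iota> E = \<lparr> rank = rank E, fibre = (\<lambda>c. fibre E (\<iota> c)),
     trivs = (\<lambda>(U, t). ({c \<in> points C. \<iota> c \<in> U}, \<lambda>c. t (\<iota> c))) ` trivs E \<rparr>"


section \<open>D-connections\<close>

text \<open>nabla p v s is the derivative of the section s in the direction of the tangent vector v at p.\<close>

type_synonym ('c, 'v) connection = "'c \<Rightarrow> 'c tangent_vector \<Rightarrow> ('c \<Rightarrow> 'v) \<Rightarrow> 'v"

definition covariant_derivative ::
  "'c manifold \<Rightarrow> ('c, 'v::real_vector) vbundle \<Rightarrow> ('c, 'v) connection \<Rightarrow> bool" where
  "covariant_derivative C E nabla \<longleftrightarrow>
     (\<forall>p\<in>points C. \<forall>v\<in>tangent_space C p. \<forall>s\<in>sections C E.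
        nabla p v s \<in> fibre E p \<and>
        (\<forall>w\<in>tangent_space C p. \<forall>a b.
           nabla p (\<lambda>f. a * v f + b * w f) s = a *\<^sub>R nabla p v s + b *\<^sub>R nabla p w s) \<and>
        (\<forall>s'\<in>sections C E. \<forall>a b.
           nabla p v (\<lambda>q. a *\<^sub>R s q + b *\<^sub>R s' q) = a *\<^sub>R nabla p v s + b *\<^sub>R nabla p v s') \<and>
        (\<forall>f\<in>smooth_functions C.
           nabla p v (\<lambda>q. f q *\<^sub>R s q) = v f *\<^sub>R s p + f p *\<^sub>R nabla p v s)) \<and>
     (\<forall>Y\<in>vector_fields C. \<forall>s\<in>sections C E.
        (\<lambda>p. if p \<in> points C then nabla p (Y p) s else 0) \<in> sections C E)"

text \<open>Only the values of nabla on D and on smooth sections are meaningful.\<close>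

definition D_connection ::
  "'c manifold \<Rightarrow> ('c \<Rightarrow> 'c tangent_vector set) \<Rightarrow> ('c, 'v::real_vector) vbundle \<Rightarrow>
   ('c, 'v) connection \<Rightarrow> bool" where
  "D_connection C D E nabla \<longleftrightarrow> (\<exists>nabla'. covariant_derivative C E nabla' \<and>
     (\<forall>p\<in>points C. \<forall>v\<in>D p. \<forall>s\<in>sections C E. nabla p v s = nabla' p v s))"

definition real_line :: "real manifold" where
  "real_line = \<lparr> mtop = euclidean, mdim = 1, atlas = {(UNIV, \<lambda>t i. if i = 0 then t else 0)} \<rparr>"

definition curve_in :: "'m manifold \<Rightarrow> (real \<Rightarrow> 'm) \<Rightarrow> bool" where
  "curve_in L \<gamma> \<longleftrightarrow> (\<exists>I. open I \<and> {0..1} \<subseteq> I \<and> smooth_map_on real_line I L \<gamma>)"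

definition velocity :: "'c manifold \<Rightarrow> (real \<Rightarrow> 'c) \<Rightarrow> real \<Rightarrow> 'c tangent_vector" where
  "velocity C \<gamma> t = (\<lambda>f. if f \<in> smooth_functions C then deriv (\<lambda>u. f (\<gamma> u)) t else 0)"

text \<open>
  The covariant derivative at time t of a section s along \<open>\<gamma>\<close> is w. It is computed from a local
  representation of s as a combination, with coefficients depending on time, of sections of E
  restricted to \<open>\<gamma>\<close>; the value does not depend on the representation. Such a representation exists
  near t whenever s is smooth: use global sections that form a frame of E near \<open>\<gamma> t\<close>.
\<close>

definition covariant_derivative_along ::
  "'c manifold \<Rightarrow> ('c, 'v::real_vector) vbundle \<Rightarrow> ('c, 'v) connection \<Rightarrow> (real \<Rightarrow> 'c) \<Rightarrow>
   (real \<Rightarrow> 'v) \<Rightarrow> real \<Rightarrow> 'v \<Rightarrow> bool" where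
  "covariant_derivative_along C E nabla \<gamma> s t w \<longleftrightarrow>
     (\<exists>J (r::nat) \<sigma> a. open J \<and> t \<in> J \<and>
        (\<forall>i<r. \<sigma> i \<in> sections C E \<and> smooth_fun_on real_line J (a i)) \<and>
        (\<forall>u\<in>J. s u = (\<Sum>i<r. a i u *\<^sub>R \<sigma> i (\<gamma> u))) \<and>
        w = (\<Sum>i<r. deriv (a i) t *\<^sub>R \<sigma> i (\<gamma> t) + a i t *\<^sub>R nabla (\<gamma> t) (velocity C \<gamma> t) (\<sigma> i)))"

definition parallel_transport ::
  "'c manifold \<Rightarrow> ('c, 'v::real_vector) vbundle \<Rightarrow> ('c, 'v) connection \<Rightarrow> (real \<Rightarrow> 'c) \<Rightarrow>
   'v \<Rightarrow> 'v \<Rightarrow> bool" where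
  "parallel_transport C E nabla \<gamma> v w \<longleftrightarrow>
     (\<exists>s. (\<forall>t\<in>{0..1}. covariant_derivative_along C E nabla \<gamma> s t 0) \<and> s 0 = v \<and> s 1 = w)"

text \<open>Curves inside a leaf are smooth for the smooth structure of the leaf.\<close>

definition holonomy_free ::
  "'c manifold \<Rightarrow> ('c \<Rightarrow> 'c tangent_vector set) \<Rightarrow> ('c, 'v::real_vector) vbundle \<Rightarrow>
   ('c, 'v) connection \<Rightarrow> bool" where
  "holonomy_free C D E nabla \<longleftrightarrow>
     (\<forall>L \<gamma> \<gamma>' v w w'. maximal_integral_manifold C D L \<and> curve_in L \<gamma> \<and> curve_in L \<gamma>' \<and>
        \<gamma> 0 = \<gamma>' 0 \<and> \<gamma> 1 = \<gamma>' 1 \<and>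
        parallel_transport C E nabla \<gamma> v w \<and> parallel_transport C E nabla \<gamma>' v w' \<longrightarrow> w = w')"

definition closed_under ::
  "'c manifold \<Rightarrow> ('c \<Rightarrow> 'c tangent_vector set) \<Rightarrow> ('c, 'v::real_vector) connection \<Rightarrow>
   ('c, 'v) vbundle \<Rightarrow> bool" where
  "closed_under C D nabla F \<longleftrightarrow> (\<forall>Y\<in>dist_sections C D. \<forall>s\<in>sections C F.
     (\<lambda>p. if p \<in> points C then nabla p (Y p) s else 0) \<in> sections C F)"


section \<open>The triple of invariant sections\<close>

definition section_module :: "('m \<Rightarrow> 'v::real_vector) set \<Rightarrow> ('m \<Rightarrow> real, 'm \<Rightarrow> 'v) module" where
  "section_module A = \<lparr> carrier = A, mult = undefined, one = undefined, zero = (\<lambda>p. 0),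
     add = (\<lambda>s s' p. s p + s' p), smult = (\<lambda>f s p. f p *\<^sub>R s p) \<rparr>"

definition invariant_sections ::
  "'m manifold \<Rightarrow> 'c manifold \<Rightarrow> ('c \<Rightarrow> 'm) \<Rightarrow> ('c \<Rightarrow> 'c tangent_vector set) \<Rightarrow>
   ('m, 'v::real_vector) vbundle \<Rightarrow> ('c, 'v) connection \<Rightarrow> ('m \<Rightarrow> 'v) set" where
  "invariant_sections M C \<iota> D EN nabla =
     {s \<in> sections M EN. \<forall>Y\<in>dist_sections C D. \<forall>p\<in>points C. nabla p (Y p) (pullback C \<iota> s) = 0}"

definition section_triple ::
  "'m manifold \<Rightarrow> 'c manifold \<Rightarrow> ('c \<Rightarrow> 'm) \<Rightarrow> ('c \<Rightarrow> 'c tangent_vector set) \<Rightarrow>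
   ('m, 'v::real_vector) vbundle \<Rightarrow> ('m, 'v) vbundle \<Rightarrow> ('c, 'v) vbundle \<Rightarrow> ('c, 'v) connection \<Rightarrow>
   ('m \<Rightarrow> real, 'm \<Rightarrow> real, 'm \<Rightarrow> 'v, 'm \<Rightarrow> 'v) coiso_mod" where
  "section_triple M C \<iota> D Etot EN E0 nabla = \<lparr>
     mod_tot = section_module (sections M Etot),
     mod_N = section_module (invariant_sections M C \<iota> D EN nabla),
     mod_0 = {s \<in> invariant_sections M C \<iota> D EN nabla. pullback C \<iota> s \<in> sections C E0},
     mod_map = (\<lambda>s. s) \<rparr>"

text \<open>\<open>E = F \<oplus> F'\<close> and \<open>nabla = nabla' \<oplus> nabla''\<close> as D-connections.\<close>

definition bundle_direct_sum ::
  "'c manifold \<Rightarrow> ('c, 'v::real_vector) vbundle \<Rightarrow> ('c, 'v) vbundle \<Rightarrow> ('c, 'v) vbundle \<Rightarrow> bool" where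
  "bundle_direct_sum C E F F' \<longleftrightarrow> subbundle C F E \<and> subbundle C F' E \<and>
     (\<forall>p\<in>points C. fibre F p \<inter> fibre F' p = {0} \<and>
        fibre E p = {v + w | v w. v \<in> fibre F p \<and> w \<in> fibre F' p})"

definition connection_direct_sum ::
  "'c manifold \<Rightarrow> ('c \<Rightarrow> 'c tangent_vector set) \<Rightarrow> ('c, 'v::real_vector) vbundle \<Rightarrow>
   ('c, 'v) vbundle \<Rightarrow> ('c, 'v) connection \<Rightarrow> ('c, 'v) connection \<Rightarrow> ('c, 'v) connection \<Rightarrow> bool"
  where
  "connection_direct_sum C D F F' nabla nabla' nabla'' \<longleftrightarrow>
     (\<forall>p\<in>points C. \<forall>v\<in>D p. \<forall>s\<in>sections C F. \<forall>s'\<in>sections C F'.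
        nabla p v (\<lambda>q. s q + s' q) = nabla' p v s + nabla'' p v s')"

end

theory Submission
  imports Defs "Jordan_Normal_Form.Determinant"
begin

text \<open>
  Being a direct summand of a free module, \<open>P\<close> is the image of an idempotent endomorphism of it, that
  is, of a matrix \<open>e\<^sub>t\<close> of smooth functions on \<open>M\<close> that restricts to an idempotent matrix \<open>e\<^sub>N\<close> of
  functions whose restrictions to \<open>C\<close> are leafwise constant, and that on \<open>C\<close> preserves the coordinates
  in the index set \<open>S\<^sub>0\<close>. The bundles are the pointwise images of these matrices in a trivial bundle;
  their ranks are the traces, which are continuous and integer-valued, hence constant as \<open>M\<close> and
  \<open>C/D\<close> are connected. If \<open>\<pi>\<close> is the coordinate projection for \<open>S\<^sub>0\<close>, then \<open>q = e\<^sub>N \<pi> e\<^sub>N\<close> is on \<open>C\<close> an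
  idempotent that commutes with \<open>e\<^sub>N\<close>, with image \<open>E\<^sub>0\<close>, and \<open>e\<^sub>N - q\<close> gives the complement. The
  connection is \<open>e\<^sub>N\<close> applied to the componentwise derivative. As \<open>e\<^sub>N\<close> is constant along the leaves, in
  directions of \<open>D\<close> it is the componentwise derivative itself: parallel transport does not change the
  components, and the invariant sections are those with leafwise constant components.
\<close>

section \<open>Smooth functions on open subsets of the model space\<close>

text \<open>The structure map of the free module reindexes along an injective map, and the
  endomorphism commutes with it. Hence \<open>e\<^sub>t\<close> maps the coordinates in
  \<open>S\<^sub>N\<close> to themselves everywhere on \<open>M\<close>, \<open>e\<^sub>N\<close> is
  \<open>e\<^sub>t\<close> with the other columns deleted, and the fibres of the second bundle are
  subspaces of those of the first inside one common space. The coordinates in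
  \<open>S\<^sub>0\<close> are stable only modulo functions vanishing on \<open>C\<close>, so
  \<open>E\<^sub>0\<close> exists over \<open>C\<close> alone. There stability reads \<pi> e \<pi> =
  e \<pi>, whence q q = e \<pi> e \<pi> e = e \<pi> e = q and e q = q = q e; so e - q is idempotent
  too. The trace is smooth in the point, and it is the dimension of the image because an idempotent
  factors as B K with K B = 1. As \<open>C\<close> may be disconnected, the trace is viewed over
  \<open>C\<close> as a function on the leaf space. The connection becomes the plain derivative
  along \<open>D\<close> by the Leibniz rule: if v is a direction in which e does not change,
  differentiating s = e s gives v s = e (v s).\<close>

lemma Euclidean_space_top_of_set: "Euclidean_space n = top_of_set {x. \<forall>i\<ge>n. x i = 0}"
  by (simp add: Euclidean_space_def euclidean_product_topology)

lemma openin_Euclidean_spaceE: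
  assumes "openin (Euclidean_space n) V"
  obtains W where "open W" "V = W \<inter> {x. \<forall>i\<ge>n. x i = 0}"
  using assms unfolding Euclidean_space_top_of_set openin_open by blast

lemma openin_Euclidean_space_zero:
  "openin (Euclidean_space n) V \<Longrightarrow> x \<in> V \<Longrightarrow> n \<le> i \<Longrightarrow> x i = 0"
  by (auto elim: openin_Euclidean_spaceE)

text \<open>Partial derivatives see \<open>V\<close> only along coordinate lines. That such a line
  stays in \<open>V\<close> near \<open>x i\<close> lets statements on \<open>V\<close> pass to
  derivatives.\<close>

lemma eventually_fun_upd_in:
  assumes V: "openin (Euclidean_space n) V" and x: "x \<in> V" and i: "i < n"
  shows "\<forall>\<^sub>F t in nhds (x i). x(i := t) \<in> V"
proof -
  obtain W where W: "open W" "V = W \<inter> {x. \<forall>i\<ge>n. x i = 0}"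
    using V by (rule openin_Euclidean_spaceE)
  have "continuous_on UNIV (\<lambda>t. x(i := t))"
  proof (rule continuous_on_coordinatewise_then_product)
    show "continuous_on UNIV (\<lambda>t. (x(i := t)) j)" for j by (cases "j = i") simp_all
  qed
  then have "open ((\<lambda>t. x(i := t)) -` W)"
    using W(1) by (simp add: open_vimage)
  moreover have "x i \<in> (\<lambda>t. x(i := t)) -` W" using x W by simp
  ultimately have "\<forall>\<^sub>F t in nhds (x i). t \<in> (\<lambda>t. x(i := t)) -` W"
    by (rule eventually_nhds_in_open)
  then show ?thesis
    by eventually_elim (use x W i in auto)
qed

text \<open>The coordinates from \<open>n\<close> on are zero throughout, so only \<open>n\<close>
  coordinates have to be controlled and one radius serves for all of them. Such boxes are convex, as
  mean value arguments need.\<close>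

lemma Euclidean_space_box:
  assumes V: "openin (Euclidean_space n) V" and x: "x \<in> V"
  obtains \<delta> where "\<delta> > 0" "\<And>z. (\<And>j. n \<le> j \<Longrightarrow> z j = 0) \<Longrightarrow> (\<And>j. j < n \<Longrightarrow> \<bar>z j - x j\<bar> < \<delta>) \<Longrightarrow> z \<in> V"
proof -
  obtain W where W: "open W" "V = W \<inter> {x. \<forall>i\<ge>n. x i = 0}"
    using V by (rule openin_Euclidean_spaceE)
  have "openin (product_topology (\<lambda>i. euclidean) UNIV) W"
    using W(1) by (simp add: euclidean_product_topology)
  then obtain B where B: "x \<in> PiE UNIV B" "\<And>i. open (B i)" "PiE UNIV B \<subseteq> W"
    using product_topology_open_contains_basis[of "\<lambda>i. euclidean" UNIV W x] x W(2) by fastforce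
  have ex: "\<exists>d>0. \<forall>s. \<bar>s - x j\<bar> < d \<longrightarrow> s \<in> B j" for j
  proof -
    have "x j \<in> B j" using B(1) by auto
    then obtain d where "d > 0" "ball (x j) d \<subseteq> B j"
      using B(2) open_contains_ball by blast
    then show ?thesis by (auto simp: ball_def dist_real_def subset_iff abs_minus_commute)
  qed
  have "\<forall>\<^sub>F d in at_right 0. \<forall>j\<in>{..<n}. \<forall>s. \<bar>s - x j\<bar> < d \<longrightarrow> s \<in> B j"
  proof (rule eventually_ball_finite; safe?)
    fix j
    obtain d where d: "d > 0" "\<And>s. \<bar>s - x j\<bar> < d \<Longrightarrow> s \<in> B j" using ex by blast
    show "\<forall>\<^sub>F d in at_right 0. \<forall>s. \<bar>s - x j\<bar> < d \<longrightarrow> s \<in> B j"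
      using eventually_at_right_less[of 0] d
      unfolding eventually_at_right_field by (intro exI[of _ d]) auto
  qed
  then obtain d where d: "d > 0" "\<forall>y>0. y < d \<longrightarrow> (\<forall>j\<in>{..<n}. \<forall>s. \<bar>s - x j\<bar> < y \<longrightarrow> s \<in> B j)"
    unfolding eventually_at_right_field by auto
  show thesis
  proof (rule that[of "d/2"])
    fix z assume z0: "\<And>j. n \<le> j \<Longrightarrow> z j = 0" and z: "\<And>j. j < n \<Longrightarrow> \<bar>z j - x j\<bar> < d/2"
    have "z j \<in> B j" for j
    proof (cases "j < n")
      case True then show ?thesis using d z[OF True] by (auto dest: spec[of _ "d/2"])
    next
      case False
      then have "z j = x j" using z0 openin_Euclidean_space_zero[OF V x] by simp
      then show ?thesis using B(1) by auto
    qed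
    then have "z \<in> W" using B(3) by auto
    then show "z \<in> V" using W(2) z0 by auto
  qed (use d in auto)
qed

section \<open>Partial derivatives and the calculus of class C^k\<close>

definition partial :: "nat \<Rightarrow> ((nat \<Rightarrow> real) \<Rightarrow> real) \<Rightarrow> (nat \<Rightarrow> real) \<Rightarrow> real" where
  "partial i f x = deriv (\<lambda>t. f (x(i := t))) (x i)"

text \<open>Differentiability and \<open>deriv\<close> are merged into one
  \<open>has_real_derivative\<close> statement, the form that derivative rules produce. It replaces
  the defining equation, which is taken out of the simplifier below.\<close>

lemma Ck_on_Suc:
  "Ck_on n (Suc k) V f \<longleftrightarrow> continuous_on V f \<and>
    (\<forall>i<n. (\<forall>x\<in>V. ((\<lambda>t. f (x(i := t))) has_real_derivative partial i f x) (at (x i))) \<and>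
      Ck_on n k V (partial i f))"
  by (auto simp: partial_def[abs_def] field_differentiable_derivI field_differentiable_def
      DERIV_imp_deriv)

declare Ck_on.simps(2) [simp del]

lemma Ck_on_imp_continuous_on: "Ck_on n k V f \<Longrightarrow> continuous_on V f"
  by (cases k) (auto simp: Ck_on_Suc)

lemma Ck_on_lower: "Ck_on n (Suc k) V f \<Longrightarrow> Ck_on n k V f"
  by (induction k arbitrary: f) (auto simp: Ck_on_Suc)

lemma Ck_on_subset: "Ck_on n k V f \<Longrightarrow> W \<subseteq> V \<Longrightarrow> Ck_on n k W f"
  by (induction k arbitrary: f) (auto simp: Ck_on_Suc intro: continuous_on_subset)

text \<open>Since \<open>V\<close> is open, the two functions have the same germ along each
  coordinate line at each point of \<open>V\<close>. Their partial derivatives thus agree on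
  \<open>V\<close>, and the induction goes on with these.\<close>

lemma Ck_on_cong_imp:
  assumes V: "openin (Euclidean_space n) V" and "Ck_on n k V f" "\<And>x. x \<in> V \<Longrightarrow> f x = g x"
  shows "Ck_on n k V g"
  using assms(2-)
proof (induction k arbitrary: f g)
  case 0 then show ?case by (auto cong: continuous_on_cong)
next
  case (Suc k)
  have ev: "\<forall>\<^sub>F t in nhds (x i). f (x(i := t)) = g (x(i := t))" if "x \<in> V" "i < n" for x i
    using eventually_fun_upd_in[OF V that] by eventually_elim (use Suc in auto)
  have p: "partial i f x = partial i g x" if "x \<in> V" "i < n" for x i
    unfolding partial_def by (rule deriv_cong_ev[OF ev[OF that]]) simp
  show ?case
    unfolding Ck_on_Suc
  proof (intro conjI allI impI ballI)
    show "continuous_on V g"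
      using Ck_on_imp_continuous_on[OF Suc.prems(1)] Suc.prems(2) by (auto cong: continuous_on_cong)
  next
    fix i assume i: "i < n"
    show "Ck_on n k V (partial i g)"
      by (rule Suc.IH[of "partial i f"]) (use Suc.prems i p in \<open>auto simp: Ck_on_Suc\<close>)
    fix x assume x: "x \<in> V"
    have "((\<lambda>t. f (x(i := t))) has_real_derivative partial i f x) (at (x i))"
      using Suc.prems i x by (auto simp: Ck_on_Suc)
    then show "((\<lambda>t. g (x(i := t))) has_real_derivative partial i g x) (at (x i))"
      using DERIV_cong_ev[OF refl ev[OF x i] p[OF x i]] by simp
  qed
qed

lemma Ck_on_SucI:
  assumes V: "openin (Euclidean_space n) V" and "continuous_on V f"
    and d: "\<And>i x. i < n \<Longrightarrow> x \<in> V \<Longrightarrow> ((\<lambda>t. f (x(i := t))) has_real_derivative d i x) (at (x i))"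
    and "\<And>i. i < n \<Longrightarrow> Ck_on n k V (d i)"
  shows "Ck_on n (Suc k) V f"
  unfolding Ck_on_Suc
proof (intro conjI allI impI ballI)
  fix i assume i: "i < n"
  have p: "partial i f x = d i x" if "x \<in> V" for x
    unfolding partial_def by (rule DERIV_imp_deriv[OF d[OF i that]])
  show "Ck_on n k V (partial i f)"
    by (rule Ck_on_cong_imp[OF V assms(4)[OF i]]) (simp add: p)
  fix x assume x: "x \<in> V"
  show "((\<lambda>t. f (x(i := t))) has_real_derivative partial i f x) (at (x i))"
    using d[OF i x] p[OF x] by simp
qed fact

lemma Ck_on_const: "Ck_on n k V (\<lambda>x. c)"
proof (induction k arbitrary: c)
  case (Suc k)
  have "partial i (\<lambda>x. c) = (\<lambda>x. 0)" for i by (simp add: partial_def fun_eq_iff)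
  then show ?case using Suc by (auto simp: Ck_on_Suc)
qed simp

lemma Ck_on_add:
  assumes V: "openin (Euclidean_space n) V"
  shows "Ck_on n k V f \<Longrightarrow> Ck_on n k V g \<Longrightarrow> Ck_on n k V (\<lambda>x. f x + g x)"
proof (induction k arbitrary: f g)
  case 0 then show ?case by (auto intro: continuous_on_add)
next
  case (Suc k)
  show ?case
    by (rule Ck_on_SucI[OF V, where d = "\<lambda>i x. partial i f x + partial i g x"])
      (use Suc in \<open>auto simp: Ck_on_Suc simp del: fun_upd_apply intro!: continuous_on_add DERIV_add\<close>)
qed

lemma Ck_on_mult:
  assumes V: "openin (Euclidean_space n) V"
  shows "Ck_on n k V f \<Longrightarrow> Ck_on n k V g \<Longrightarrow> Ck_on n k V (\<lambda>x. f x * g x)"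
proof (induction k arbitrary: f g)
  case 0 then show ?case by (auto intro: continuous_on_mult)
next
  case (Suc k)
  show ?case
  proof (rule Ck_on_SucI[OF V, where d = "\<lambda>i x. partial i f x * g x + partial i g x * f x"])
    fix i x assume "i < n" "x \<in> V"
    then show "((\<lambda>t. f (x(i := t)) * g (x(i := t))) has_real_derivative
        partial i f x * g x + partial i g x * f x) (at (x i))"
      using DERIV_mult[of "\<lambda>t. f (x(i := t))" "partial i f x" "x i" UNIV "\<lambda>t. g (x(i := t))" "partial i g x"]
        Suc.prems by (simp add: Ck_on_Suc)
  next
    fix i assume "i < n"
    then show "Ck_on n k V (\<lambda>x. partial i f x * g x + partial i g x * f x)"
      \<comment> \<open>In each term of the product rule one factor stays undifferentiated and has
        to be lowered to order \<open>k\<close>.\<close>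
      using Suc.prems Ck_on_lower[OF Suc.prems(1)] Ck_on_lower[OF Suc.prems(2)]
      by (auto simp: Ck_on_Suc intro!: Ck_on_add[OF V] Suc.IH)
  qed (use Suc.prems in \<open>auto simp: Ck_on_Suc intro: continuous_on_mult\<close>)
qed

lemma Ck_on_sum:
  assumes V: "openin (Euclidean_space n) V"
  shows "(\<And>j. j \<in> J \<Longrightarrow> Ck_on n k V (f j)) \<Longrightarrow> Ck_on n k V (\<lambda>x. \<Sum>j\<in>J. f j x)"
  by (induction J rule: infinite_finite_induct) (auto intro: Ck_on_const Ck_on_add[OF V])

text \<open>The derivative - f' / f^2 is written with two factors \<open>inverse (f x)\<close>, so
  that the induction hypothesis for the inverse itself and the product rule give its
  regularity.\<close>

lemma Ck_on_inverse:
  assumes V: "openin (Euclidean_space n) V" and nz: "\<And>x. x \<in> V \<Longrightarrow> f x \<noteq> 0"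
  shows "Ck_on n k V f \<Longrightarrow> Ck_on n k V (\<lambda>x. inverse (f x))"
proof (induction k)
  case 0 then show ?case using nz by (auto intro: continuous_on_inverse)
next
  case (Suc k)
  show ?case
  proof (rule Ck_on_SucI[OF V, where d = "\<lambda>i x. (- 1) * (partial i f x * (inverse (f x) * inverse (f x)))"])
    fix i x assume "i < n" "x \<in> V"
    then show "((\<lambda>t. inverse (f (x(i := t)))) has_real_derivative
        (- 1) * (partial i f x * (inverse (f x) * inverse (f x)))) (at (x i))"
      using DERIV_inverse_fun[of "\<lambda>t. f (x(i := t))" "partial i f x" "x i" UNIV] nz[of x]
        Suc.prems by (auto simp: Ck_on_Suc power2_eq_square)
  next
    fix i assume "i < n"
    then show "Ck_on n k V (\<lambda>x. (- 1) * (partial i f x * (inverse (f x) * inverse (f x))))"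
      using Suc.prems Ck_on_lower[OF Suc.prems]
      by (intro Ck_on_mult[OF V] Ck_on_const Suc.IH) (auto simp: Ck_on_Suc)
  qed (use Suc.prems nz in \<open>auto simp: Ck_on_Suc intro: continuous_on_inverse\<close>)
qed

lemma Ck_on_coordinate: "i < n \<Longrightarrow> openin (Euclidean_space n) V \<Longrightarrow> Ck_on n k V (\<lambda>x. x i)"
proof (cases k)
  case 0 then show ?thesis by (auto intro: continuous_on_subset[OF continuous_on_product_coordinates])
next
  case (Suc k')
  assume i: "i < n" and V: "openin (Euclidean_space n) V"
  show ?thesis
    unfolding Suc
    by (rule Ck_on_SucI[OF V, where d = "\<lambda>j x. if j = i then 1 else 0"])
      (auto intro: Ck_on_const continuous_on_subset[OF continuous_on_product_coordinates])
qed

text \<open>\<open>partial i f\<close> does not mention a domain, so the local statements all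
  concern the same functions and the induction on the order goes through. Only continuity needs an
  argument, by shrinking to a relatively open set.\<close>

lemma Ck_on_local:
  assumes V: "openin (Euclidean_space n) V"
    and loc: "\<And>x. x \<in> V \<Longrightarrow> \<exists>V'. x \<in> V' \<and> openin (Euclidean_space n) V' \<and> Ck_on n k V' f"
  shows "Ck_on n k V f"
  using loc
proof (induction k arbitrary: f)
  case 0
  have "(f \<longlongrightarrow> f x) (at x within V)" if x: "x \<in> V" for x
  proof -
    obtain V' where V': "x \<in> V'" "openin (Euclidean_space n) V'" "continuous_on V' f"
      using 0 x by auto
    obtain W where W: "open W" "V' = W \<inter> {x. \<forall>i\<ge>n. x i = 0}"
      using V'(2) by (rule openin_Euclidean_spaceE)
    have "(f \<longlongrightarrow> f x) (at x within V')" using V' by (auto simp: continuous_on_def)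
    moreover have "V \<inter> W \<subseteq> V'" using W openin_Euclidean_space_zero[OF V] by auto
    ultimately have "(f \<longlongrightarrow> f x) (at x within V \<inter> W)" by (rule tendsto_within_subset)
    also have "at x within V \<inter> W = at x within V"
      by (rule at_within_nhd[of x W]) (use V' W in auto)
    finally show ?thesis .
  qed
  then show ?case by (simp add: continuous_on_def)
next
  case (Suc k)
  have k0: "\<exists>V'. x \<in> V' \<and> openin (Euclidean_space n) V' \<and> Ck_on n k V' f" if "x \<in> V" for x
    using Suc.prems[OF that] Ck_on_lower by blast
  show ?case
    unfolding Ck_on_Suc
  proof (intro conjI allI impI ballI)
    show "continuous_on V f" by (rule Ck_on_imp_continuous_on[OF Suc.IH[OF k0]])
    fix i assume i: "i < n"
    show "Ck_on n k V (partial i f)"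
    proof (rule Suc.IH)
      fix x assume "x \<in> V"
      then show "\<exists>V'. x \<in> V' \<and> openin (Euclidean_space n) V' \<and> Ck_on n k V' (partial i f)"
        using Suc.prems i unfolding Ck_on_Suc by blast
    qed
    fix x assume x: "x \<in> V"
    show "((\<lambda>t. f (x(i := t))) has_real_derivative partial i f x) (at (x i))"
      using Suc.prems[OF x] i unfolding Ck_on_Suc by blast
  qed
qed

section \<open>The chain rule\<close>

lemma Ck_on_box_continuity:
  assumes V: "openin (Euclidean_space n) V" and x: "x \<in> V" and g: "continuous_on V g" and e: "e > 0"
  obtains \<delta> where "\<delta> > 0" "\<And>z. (\<And>j. n \<le> j \<Longrightarrow> z j = 0) \<Longrightarrow> (\<And>j. j < n \<Longrightarrow> \<bar>z j - x j\<bar> < \<delta>) \<Longrightarrow>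
    z \<in> V \<and> \<bar>g z - g x\<bar> < (e::real)"
proof -
  have "openin (top_of_set V) (V \<inter> g -` ball (g x) e)"
    by (rule continuous_openin_preimage_gen[OF g]) simp
  then have "openin (Euclidean_space n) (V \<inter> g -` ball (g x) e)"
    using V unfolding Euclidean_space_top_of_set by (rule openin_trans)
  moreover have "x \<in> V \<inter> g -` ball (g x) e" using x e by simp
  ultimately obtain \<delta> where "\<delta> > 0"
    "\<And>z. (\<And>j. n \<le> j \<Longrightarrow> z j = 0) \<Longrightarrow> (\<And>j. j < n \<Longrightarrow> \<bar>z j - x j\<bar> < \<delta>) \<Longrightarrow> z \<in> V \<inter> g -` ball (g x) e"
    by (rule Euclidean_space_box) blast
  then show thesis
    by (intro that) (auto simp: dist_real_def abs_minus_commute)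
qed

text \<open>The coordinates are moved one at a time, each step being controlled by the mean value theorem.\<close>

lemma DERIV_compose_partials:
  fixes c :: "real \<Rightarrow> nat \<Rightarrow> real"
  assumes V: "openin (Euclidean_space m) V" and f: "Ck_on m (Suc 0) V f" and c0: "c t0 \<in> V"
    and cm: "\<forall>\<^sub>F t in nhds t0. \<forall>j\<ge>m. c t j = 0"
    and c: "\<And>j. j < m \<Longrightarrow> ((\<lambda>t. c t j) has_real_derivative d j) (at t0)"
  shows "((\<lambda>t. f (c t)) has_real_derivative (\<Sum>j<m. partial j f (c t0) * d j)) (at t0)"
proof -
  \<comment> \<open>\<open>y k t\<close> has its first \<open>k\<close> coordinates from
    \<open>c t\<close> and the others from \<open>c t0\<close>, so \<open>f (c t) - f (c t0)\<close>
    telescopes over \<open>k\<close>.\<close>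
  define y where "y k t = (\<lambda>j. if j < k then c t j else c t0 j)" for k t
  have c0z: "c t0 j = 0" if "m \<le> j" for j
    using openin_Euclidean_space_zero[OF V c0 that] .
  have cont: "\<forall>\<^sub>F t in at t0. \<forall>j\<in>{..<m}. \<bar>c t j - c t0 j\<bar> < \<delta>" if "\<delta> > 0" for \<delta>
  proof (rule eventually_ball_finite; safe?)
    fix j assume "j < m"
    then have "((\<lambda>t. c t j) \<longlongrightarrow> c t0 j) (at t0)"
      using c DERIV_isCont isCont_def by blast
    then show "\<forall>\<^sub>F t in at t0. \<bar>c t j - c t0 j\<bar> < \<delta>"
      using that by (auto simp: tendsto_iff dist_real_def)
  qed
  have step: "((\<lambda>t. f (y (Suc k) t) - f (y k t)) has_real_derivative partial k f (c t0) * d k) (at t0)"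
    if k: "k < m" for k
  proof -
    define h where "h t = f (y (Suc k) t) - f (y k t)" for t
    \<comment> \<open>The difference quotient in the \<open>k\<close>-th coordinate. Where the
      increment is zero it is filled by the limit value, so that \<open>h\<close> is
      \<open>G\<close> times the increment without exception.\<close>
    define G where "G t = (if c t k = c t0 k then partial k f (c t0) else h t / (c t k - c t0 k))" for t
    have h0: "h t0 = 0" by (simp add: h_def y_def)
    have hG: "h t = G t * (c t k - c t0 k)" for t
    proof (cases "c t k = c t0 k")
      case True
      then have "y (Suc k) t = y k t" by (auto simp: y_def fun_eq_iff less_Suc_eq)
      then show ?thesis using True by (simp add: h_def)
    qed (simp add: G_def)
    have "(G \<longlongrightarrow> partial k f (c t0)) (at t0)"
    proof (rule tendstoI)
      fix e :: real assume e: "e > 0"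
      have "continuous_on V (partial k f)" using f k by (auto simp: Ck_on_Suc)
      then obtain \<delta> where \<delta>: "\<delta> > 0" "\<And>z. (\<And>j. m \<le> j \<Longrightarrow> z j = 0) \<Longrightarrow>
          (\<And>j. j < m \<Longrightarrow> \<bar>z j - c t0 j\<bar> < \<delta>) \<Longrightarrow> z \<in> V \<and> \<bar>partial k f z - partial k f (c t0)\<bar> < e"
        using Ck_on_box_continuity[OF V c0 _ e] by metis
      show "\<forall>\<^sub>F t in at t0. dist (G t) (partial k f (c t0)) < e"
        using cont[OF \<delta>(1)]
      proof eventually_elim
        case (elim t)
        \<comment> \<open>The \<open>k\<close>-th coordinate line from \<open>y k t\<close> to
          \<open>y (Suc k) t\<close>. It stays in the box because its moving coordinate lies between
          those of \<open>c t0\<close> and \<open>c t\<close>.\<close>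
        define u where "u s = (y k t)(k := s)" for s
        have u: "u s \<in> V" "\<bar>partial k f (u s) - partial k f (c t0)\<bar> < e"
          if "min (c t0 k) (c t k) \<le> s" "s \<le> max (c t0 k) (c t k)" for s
        proof -
          have "\<bar>u s j - c t0 j\<bar> < \<delta>" if "j < m" for j
          proof -
            have "\<bar>c t k - c t0 k\<bar> < \<delta>" using elim k by blast
            then show ?thesis
              using elim \<open>j < m\<close> \<delta>(1) \<open>min (c t0 k) (c t k) \<le> s\<close> \<open>s \<le> max (c t0 k) (c t k)\<close>
              by (auto simp: u_def y_def)
          qed
          moreover have "u s j = 0" if "m \<le> j" for j using k that c0z by (simp add: u_def y_def)
          ultimately show "u s \<in> V" "\<bar>partial k f (u s) - partial k f (c t0)\<bar> < e"
            using \<delta>(2) by blast+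
        qed
        have du: "((\<lambda>s. f (u s)) has_real_derivative partial k f (u s)) (at s)"
          if "min (c t0 k) (c t k) \<le> s" "s \<le> max (c t0 k) (c t k)" for s
        proof -
          have "((\<lambda>r. f ((u s)(k := r))) has_real_derivative partial k f (u s)) (at (u s k))"
            using f k u(1)[OF that] by (auto simp: Ck_on_Suc)
          then show ?thesis by (simp add: u_def)
        qed
        have hu: "h t = f (u (c t k)) - f (u (c t0 k))"
        proof -
          have "u (c t k) = y (Suc k) t" "u (c t0 k) = y k t"
            by (auto simp: u_def y_def fun_eq_iff less_Suc_eq)
          then show ?thesis by (simp add: h_def)
        qed
        show ?case
        proof (cases "c t k = c t0 k")
          case True then show ?thesis using e by (simp add: G_def)
        next
          case False
          have "\<exists>z. min (c t0 k) (c t k) \<le> z \<and> z \<le> max (c t0 k) (c t k) \<and>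
              h t = (c t k - c t0 k) * partial k f (u z)"
          proof (cases "c t0 k < c t k")
            case True
            from MVT2[OF True, of "\<lambda>s. f (u s)" "\<lambda>s. partial k f (u s)"] du True
            obtain z where z: "c t0 k < z" "z < c t k"
              "f (u (c t k)) - f (u (c t0 k)) = (c t k - c t0 k) * partial k f (u z)" by force
            then show ?thesis unfolding hu by (intro exI[of _ z]) auto
          next
            case F: False
            then have "c t k < c t0 k" using False by simp
            from MVT2[OF this, of "\<lambda>s. f (u s)" "\<lambda>s. partial k f (u s)"] du this
            obtain z where z: "c t k < z" "z < c t0 k"
              "f (u (c t0 k)) - f (u (c t k)) = (c t0 k - c t k) * partial k f (u z)" by force
            then have "h t = (c t k - c t0 k) * partial k f (u z)"
              unfolding hu by (simp add: algebra_simps)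
            then show ?thesis using z by (intro exI[of _ z]) auto
          qed
          then obtain z where z: "min (c t0 k) (c t k) \<le> z" "z \<le> max (c t0 k) (c t k)"
              "h t = (c t k - c t0 k) * partial k f (u z)" by blast
          then have "G t = partial k f (u z)" using False by (simp add: G_def)
          then show ?thesis using u(2)[OF z(1,2)] by (simp add: dist_real_def)
        qed
      qed
    qed
    moreover have "((\<lambda>t. (c t k - c t0 k) / (t - t0)) \<longlongrightarrow> d k) (at t0)"
      using c[OF k] by (simp add: has_field_derivative_iff)
    ultimately have "((\<lambda>t. G t * ((c t k - c t0 k) / (t - t0))) \<longlongrightarrow> partial k f (c t0) * d k) (at t0)"
      by (rule tendsto_mult)
    then have "(h has_real_derivative partial k f (c t0) * d k) (at t0)"
      by (simp add: has_field_derivative_iff h0) (simp add: hG)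
    then show ?thesis by (simp add: h_def[abs_def])
  qed
  have ind: "k \<le> m \<Longrightarrow> ((\<lambda>t. f (y k t)) has_real_derivative (\<Sum>j<k. partial j f (c t0) * d j)) (at t0)" for k
  proof (induction k)
    case 0 then show ?case by (simp add: y_def)
  next
    case (Suc k)
    then show ?case using DERIV_add[OF Suc.IH step[of k]] by simp
  qed
  \<comment> \<open>After \<open>m\<close> steps the curve is reached: the remaining coordinates
    vanish both at \<open>t0\<close> and near it.\<close>
  have "\<forall>\<^sub>F t in nhds t0. f (y m t) = f (c t)"
    using cm
  proof eventually_elim
    case (elim t)
    then have "y m t = c t" using c0z by (auto simp: y_def fun_eq_iff not_less)
    then show ?case by simp
  qed
  from DERIV_cong_ev[OF refl this refl] ind[of m] show ?thesis by simp
qed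

lemma Ck_on_compose:
  assumes V: "openin (Euclidean_space n) V" and V': "openin (Euclidean_space m) V'"
    and in_V': "\<And>x. x \<in> V \<Longrightarrow> \<phi> x \<in> V'"
  shows "(\<And>j. j < m \<Longrightarrow> Ck_on n k V (\<lambda>x. \<phi> x j)) \<Longrightarrow> Ck_on m k V' f \<Longrightarrow> Ck_on n k V (\<lambda>x. f (\<phi> x))"
proof (induction k arbitrary: f)
  case 0
  have "continuous_on V \<phi>"
  proof (rule continuous_on_coordinatewise_then_product)
    fix i
    show "continuous_on V (\<lambda>x. \<phi> x i)"
    proof (cases "i < m")
      case True then show ?thesis using 0 by simp
    next
      case False
      then have "\<phi> x i = 0" if "x \<in> V" for x
        using openin_Euclidean_space_zero[OF V' in_V'[OF that]] by simp
      then show ?thesis by (simp cong: continuous_on_cong)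
    qed
  qed
  then show ?case using 0(2) in_V' continuous_on_compose2[of V' f V \<phi>] by auto
next
  case (Suc k)
  \<comment> \<open>Needed for \<open>f\<close> and for all \<open>partial j f\<close>, which is why
    the induction leaves \<open>f\<close> arbitrary.\<close>
  have l: "Ck_on n k V (\<lambda>x. f (\<phi> x))" if "Ck_on m k V' f" for f
    by (rule Suc.IH[OF Ck_on_lower[OF Suc.prems(1)] that])
  show ?case
  proof (rule Ck_on_SucI[OF V, where d = "\<lambda>i x. \<Sum>j<m. partial j f (\<phi> x) * partial i (\<lambda>x. \<phi> x j) x"])
    show "continuous_on V (\<lambda>x. f (\<phi> x))"
      by (rule Ck_on_imp_continuous_on[OF l[OF Ck_on_lower[OF Suc.prems(2)]]])
  next
    fix i x assume i: "i < n" and x: "x \<in> V"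
    have 1: "Ck_on m (Suc 0) V' f"
      using Suc.prems(2) Ck_on_imp_continuous_on by (auto simp: Ck_on_Suc)
    have "((\<lambda>t. f (\<phi> (x(i := t)))) has_real_derivative
        (\<Sum>j<m. partial j f (\<phi> (x(i := x i))) * partial i (\<lambda>x. \<phi> x j) x)) (at (x i))"
    proof (rule DERIV_compose_partials[OF V' 1])
      show "\<phi> (x(i := x i)) \<in> V'" using in_V' x by simp
      show "\<forall>\<^sub>F t in nhds (x i). \<forall>j\<ge>m. \<phi> (x(i := t)) j = 0"
        using eventually_fun_upd_in[OF V x i]
        by eventually_elim (use in_V' openin_Euclidean_space_zero[OF V'] in blast)
      show "((\<lambda>t. \<phi> (x(i := t)) j) has_real_derivative partial i (\<lambda>x. \<phi> x j) x) (at (x i))" if "j < m" for j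
        using Suc.prems(1)[OF that] i x by (auto simp: Ck_on_Suc)
    qed
    then show "((\<lambda>t. f (\<phi> (x(i := t)))) has_real_derivative
        (\<Sum>j<m. partial j f (\<phi> x) * partial i (\<lambda>x. \<phi> x j) x)) (at (x i))" by simp
  next
    fix i assume "i < n"
    then show "Ck_on n k V (\<lambda>x. \<Sum>j<m. partial j f (\<phi> x) * partial i (\<lambda>x. \<phi> x j) x)"
      using Suc.prems by (intro Ck_on_sum[OF V] Ck_on_mult[OF V] l) (auto simp: Ck_on_Suc)
  qed
qed

section \<open>Functions and tangent vectors on manifolds\<close>

lemma chart_props:
  assumes "smooth_manifold M" "(U, \<phi>) \<in> atlas M"
  shows chart_open: "openin (mtop M) U"
    and chart_inj: "inj_on \<phi> U"
    and chart_homeomorphic: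
      "homeomorphic_map (subtopology (mtop M) U) (subtopology (Euclidean_space (mdim M)) (\<phi> ` U)) \<phi>"
    and chart_image_open: "openin (Euclidean_space (mdim M)) (\<phi> ` U)"
proof -
  show U: "openin (mtop M) U" and h: "homeomorphic_map (subtopology (mtop M) U)
      (subtopology (Euclidean_space (mdim M)) (\<phi> ` U)) \<phi>"
    and "openin (Euclidean_space (mdim M)) (\<phi> ` U)"
    using assms unfolding smooth_manifold_def by fast+
  show "inj_on \<phi> U"
    using homeomorphic_imp_injective_map[OF h] openin_subset[OF U] by (simp add: inf.absorb2)
qed

lemma chart_openin:
  assumes "smooth_manifold M" "(U, \<phi>) \<in> atlas M" "openin (mtop M) W"
  shows "openin (Euclidean_space (mdim M)) (\<phi> ` (U \<inter> W))"
proof -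
  have "openin (subtopology (mtop M) U) (U \<inter> W)"
    using assms(3) by (auto simp: openin_subtopology)
  then have "openin (subtopology (Euclidean_space (mdim M)) (\<phi> ` U)) (\<phi> ` (U \<inter> W))"
    using homeomorphic_imp_open_map[OF chart_homeomorphic[OF assms(1,2)]] by (auto simp: open_map_def)
  then show ?thesis
    using chart_image_open[OF assms(1,2)] by (rule openin_trans_full)
qed

lemma chart_cover:
  assumes "smooth_manifold M" "p \<in> points M"
  obtains U \<phi> where "(U, \<phi>) \<in> atlas M" "p \<in> U"
  using assms unfolding smooth_manifold_def by blast

lemma inv_into_chart:
  assumes "smooth_manifold M" "(U, \<phi>) \<in> atlas M" "p \<in> U"
  shows "inv_into U \<phi> (\<phi> p) = p"
  by (rule inv_into_f_f[OF chart_inj[OF assms(1,2)] assms(3)])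

lemma smooth_fun_on_Ck:
  "smooth_fun_on M W f \<longleftrightarrow>
    (\<forall>(U, \<phi>)\<in>atlas M. \<forall>k. Ck_on (mdim M) k (\<phi> ` (U \<inter> W)) (\<lambda>x. f (inv_into U \<phi> x)))"
  unfolding smooth_fun_on_def smooth_on_def by blast

lemma smooth_fun_on_const: "smooth_fun_on M W (\<lambda>p. c)"
  by (auto simp: smooth_fun_on_Ck intro: Ck_on_const)

lemma smooth_fun_on_add:
  assumes "smooth_manifold M" "openin (mtop M) W" "smooth_fun_on M W f" "smooth_fun_on M W g"
  shows "smooth_fun_on M W (\<lambda>p. f p + g p)"
  using assms(3,4) unfolding smooth_fun_on_Ck
  by (auto intro!: Ck_on_add chart_openin[OF assms(1) _ assms(2)])

lemma smooth_fun_on_mult: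
  assumes "smooth_manifold M" "openin (mtop M) W" "smooth_fun_on M W f" "smooth_fun_on M W g"
  shows "smooth_fun_on M W (\<lambda>p. f p * g p)"
  using assms(3,4) unfolding smooth_fun_on_Ck
  by (auto intro!: Ck_on_mult chart_openin[OF assms(1) _ assms(2)])

lemma smooth_fun_on_diff:
  assumes "smooth_manifold M" "openin (mtop M) W" "smooth_fun_on M W f" "smooth_fun_on M W g"
  shows "smooth_fun_on M W (\<lambda>p. f p - g p)"
  using smooth_fun_on_add[OF assms(1-3) smooth_fun_on_mult[OF assms(1,2) smooth_fun_on_const[of M W "-1"] assms(4)]]
  by simp

lemma smooth_fun_on_sum:
  assumes "smooth_manifold M" "openin (mtop M) W" "\<And>j. j \<in> J \<Longrightarrow> smooth_fun_on M W (f j)"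
  shows "smooth_fun_on M W (\<lambda>p. \<Sum>j\<in>J. f j p)"
  using assms(3) by (induction J rule: infinite_finite_induct)
    (auto intro: smooth_fun_on_const smooth_fun_on_add[OF assms(1,2)])

lemma smooth_fun_on_prod:
  assumes "smooth_manifold M" "openin (mtop M) W" "\<And>j. j \<in> J \<Longrightarrow> smooth_fun_on M W (f j)"
  shows "smooth_fun_on M W (\<lambda>p. \<Prod>j\<in>J. f j p)"
  using assms(3) by (induction J rule: infinite_finite_induct)
    (auto intro: smooth_fun_on_const smooth_fun_on_mult[OF assms(1,2)])

lemma smooth_fun_on_inverse:
  assumes "smooth_manifold M" "openin (mtop M) W" "smooth_fun_on M W f" "\<And>p. p \<in> W \<Longrightarrow> f p \<noteq> 0"
  shows "smooth_fun_on M W (\<lambda>p. inverse (f p))"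
  unfolding smooth_fun_on_Ck
proof safe
  fix U \<phi> k assume U: "(U, \<phi>) \<in> atlas M"
  show "Ck_on (mdim M) k (\<phi> ` (U \<inter> W)) (\<lambda>x. inverse (f (inv_into U \<phi> x)))"
    by (rule Ck_on_inverse[OF chart_openin[OF assms(1) U assms(2)]])
      (use assms(3,4) U in \<open>auto simp: smooth_fun_on_Ck inv_into_chart[OF assms(1) U]\<close>)
qed

lemma smooth_fun_on_cong:
  assumes "smooth_manifold M" "openin (mtop M) W" "\<And>p. p \<in> W \<Longrightarrow> f p = g p" "smooth_fun_on M W f"
  shows "smooth_fun_on M W g"
  unfolding smooth_fun_on_Ck
proof safe
  fix U \<phi> k assume U: "(U, \<phi>) \<in> atlas M"
  show "Ck_on (mdim M) k (\<phi> ` (U \<inter> W)) (\<lambda>x. g (inv_into U \<phi> x))"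
    by (rule Ck_on_cong_imp[OF chart_openin[OF assms(1) U assms(2)], of _ "\<lambda>x. f (inv_into U \<phi> x)"])
      (use assms(3,4) U in \<open>auto simp: smooth_fun_on_Ck inv_into_chart[OF assms(1) U]\<close>)
qed

lemma smooth_fun_on_subset: "smooth_fun_on M W f \<Longrightarrow> W' \<subseteq> W \<Longrightarrow> smooth_fun_on M W' f"
  unfolding smooth_fun_on_Ck by (fast intro: Ck_on_subset)

lemma smooth_fun_on_local:
  assumes M: "smooth_manifold M" and W: "openin (mtop M) W"
    and loc: "\<And>p. p \<in> W \<Longrightarrow> \<exists>W'. p \<in> W' \<and> openin (mtop M) W' \<and> smooth_fun_on M W' f"
  shows "smooth_fun_on M W f"
  unfolding smooth_fun_on_Ck
proof safe
  fix U \<phi> k assume U: "(U, \<phi>) \<in> atlas M"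
  show "Ck_on (mdim M) k (\<phi> ` (U \<inter> W)) (\<lambda>x. f (inv_into U \<phi> x))"
  proof (rule Ck_on_local[OF chart_openin[OF M U W]])
    fix x assume "x \<in> \<phi> ` (U \<inter> W)"
    then obtain p where p: "p \<in> U" "p \<in> W" "x = \<phi> p" by blast
    obtain W' where W': "p \<in> W'" "openin (mtop M) W'" "smooth_fun_on M W' f"
      using loc[OF p(2)] by blast
    show "\<exists>V'. x \<in> V' \<and> openin (Euclidean_space (mdim M)) V' \<and>
        Ck_on (mdim M) k V' (\<lambda>x. f (inv_into U \<phi> x))"
      using p W' U chart_openin[OF M U W'(2)]
      by (intro exI[of _ "\<phi> ` (U \<inter> W')"]) (auto simp: smooth_fun_on_Ck)
  qed
qed

text \<open>On each chart domain \<open>f\<close> is its continuous coordinate expression after the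
  chart; the pieces are glued. The index triples carry the chart along with its domain.\<close>

lemma smooth_fun_on_continuous:
  assumes M: "smooth_manifold M" and W: "openin (mtop M) W" and f: "smooth_fun_on M W f"
  shows "continuous_map (subtopology (mtop M) W) euclidean f"
proof (rule pasting_lemma[where T = fst and f = "\<lambda>_. f" and I = "(\<lambda>(U, \<phi>). (U \<inter> W, U, \<phi>)) ` atlas M"])
  fix i assume "i \<in> (\<lambda>(U, \<phi>). (U \<inter> W, U, \<phi>)) ` atlas M"
  then obtain U \<phi> where i: "i = (U \<inter> W, U, \<phi>)" and U: "(U, \<phi>) \<in> atlas M" by auto
  show "openin (subtopology (mtop M) W) (fst i)"
    using i W chart_open[OF M U] by (auto simp: openin_subtopology)
  have Wt: "W \<subseteq> points M" "U \<subseteq> points M" using W chart_open[OF M U] openin_subset by blast+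
  have "continuous_on (\<phi> ` (U \<inter> W)) (\<lambda>x. f (inv_into U \<phi> x))"
    using f U by (intro Ck_on_imp_continuous_on[of "mdim M" 0]) (auto simp only: smooth_fun_on_Ck)
  moreover have "continuous_map (subtopology (mtop M) (U \<inter> W)) (top_of_set (\<phi> ` (U \<inter> W))) \<phi>"
  proof -
    have "continuous_map (subtopology (mtop M) U) (Euclidean_space (mdim M)) \<phi>"
      using homeomorphic_imp_continuous_map[OF chart_homeomorphic[OF M U]]
      by (simp add: continuous_map_in_subtopology)
    then have "continuous_map (subtopology (mtop M) U) euclidean \<phi>"
      unfolding Euclidean_space_top_of_set by (simp add: continuous_map_in_subtopology)
    then have "continuous_map (subtopology (mtop M) (U \<inter> W)) euclidean \<phi>"
      by (rule continuous_map_from_subtopology_mono) blast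
    then show ?thesis by (auto simp: continuous_map_in_subtopology)
  qed
  ultimately have "continuous_map (subtopology (mtop M) (U \<inter> W)) euclidean ((\<lambda>x. f (inv_into U \<phi> x)) \<circ> \<phi>)"
    by (intro continuous_map_compose) auto
  then have "continuous_map (subtopology (mtop M) (U \<inter> W)) euclidean f"
    by (rule continuous_map_eq) (auto simp: inv_into_chart[OF M U])
  then show "continuous_map (subtopology (subtopology (mtop M) W) (fst i)) euclidean f"
    by (simp add: i subtopology_subtopology inf.absorb2 Int_commute inf.left_commute)
next
  fix x assume "x \<in> topspace (subtopology (mtop M) W)"
  then have "x \<in> points M" "x \<in> W" by auto
  then show "\<exists>j. j \<in> (\<lambda>(U, \<phi>). (U \<inter> W, U, \<phi>)) ` atlas M \<and> x \<in> fst j \<and> f x = f x"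
    using chart_cover[OF M] by (metis (no_types, lifting) IntI case_prod_conv fst_conv imageI)
qed simp

text \<open>The domains of the trivializations will be sets where a determinant does not
  vanish.\<close>

lemma smooth_fun_on_nonzero_open:
  assumes M: "smooth_manifold M" and W: "openin (mtop M) W" and f: "smooth_fun_on M W f"
  shows "openin (mtop M) {p \<in> W. f p \<noteq> 0}"
proof -
  have "openin (subtopology (mtop M) W) {p \<in> topspace (subtopology (mtop M) W). f p \<in> - {0}}"
    by (rule openin_continuous_map_preimage[OF smooth_fun_on_continuous[OF assms]]) auto
  moreover have "{p \<in> topspace (subtopology (mtop M) W). f p \<in> - {0}} = {p \<in> W. f p \<noteq> 0}"
    using openin_subset[OF W] by auto
  ultimately show ?thesis using W openin_trans_full by metis
qed

lemma smooth_map_on_openin_preimage: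
  assumes "smooth_map_on M W N F" "openin (mtop M) W" "openin (mtop N) U"
  shows "openin (mtop M) {p \<in> W. F p \<in> U}"
proof -
  have "openin (subtopology (mtop M) W) {p \<in> topspace (subtopology (mtop M) W). F p \<in> U}"
    by (rule openin_continuous_map_preimage) (use assms in \<open>auto simp: smooth_map_on_def\<close>)
  moreover have "{p \<in> topspace (subtopology (mtop M) W). F p \<in> U} = {p \<in> W. F p \<in> U}"
    using openin_subset[OF assms(2)] by auto
  ultimately show ?thesis using assms(2) openin_trans_full by metis
qed

lemma smooth_map_on_points:
  assumes "smooth_map_on M W N F" "openin (mtop M) W" "p \<in> W"
  shows "F p \<in> points N"
  using assms openin_subset[OF assms(2)] unfolding smooth_map_on_def
  by (auto simp: continuous_map_def Pi_iff)

lemma smooth_fun_on_compose: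
  assumes M: "smooth_manifold M" and N: "smooth_manifold N"
    and F: "smooth_map_on M W N F" and W: "openin (mtop M) W" and f: "smooth_fun_on N (points N) f"
  shows "smooth_fun_on M W (\<lambda>p. f (F p))"
  unfolding smooth_fun_on_Ck
proof safe
  fix U \<phi> k assume U: "(U, \<phi>) \<in> atlas M"
  show "Ck_on (mdim M) k (\<phi> ` (U \<inter> W)) (\<lambda>x. f (F (inv_into U \<phi> x)))"
  proof (rule Ck_on_local[OF chart_openin[OF M U W]])
    fix x assume "x \<in> \<phi> ` (U \<inter> W)"
    then obtain p where p: "p \<in> U" "p \<in> W" "x = \<phi> p" by blast
    obtain U' \<phi>' where U': "(U', \<phi>') \<in> atlas N" "F p \<in> U'"
      using chart_cover[OF N smooth_map_on_points[OF F W p(2)]] by blast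
    \<comment> \<open>On \<open>V\<close> the chart at \<open>p\<close> and the chart at
      \<open>F p\<close> are both available, so the coordinate expression of the composite factors
      through the one of \<open>F\<close>.\<close>
    define V where "V = \<phi> ` (U \<inter> {q \<in> W. F q \<in> U'})"
    have V: "openin (Euclidean_space (mdim M)) V"
      unfolding V_def
      by (rule chart_openin[OF M U smooth_map_on_openin_preimage[OF F W chart_open[OF N U'(1)]]])
    have Veq: "\<phi> ` {q \<in> U \<inter> W. F q \<in> U'} = V" unfolding V_def by (rule arg_cong[of _ _ "image \<phi>"]) blast
    have "Ck_on (mdim M) k V (\<lambda>x. f (inv_into U' \<phi>' (\<phi>' (F (inv_into U \<phi> x)))))"
    proof (rule Ck_on_compose[OF V chart_image_open[OF N U'(1)],
          where \<phi> = "\<lambda>x. \<phi>' (F (inv_into U \<phi> x))" and f = "\<lambda>y. f (inv_into U' \<phi>' y)"])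
      show "\<phi>' (F (inv_into U \<phi> x)) \<in> \<phi>' ` U'" if "x \<in> V" for x
        using that by (auto simp: V_def inv_into_chart[OF M U])
      show "Ck_on (mdim M) k V (\<lambda>x. \<phi>' (F (inv_into U \<phi> x)) j)" if "j < mdim N" for j
        using F U U'(1) that unfolding smooth_map_on_def smooth_on_def Veq[symmetric] by fast
      have "U' \<inter> points N = U'" using openin_subset[OF chart_open[OF N U'(1)]] by blast
      then show "Ck_on (mdim N) k (\<phi>' ` U') (\<lambda>y. f (inv_into U' \<phi>' y))"
        using f U'(1) unfolding smooth_fun_on_Ck by fastforce
    qed
    then have "Ck_on (mdim M) k V (\<lambda>x. f (F (inv_into U \<phi> x)))"
      by (rule Ck_on_cong_imp[OF V])
        (auto simp: V_def inv_into_chart[OF M U] inv_into_chart[OF N U'(1)])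
    then show "\<exists>V'. x \<in> V' \<and> openin (Euclidean_space (mdim M)) V' \<and>
        Ck_on (mdim M) k V' (\<lambda>x. f (F (inv_into U \<phi> x)))"
      using V p U'(2) by (intro exI[of _ V]) (auto simp: V_def)
  qed
qed

lemma smooth_functions_add:
  assumes "smooth_manifold M" "f \<in> smooth_functions M" "g \<in> smooth_functions M"
  shows "(\<lambda>p. f p + g p) \<in> smooth_functions M"
  using assms smooth_fun_on_add[OF assms(1) openin_topspace] by (auto simp: smooth_functions_def)

lemma smooth_functions_mult:
  assumes "smooth_manifold M" "f \<in> smooth_functions M" "g \<in> smooth_functions M"
  shows "(\<lambda>p. f p * g p) \<in> smooth_functions M"
  using assms smooth_fun_on_mult[OF assms(1) openin_topspace] by (auto simp: smooth_functions_def)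

lemma smooth_functions_scale:
  assumes "smooth_manifold M" "f \<in> smooth_functions M"
  shows "(\<lambda>p. a * f p) \<in> smooth_functions M"
  using assms smooth_fun_on_mult[OF assms(1) openin_topspace smooth_fun_on_const] by (auto simp: smooth_functions_def)

lemma smooth_functions_sum:
  assumes "smooth_manifold M" "\<And>j. j \<in> J \<Longrightarrow> f j \<in> smooth_functions M"
  shows "(\<lambda>p. \<Sum>j\<in>J. f j p) \<in> smooth_functions M"
  using assms smooth_fun_on_sum[OF assms(1) openin_topspace, of J f] by (auto simp: smooth_functions_def)

lemma smooth_functions_const:
  assumes "smooth_manifold M"
  shows "(\<lambda>p. if p \<in> points M then c else 0) \<in> smooth_functions M"
  using smooth_fun_on_cong[OF assms openin_topspace _ smooth_fun_on_const[of M _ c]]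
  by (auto simp: smooth_functions_def)

lemma smooth_fun_on_restrict:
  assumes "smooth_manifold M" "smooth_fun_on M (points M) f"
  shows "(\<lambda>p. if p \<in> points M then f p else 0) \<in> smooth_functions M"
  using smooth_fun_on_cong[OF assms(1) openin_topspace _ assms(2)]
  by (auto simp: smooth_functions_def)

lemma pullback_smooth_functions:
  assumes "smooth_manifold M" "smooth_manifold N" "smooth_map_on M (points M) N F" "f \<in> smooth_functions N"
  shows "pullback M F f \<in> smooth_functions M"
  unfolding pullback_def
  by (rule smooth_fun_on_restrict[OF assms(1) smooth_fun_on_compose[OF assms(1-3) openin_topspace]])
    (use assms(4) in \<open>simp add: smooth_functions_def\<close>)

section \<open>Tangent vectors as derivations\<close>

lemma tangent_space_add:
  assumes "v \<in> tangent_space M p" "f \<in> smooth_functions M" "g \<in> smooth_functions M"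
  shows "v (\<lambda>q. f q + g q) = v f + v g"
proof -
  have "v (\<lambda>q. 1 * f q + 1 * g q) = 1 * v f + 1 * v g"
    using assms unfolding tangent_space_def by fast
  then show ?thesis by simp
qed

lemma tangent_space_mult:
  assumes "v \<in> tangent_space M p" "f \<in> smooth_functions M" "g \<in> smooth_functions M"
  shows "v (\<lambda>q. f q * g q) = v f * g p + f p * v g"
  using assms unfolding tangent_space_def by fast

lemma tangent_space_scale:
  assumes "v \<in> tangent_space M p" "f \<in> smooth_functions M"
  shows "v (\<lambda>q. a * f q) = a * v f"
proof -
  have "v (\<lambda>q. a * f q + 0 * f q) = a * v f + 0 * v f"
    using assms unfolding tangent_space_def by fast
  then show ?thesis by simp
qed

lemma tangent_space_zero: "v \<in> tangent_space M p \<Longrightarrow> smooth_manifold M \<Longrightarrow> v (\<lambda>q. 0) = 0"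
  using tangent_space_scale[of v M p _ 0] smooth_functions_const[of M 0] by fastforce

lemma tangent_space_sum:
  assumes "smooth_manifold M" "v \<in> tangent_space M p" "\<And>j. j \<in> J \<Longrightarrow> f j \<in> smooth_functions M"
  shows "v (\<lambda>q. \<Sum>j\<in>J. f j q) = (\<Sum>j\<in>J. v (f j))"
  using assms(3)
proof (induction J rule: infinite_finite_induct)
  case (insert x F)
  then show ?case
    using tangent_space_add[OF assms(2), of "f x" "\<lambda>q. \<Sum>j\<in>F. f j q"] smooth_functions_sum[OF assms(1), of F f]
    by auto
qed (auto simp: tangent_space_zero[OF assms(2,1)])

text \<open>The Leibniz rule for 1 = 1 * 1 gives v 1 = 2 * v 1. The constant is cut off outside
  \<open>M\<close>, since \<open>v\<close> is defined to be zero on functions that do not vanish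
  there.\<close>

lemma tangent_space_const:
  assumes M: "smooth_manifold M" and v: "v \<in> tangent_space M p" and p: "p \<in> points M"
  shows "v (\<lambda>q. if q \<in> points M then c else 0) = 0"
proof -
  let ?one = "\<lambda>q. if q \<in> points M then 1 else 0 :: real"
  have one: "?one \<in> smooth_functions M" by (rule smooth_functions_const[OF M])
  have "v (\<lambda>q. ?one q * ?one q) = v ?one * ?one p + ?one p * v ?one"
    by (rule tangent_space_mult[OF v one one])
  moreover have "(\<lambda>q. ?one q * ?one q) = ?one" by auto
  ultimately have "v ?one = 0" using p by simp
  moreover have "(\<lambda>q. if q \<in> points M then c else 0) = (\<lambda>q. c * ?one q)" by auto
  ultimately show ?thesis using tangent_space_scale[OF v one, of c] by simp
qed

text \<open>These derivations make the abstract tangent space large enough: if all tangent vectors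
  annihilate a function, then so do the partial derivatives in a chart.\<close>

lemma coordinate_tangent_vector:
  assumes M: "smooth_manifold M" and U: "(U, \<phi>) \<in> atlas M" and p: "p \<in> U" and i: "i < mdim M"
  shows "(\<lambda>f. if f \<in> smooth_functions M then partial i (\<lambda>x. f (inv_into U \<phi> x)) (\<phi> p) else 0)
    \<in> tangent_space M p"
proof -
  have D: "((\<lambda>t. f (inv_into U \<phi> ((\<phi> p)(i := t)))) has_real_derivative
      partial i (\<lambda>x. f (inv_into U \<phi> x)) (\<phi> p)) (at (\<phi> p i))" if f: "f \<in> smooth_functions M" for f
  proof -
    have "U \<inter> points M = U" using openin_subset[OF chart_open[OF M U]] by blast
    then have "Ck_on (mdim M) (Suc 0) (\<phi> ` U) (\<lambda>x. f (inv_into U \<phi> x))"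
      using f U unfolding smooth_functions_def smooth_fun_on_Ck by fastforce
    then show ?thesis using i p by (auto simp: Ck_on_Suc)
  qed
  have add: "partial i (\<lambda>x. a * f (inv_into U \<phi> x) + b * g (inv_into U \<phi> x)) (\<phi> p) =
      a * partial i (\<lambda>x. f (inv_into U \<phi> x)) (\<phi> p) + b * partial i (\<lambda>x. g (inv_into U \<phi> x)) (\<phi> p)"
    if "f \<in> smooth_functions M" "g \<in> smooth_functions M" for f g a b
    unfolding partial_def[of i "\<lambda>x. a * f (inv_into U \<phi> x) + b * g (inv_into U \<phi> x)"]
    by (rule DERIV_imp_deriv) (intro DERIV_add DERIV_cmult D that)
  have mult: "partial i (\<lambda>x. f (inv_into U \<phi> x) * g (inv_into U \<phi> x)) (\<phi> p) =
      partial i (\<lambda>x. f (inv_into U \<phi> x)) (\<phi> p) * g p + f p * partial i (\<lambda>x. g (inv_into U \<phi> x)) (\<phi> p)"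
    if "f \<in> smooth_functions M" "g \<in> smooth_functions M" for f g
    using DERIV_imp_deriv[OF DERIV_mult[OF D[OF that(1)] D[OF that(2)]]]
    unfolding partial_def[of i "\<lambda>x. f (inv_into U \<phi> x) * g (inv_into U \<phi> x)"]
    by (simp add: inv_into_chart[OF M U p] mult.commute)
  show ?thesis
    unfolding tangent_space_def
    using add mult smooth_functions_mult[OF M]
      smooth_functions_add[OF M smooth_functions_scale[OF M] smooth_functions_scale[OF M]]
    by auto
qed

section \<open>Vanishing derivatives and leafwise constancy\<close>

lemma vanishing_partials_constant_on_box:
  assumes V: "openin (Euclidean_space n) V" and f: "Ck_on n (Suc 0) V f"
    and z: "\<And>i x. i < n \<Longrightarrow> x \<in> V \<Longrightarrow> partial i f x = 0"
    and box: "\<And>z. (\<And>j. n \<le> j \<Longrightarrow> z j = 0) \<Longrightarrow> (\<And>j. j < n \<Longrightarrow> \<bar>z j - x j\<bar> < \<delta>) \<Longrightarrow> z \<in> V"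
    and \<delta>: "\<delta> > 0" and x: "x \<in> V"
    and y: "\<And>j. n \<le> j \<Longrightarrow> y j = 0" "\<And>j. j < n \<Longrightarrow> \<bar>y j - x j\<bar> < \<delta>"
  shows "f y = f x"
proof -
  \<comment> \<open>The segment from \<open>x\<close> to \<open>y\<close>, which the box contains;
    by the chain rule \<open>f\<close> has zero derivative along it.\<close>
  define c where "c t = (\<lambda>j. x j + t * (y j - x j))" for t
  have x0: "x j = 0" if "n \<le> j" for j using openin_Euclidean_space_zero[OF V x that] .
  have d: "((\<lambda>t. f (c t)) has_real_derivative 0) (at t)" if t: "0 \<le> t" "t \<le> 1" for t
  proof -
    have "c t \<in> V"
    proof (rule box)
      show "c t j = 0" if "n \<le> j" for j using that x0 y(1) by (simp add: c_def)
      show "\<bar>c t j - x j\<bar> < \<delta>" if "j < n" for j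
      proof -
        have "\<bar>c t j - x j\<bar> = t * \<bar>y j - x j\<bar>" using t by (simp add: c_def abs_mult)
        also have "\<dots> \<le> 1 * \<bar>y j - x j\<bar>" using t by (intro mult_right_mono) auto
        finally show ?thesis using y(2)[OF that] by simp
      qed
    qed
    moreover have "((\<lambda>t. c t j) has_real_derivative y j - x j) (at t)" for j
      unfolding c_def by (auto intro!: derivative_eq_intros)
    ultimately have "((\<lambda>t. f (c t)) has_real_derivative (\<Sum>j<n. partial j f (c t) * (y j - x j))) (at t)"
      by (intro DERIV_compose_partials[OF V f]) (use x0 y(1) in \<open>auto simp: c_def\<close>)
    then show ?thesis using z \<open>c t \<in> V\<close> by simp
  qed
  have "f (c 1) = f (c 0)"
    by (intro DERIV_isconst_end[of 0 1 "\<lambda>t. f (c t)"] continuous_at_imp_continuous_on)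
      (auto intro!: d DERIV_isCont[OF d])
  then show ?thesis by (simp add: c_def)
qed

lemma connected_locally_constant:
  assumes "connected_space T" and loc: "\<And>p. p \<in> topspace T \<Longrightarrow> \<exists>U. openin T U \<and> p \<in> U \<and> (\<forall>q\<in>U. f q = f p)"
    and p: "p \<in> topspace T" and q: "q \<in> topspace T"
  shows "f p = f q"
proof (rule ccontr)
  assume ne: "f p \<noteq> f q"
  \<comment> \<open>The predicate is arbitrary so that both a level set of \<open>f\<close> and its
    complement come out open.\<close>
  have op: "openin T {x \<in> topspace T. P (f x)}" for P
  proof (subst openin_subopen, intro ballI)
    fix x assume x: "x \<in> {x \<in> topspace T. P (f x)}"
    then obtain U where "openin T U" "x \<in> U" "\<forall>q\<in>U. f q = f x" using loc by blast
    moreover have "U \<subseteq> {x \<in> topspace T. P (f x)}"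
    proof
      fix q assume q: "q \<in> U"
      have "f q = f x" using \<open>\<forall>q\<in>U. f q = f x\<close> q by (rule bspec)
      then have "P (f q)" using x by simp
      then show "q \<in> {x \<in> topspace T. P (f x)}" using openin_subset[OF \<open>openin T U\<close>] q by blast
    qed
    ultimately show "\<exists>U. openin T U \<and> x \<in> U \<and> U \<subseteq> {x \<in> topspace T. P (f x)}"
      by blast
  qed
  have "\<not> (openin T {x \<in> topspace T. f x = f p} \<and> openin T {x \<in> topspace T. f x \<noteq> f p} \<and>
      topspace T \<subseteq> {x \<in> topspace T. f x = f p} \<union> {x \<in> topspace T. f x \<noteq> f p} \<and>
      {x \<in> topspace T. f x = f p} \<inter> {x \<in> topspace T. f x \<noteq> f p} = {} \<and>
      {x \<in> topspace T. f x = f p} \<noteq> {} \<and> {x \<in> topspace T. f x \<noteq> f p} \<noteq> {})"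
    using assms(1) unfolding connected_space_def by blast
  then show False using op[of "\<lambda>y. y = f p"] op[of "\<lambda>y. y \<noteq> f p"] p q ne by force
qed

lemma vanishing_tangent_constant:
  assumes M: "smooth_manifold M" and con: "connected_space (mtop M)" and f: "f \<in> smooth_functions M"
    and z: "\<And>p v. p \<in> points M \<Longrightarrow> v \<in> tangent_space M p \<Longrightarrow> v f = 0"
    and pq: "p \<in> points M" "q \<in> points M"
  shows "f p = f q"
proof (rule connected_locally_constant[OF con _ pq])
  fix p assume "p \<in> points M"
  then obtain U \<phi> where U: "(U, \<phi>) \<in> atlas M" "p \<in> U" using chart_cover[OF M] by metis
  define g where "g = (\<lambda>x. f (inv_into U \<phi> x))"
  have UM: "U \<inter> points M = U" using openin_subset[OF chart_open[OF M U(1)]] by blast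
  then have g: "Ck_on (mdim M) (Suc 0) (\<phi> ` U) g"
    using f U unfolding smooth_functions_def smooth_fun_on_Ck g_def by fastforce
  have V: "openin (Euclidean_space (mdim M)) (\<phi> ` U)" by (rule chart_image_open[OF M U(1)])
  obtain \<delta> where \<delta>: "\<delta> > 0" "\<And>z. (\<And>j. mdim M \<le> j \<Longrightarrow> z j = 0) \<Longrightarrow>
      (\<And>j. j < mdim M \<Longrightarrow> \<bar>z j - \<phi> p j\<bar> < \<delta>) \<Longrightarrow> z \<in> \<phi> ` U"
    using Euclidean_space_box[OF V imageI[OF U(2)]] by blast
  have pz: "partial i g x = 0" if i: "i < mdim M" and "x \<in> \<phi> ` U" for i x
  proof -
    obtain r where r: "r \<in> U" "x = \<phi> r" using \<open>x \<in> \<phi> ` U\<close> by blast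
    have "r \<in> points M" using r UM by blast
    from z[OF this coordinate_tangent_vector[OF M U(1) r(1) i]] show ?thesis
      using f r by (simp add: g_def)
  qed
  \<comment> \<open>The chart domain may be disconnected; only points in this box are known to be
    joined to \<open>\<phi> p\<close> by a segment inside the chart image.\<close>
  define B where "B = {y \<in> \<phi> ` U. \<forall>j<mdim M. \<bar>y j - \<phi> p j\<bar> < \<delta>}"
  have "openin (Euclidean_space (mdim M)) B"
  proof -
    have "open (\<Inter>j\<in>{..<mdim M}. (\<lambda>y. y j) -` {t. \<bar>t - \<phi> p j\<bar> < \<delta>})"
    proof (intro open_INT ballI)
      fix j
      have "{t. \<bar>t - \<phi> p j\<bar> < \<delta>} = ball (\<phi> p j) \<delta>" by (auto simp: dist_real_def)
      then show "open ((\<lambda>y::nat\<Rightarrow>real. y j) -` {t. \<bar>t - \<phi> p j\<bar> < \<delta>})"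
        by (auto intro: open_vimage continuous_on_product_coordinates)
    qed simp
    moreover have "B = \<phi> ` U \<inter> (\<Inter>j\<in>{..<mdim M}. (\<lambda>y. y j) -` {t. \<bar>t - \<phi> p j\<bar> < \<delta>})"
      by (auto simp: B_def)
    ultimately show ?thesis using V unfolding Euclidean_space_top_of_set
      by (simp only: openin_Int_open)
  qed
  then have "openin (subtopology (Euclidean_space (mdim M)) (\<phi> ` U)) B"
    by (auto simp: openin_subtopology B_def)
  then have "openin (subtopology (mtop M) U) {q \<in> topspace (subtopology (mtop M) U). \<phi> q \<in> B}"
    by (rule openin_continuous_map_preimage[OF homeomorphic_imp_continuous_map[OF chart_homeomorphic[OF M U(1)]]])
  then have "openin (mtop M) {q \<in> topspace (subtopology (mtop M) U). \<phi> q \<in> B}"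
    using chart_open[OF M U(1)] openin_trans_full by blast
  have fc: "f q = f p" if "q \<in> U" "\<phi> q \<in> B" for q
  proof -
    have "g (\<phi> q) = g (\<phi> p)"
    proof (rule vanishing_partials_constant_on_box[OF V g pz \<delta>(2) \<delta>(1)])
      show "\<phi> q j = 0" if "mdim M \<le> j" for j
        using openin_Euclidean_space_zero[OF V imageI[OF \<open>q \<in> U\<close>] that] .
    qed (use that U in \<open>auto simp: B_def\<close>)
    then show ?thesis by (simp add: g_def inv_into_chart[OF M U(1)] U(2) that)
  qed
  show "\<exists>W. openin (mtop M) W \<and> p \<in> W \<and> (\<forall>q\<in>W. f q = f p)"
  proof (intro exI conjI ballI)
    show "openin (mtop M) {q \<in> topspace (subtopology (mtop M) U). \<phi> q \<in> B}" by fact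
    show "p \<in> {q \<in> topspace (subtopology (mtop M) U). \<phi> q \<in> B}"
      using U UM \<delta>(1) by (auto simp: B_def)
    fix q assume "q \<in> {q \<in> topspace (subtopology (mtop M) U). \<phi> q \<in> B}"
    then have "q \<in> U" "\<phi> q \<in> B" by auto
    then show "f q = f p" by (rule fc)
  qed
qed

text \<open>Unlike \<open>leafwise_constant_functions\<close> this asks neither for smoothness nor
  for vanishing off \<open>C\<close>, so it applies directly to matrix entries.\<close>

definition leafwise_constant :: "'c manifold \<Rightarrow> ('c \<Rightarrow> 'c tangent_vector set) \<Rightarrow> ('c \<Rightarrow> 'a) \<Rightarrow> bool" where
  "leafwise_constant C D f \<longleftrightarrow> (\<forall>S\<in>leaves C D. \<forall>p\<in>S. \<forall>q\<in>S. f p = f q)"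

text \<open>A vector in \<open>D p\<close> comes from a tangent vector of the leaf through
  \<open>p\<close>, and on that leaf \<open>f\<close> restricts to a constant.\<close>

lemma leafwise_constant_derivative:
  assumes C: "smooth_manifold C" and int: "integrable_distribution C D"
    and f: "f \<in> smooth_functions C" and lc: "leafwise_constant C D f"
    and p: "p \<in> points C" and v: "v \<in> D p"
  shows "v f = 0"
proof -
  obtain L where L: "maximal_integral_manifold C D L" "p \<in> points L"
    using int p unfolding integrable_distribution_def by blast
  then have LC: "points L \<subseteq> points C" and Lm: "smooth_manifold L"
    and D: "differential L C (\<lambda>p. p) ` tangent_space L p = D p"
    unfolding maximal_integral_manifold_def integral_manifold_def by auto
  obtain w where w: "w \<in> tangent_space L p" "v = differential L C (\<lambda>p. p) w"
    using v D by blast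
  have "pullback L (\<lambda>p. p) f = (\<lambda>q. if q \<in> points L then f p else 0)"
    using lc L unfolding leafwise_constant_def leaves_def pullback_def by fastforce
  then show ?thesis
    using tangent_space_const[OF Lm w(1) L(2)] by (simp add: w(2) differential_def)
qed

text \<open>The value of a smooth distribution at a point is spanned by its global sections, so
  every tangent vector of a leaf annihilates \<open>f\<close>. The leaf is connected in its own
  topology, and \<open>f\<close> is constant on it.\<close>

lemma leafwise_constantI:
  assumes C: "smooth_manifold C" and dist: "smooth_distribution C D"
    and f: "f \<in> smooth_functions C"
    and z: "\<And>Y p. Y \<in> dist_sections C D \<Longrightarrow> p \<in> points C \<Longrightarrow> Y p f = 0"
  shows "leafwise_constant C D f"
  unfolding leafwise_constant_def
proof (intro ballI)
  fix S p q assume "S \<in> leaves C D" and pq: "p \<in> S" "q \<in> S"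
  then obtain L where S: "S = points L" and L: "maximal_integral_manifold C D L"
    unfolding leaves_def by blast
  then have LC: "points L \<subseteq> points C" and Lm: "smooth_manifold L" and con: "connected_space (mtop L)"
    and inc: "smooth_map_on L (points L) C (\<lambda>p. p)"
    and D: "\<And>p. p \<in> points L \<Longrightarrow> differential L C (\<lambda>p. p) ` tangent_space L p = D p"
    unfolding maximal_integral_manifold_def integral_manifold_def injective_immersion_def by auto
  let ?g = "pullback L (\<lambda>p. p) f"
  have "?g p = ?g q"
  proof (rule vanishing_tangent_constant[OF Lm con pullback_smooth_functions[OF Lm C inc f]])
    fix r v assume r: "r \<in> points L" and v: "v \<in> tangent_space L r"
    have "differential L C (\<lambda>p. p) v \<in> D r" using D[OF r] v by blast
    then obtain Y where "Y \<in> dist_sections C D" "Y r = differential L C (\<lambda>p. p) v"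
      using dist r LC unfolding smooth_distribution_def by blast
    then have "differential L C (\<lambda>p. p) v f = 0" using z r LC by (metis subsetD)
    then show "v ?g = 0" using f by (simp add: differential_def)
  qed (use pq S in auto)
  then show "f p = f q" using pq S by (simp add: pullback_def)
qed

section \<open>The real line as a manifold, and curves in leaves\<close>

lemma smooth_manifold_real_line: "smooth_manifold real_line"
proof -
  define \<phi> :: "real \<Rightarrow> nat \<Rightarrow> real" where "\<phi> t = (\<lambda>i. if i = 0 then t else 0)" for t
  have img: "range \<phi> = topspace (Euclidean_space 1)"
  proof -
    have "x = \<phi> (x 0)" if "x \<in> topspace (Euclidean_space 1)" for x
      using that by (auto simp: topspace_Euclidean_space \<phi>_def fun_eq_iff)
    then show ?thesis by (auto simp: topspace_Euclidean_space \<phi>_def)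
  qed
  have inv: "inv_into UNIV \<phi> x = x 0" if "x \<in> range \<phi>" for x
    using that by (auto intro!: inv_into_f_eq simp: inj_def \<phi>_def fun_eq_iff split: if_splits)
  have "continuous_on UNIV \<phi>"
  proof (rule continuous_on_coordinatewise_then_product)
    show "continuous_on UNIV (\<lambda>t. \<phi> t i)" for i by (cases "i = 0") (simp_all add: \<phi>_def)
  qed
  then have "homeomorphic_maps euclideanreal (Euclidean_space 1) \<phi> (\<lambda>x. x 0)"
    unfolding homeomorphic_maps_def Euclidean_space_top_of_set
    by (auto simp: continuous_map_in_subtopology \<phi>_def fun_eq_iff
        intro: continuous_on_subset[OF continuous_on_product_coordinates])
  then have hom: "homeomorphic_map euclideanreal (Euclidean_space 1) \<phi>"
    using homeomorphic_map_maps by blast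
  have sm: "smooth_on 1 (range \<phi>) (\<lambda>x. \<phi> (inv_into UNIV \<phi> x) i)" if "i < 1" for i
    unfolding smooth_on_def
  proof
    fix k
    have op: "openin (Euclidean_space 1) (range \<phi>)" unfolding img by simp
    show "Ck_on 1 k (range \<phi>) (\<lambda>x. \<phi> (inv_into UNIV \<phi> x) i)"
      by (rule Ck_on_cong_imp[OF op Ck_on_coordinate[of 0 1 _ k]])
        (use op that in \<open>auto simp: inv \<phi>_def\<close>)
  qed
  have "second_countable euclideanreal"
    unfolding second_countable_def
  proof -
    obtain B :: "real set set" where B: "countable B" "topological_basis B" using ex_countable_basis by blast
    show "\<exists>\<B>. countable \<B> \<and> (\<forall>V\<in>\<B>. openin euclideanreal V) \<and>
        (\<forall>U x. openin euclideanreal U \<and> x \<in> U \<longrightarrow> (\<exists>V\<in>\<B>. x \<in> V \<and> V \<subseteq> U))"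
      using B topological_basis_open[OF B(2)] topological_basisE[OF B(2)]
      by (intro exI[of _ B]) (metis open_openin)
  qed
  then show ?thesis
    using hom sm img unfolding smooth_manifold_def real_line_def \<phi>_def[abs_def] by simp
qed

lemma smooth_fun_on_real_line:
  assumes "open J" "smooth_fun_on real_line J f" "t \<in> J"
  shows "(f has_real_derivative deriv f t) (at t)"
proof -
  define \<phi> :: "real \<Rightarrow> nat \<Rightarrow> real" where "\<phi> t = (\<lambda>i. if i = 0 then t else 0)" for t
  have inv: "inv_into UNIV \<phi> (\<phi> s) = s" for s
    by (rule inv_into_f_f) (auto simp: inj_def \<phi>_def fun_eq_iff split: if_splits)
  have "(UNIV, \<phi>) \<in> atlas real_line" "mdim real_line = 1"
    by (simp_all add: real_line_def \<phi>_def[abs_def])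
  then have "Ck_on 1 (Suc 0) (\<phi> ` J) (\<lambda>x. f (inv_into UNIV \<phi> x))"
    using assms(2) unfolding smooth_fun_on_Ck by fastforce
  then have "((\<lambda>s. f (inv_into UNIV \<phi> ((\<phi> t)(0 := s)))) has_real_derivative
      partial 0 (\<lambda>x. f (inv_into UNIV \<phi> x)) (\<phi> t)) (at (\<phi> t 0))"
    using assms(3) by (auto simp: Ck_on_Suc)
  moreover have "(\<phi> t)(0 := s) = \<phi> s" for s by (auto simp: \<phi>_def)
  ultimately have "(f has_real_derivative partial 0 (\<lambda>x. f (inv_into UNIV \<phi> x)) (\<phi> t)) (at t)"
    by (simp add: inv) (simp add: \<phi>_def)
  then show ?thesis using DERIV_imp_deriv by metis
qed

text \<open>The curve is smooth into the leaf \<open>L\<close>, whose topology may be finer than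
  that induced by \<open>C\<close>; so \<open>f\<close> is first restricted to the leaf and then to
  the curve.\<close>

lemma curve_derivative:
  assumes C: "smooth_manifold C" and L: "smooth_manifold L" and inc: "smooth_map_on L (points L) C (\<lambda>p. p)"
    and I: "open I" and \<gamma>: "smooth_map_on real_line I L \<gamma>" and f: "f \<in> smooth_functions C" and t: "t \<in> I"
  shows "((\<lambda>u. f (\<gamma> u)) has_real_derivative deriv (\<lambda>u. f (\<gamma> u)) t) (at t)"
proof -
  have I': "openin (mtop real_line) I" using I by (simp add: real_line_def)
  have "smooth_fun_on L (points L) (\<lambda>p. f p)"
    by (rule smooth_fun_on_compose[OF L C inc openin_topspace]) (use f in \<open>simp add: smooth_functions_def\<close>)
  then have "smooth_fun_on real_line I (\<lambda>u. f (\<gamma> u))"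
    by (intro smooth_fun_on_compose[OF smooth_manifold_real_line L \<gamma> I']) simp
  then show ?thesis by (rule smooth_fun_on_real_line[OF I _ t])
qed

section \<open>Matrices acting on finite sequences\<close>

abbreviation coord :: "fin_seq \<Rightarrow> nat \<Rightarrow> real" where
  "coord \<equiv> Poly_Mapping.lookup"

abbreviation basis_vec :: "nat \<Rightarrow> fin_seq" where
  "basis_vec j \<equiv> Poly_Mapping.single j 1"

definition fin_vec :: "nat \<Rightarrow> (nat \<Rightarrow> real) \<Rightarrow> fin_seq" where
  "fin_vec n f = (\<Sum>i<n. Poly_Mapping.single i (f i))"

text \<open>Matrices are functions on all index pairs of which only the \<open>n\<close> by
  \<open>m\<close> window is read, and the result is cut off at \<open>n\<close>. Accordingly,
  matrices are compared through their action or on the window.\<close>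

definition mat_app :: "nat \<Rightarrow> nat \<Rightarrow> (nat \<Rightarrow> nat \<Rightarrow> real) \<Rightarrow> fin_seq \<Rightarrow> fin_seq" where
  "mat_app n m A v = fin_vec n (\<lambda>i. \<Sum>j<m. A i j * coord v j)"

definition mat_mult :: "nat \<Rightarrow> (nat \<Rightarrow> nat \<Rightarrow> real) \<Rightarrow> (nat \<Rightarrow> nat \<Rightarrow> real) \<Rightarrow> nat \<Rightarrow> nat \<Rightarrow> real" where
  "mat_mult k A B = (\<lambda>i j. \<Sum>l<k. A i l * B l j)"

definition fin_space :: "nat \<Rightarrow> fin_seq set" where
  "fin_space n = {v. \<forall>i\<ge>n. coord v i = 0}"

lemma fin_seq_eqI: "(\<And>i. coord v i = coord w i) \<Longrightarrow> v = w"
  by (rule poly_mapping_eqI)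

lemma coord_scaleR [simp]: "coord (a *\<^sub>R v) i = a * coord v i"
proof -
  have "finite {i. a * coord v i \<noteq> 0}"
    by (rule finite_subset[of _ "{i. coord v i \<noteq> 0}"]) (auto simp: finite_lookup)
  then show ?thesis by (simp add: scaleR_poly_mapping_def)
qed

lemma coord_fin_vec [simp]: "coord (fin_vec n f) i = (if i < n then f i else 0)"
proof -
  have "coord (fin_vec n f) i = (\<Sum>k<n. if k = i then f i else 0)"
    unfolding fin_vec_def lookup_sum by (rule sum.cong) (auto simp: lookup_single when_def)
  then show ?thesis by simp
qed

lemma coord_mat_app [simp]: "coord (mat_app n m A v) i = (if i < n then \<Sum>j<m. A i j * coord v j else 0)"
  by (simp add: mat_app_def)

lemma fin_vec_in [simp]: "fin_vec n f \<in> fin_space n"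
  by (simp add: fin_space_def)

lemma mat_app_in [simp]: "mat_app n m A v \<in> fin_space n"
  by (simp add: mat_app_def)

lemma fin_vec_coord: "v \<in> fin_space n \<Longrightarrow> fin_vec n (coord v) = v"
  by (rule fin_seq_eqI) (auto simp: fin_space_def not_less)

lemma mat_app_add: "mat_app n m A (v + w) = mat_app n m A v + mat_app n m A w"
  by (rule fin_seq_eqI) (auto simp: lookup_add algebra_simps sum.distrib)

lemma mat_app_scaleR: "mat_app n m A (a *\<^sub>R v) = a *\<^sub>R mat_app n m A v"
  by (rule fin_seq_eqI) (auto simp: sum_distrib_left algebra_simps)

lemma mat_app_diff: "mat_app n m A (v - w) = mat_app n m A v - mat_app n m A w"
  by (rule fin_seq_eqI) (auto simp: lookup_minus algebra_simps sum_subtractf)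

lemma mat_app_zero [simp]: "mat_app n m A 0 = 0"
  by (rule fin_seq_eqI) simp

lemma mat_app_mult: "mat_app n m (mat_mult k A B) v = mat_app n k A (mat_app k m B v)"
proof (rule fin_seq_eqI)
  fix i
  have "(\<Sum>j<m. (\<Sum>l<k. A i l * B l j) * coord v j) = (\<Sum>j<m. \<Sum>l<k. A i l * (B l j * coord v j))"
    by (simp add: sum_distrib_right mult.assoc)
  also have "\<dots> = (\<Sum>l<k. A i l * (\<Sum>j<m. B l j * coord v j))"
    by (subst sum.swap) (simp add: sum_distrib_left)
  finally show "coord (mat_app n m (mat_mult k A B) v) i = coord (mat_app n k A (mat_app k m B v)) i"
    by (simp add: mat_mult_def)
qed

lemma coord_mat_app_single:
  "i < n \<Longrightarrow> j < m \<Longrightarrow> coord (mat_app n m A (basis_vec j)) i = A i j"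
  by (simp add: lookup_single when_def if_distrib sum.delta cong: if_cong)

lemma mat_app_eqD:
  assumes "\<And>v. mat_app n m A v = mat_app n m B v" "i < n" "j < m"
  shows "A i j = B i j"
  using coord_mat_app_single[OF assms(2,3)] assms(1) by metis

lemma mat_app_cong:
  assumes "\<And>i j. i < n \<Longrightarrow> j < m \<Longrightarrow> A i j = B i j"
  shows "mat_app n m A v = mat_app n m B v"
  by (rule fin_seq_eqI) (use assms in simp)

section \<open>Factorization of idempotents and the trace\<close>

definition trace_upto :: "nat \<Rightarrow> (nat \<Rightarrow> nat \<Rightarrow> real) \<Rightarrow> real" where
  "trace_upto n A = (\<Sum>i<n. A i i)"

text \<open>The linear algebra of a frame: \<open>B\<close> embeds the \<open>r\<close>-dimensional
  space into the \<open>n\<close>-dimensional one and \<open>K\<close> is a left inverse, so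
  \<open>B K\<close> is an idempotent of rank \<open>r\<close>.\<close>

definition section_retraction :: "nat \<Rightarrow> nat \<Rightarrow> (nat \<Rightarrow> nat \<Rightarrow> real) \<Rightarrow> (nat \<Rightarrow> nat \<Rightarrow> real) \<Rightarrow> bool" where
  "section_retraction n r B K \<longleftrightarrow> (\<forall>w\<in>fin_space r. mat_app r n K (mat_app n r B w) = w)"

text \<open>The trace of B K equals that of K B, which is the identity of the
  \<open>r\<close>-dimensional space.\<close>

lemma section_retraction_trace:
  assumes BK: "section_retraction n r B K"
  shows "trace_upto n (mat_mult r B K) = real r"
proof -
  have KB: "(\<Sum>i<n. K a i * B i a) = 1" if "a < r" for a
  proof -
    have "basis_vec a \<in> fin_space r"
      using that by (auto simp: fin_space_def lookup_single when_def)
    then have "mat_app r r (mat_mult n K B) (basis_vec a) = basis_vec a"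
      using BK by (simp add: section_retraction_def mat_app_mult)
    then have "mat_mult n K B a a = coord (basis_vec a) a"
      using coord_mat_app_single[OF that that] by metis
    then show ?thesis by (simp add: mat_mult_def)
  qed
  have "trace_upto n (mat_mult r B K) = (\<Sum>a<r. \<Sum>i<n. K a i * B i a)"
    unfolding trace_upto_def mat_mult_def by (subst sum.swap) (simp add: mult.commute)
  then show ?thesis by (simp add: KB)
qed

lemma idempotent_factorization:
  assumes idem: "\<And>v. mat_app n n e (mat_app n n e v) = mat_app n n e v"
  obtains r B K where "section_retraction n r B K" "\<And>v. mat_app n n (mat_mult r B K) v = mat_app n n e v"
proof -
  let ?F = "range (mat_app n n e)"
  obtain b where b: "b \<subseteq> ?F" "independent b" "?F \<subseteq> span b"
    using maximal_independent_subset by blast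
  \<comment> \<open>This bounds the dimension of the image and makes the basis \<open>b\<close>
    finite.\<close>
  have "?F \<subseteq> span (basis_vec ` {..<n})"
  proof safe
    fix v
    have "Poly_Mapping.single i c = c *\<^sub>R basis_vec i" for i :: nat and c :: real
      by (rule fin_seq_eqI) (simp add: lookup_single when_def)
    then have "Poly_Mapping.single i c \<in> span (basis_vec ` {..<n})"
      if "i < n" for i :: nat and c :: real
      using that by (metis imageI lessThan_iff span_base span_scale)
    then show "mat_app n n e v \<in> span (basis_vec ` {..<n})"
      unfolding mat_app_def fin_vec_def by (auto intro!: span_sum)
  qed
  then have fin: "finite b"
    using independent_span_bound[OF _ b(2)] b(1) by (meson finite_imageI finite_lessThan subset_trans)
  define r where "r = card b"
  obtain h where h: "bij_betw h {..<r} b"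
    using ex_bij_betw_nat_finite[OF fin] unfolding r_def atLeast0LessThan by blast
  have hb: "h a \<in> b" if "a < r" for a using h that by (auto simp: bij_betw_def)
  have hF: "h a \<in> fin_space n" if "a < r" for a using hb[OF that] b(1) by auto
  \<comment> \<open>The columns of \<open>?B\<close> are a basis of the image of \<open>e\<close>,
    and \<open>?K\<close> gives the coefficients of \<open>e v\<close> in that basis. Thus B K = e,
    and K B is the identity because \<open>e\<close> fixes its image.\<close>
  let ?B = "\<lambda>i a. coord (h a) i"
  let ?K = "\<lambda>a j. representation b (mat_app n n e (basis_vec j)) (h a)"
  have B: "mat_app n r ?B w = (\<Sum>a<r. coord w a *\<^sub>R h a)" for w
    by (rule fin_seq_eqI) (use hF in \<open>auto simp: lookup_sum mult.commute fin_space_def not_less\<close>)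
  have K: "coord (mat_app r n ?K v) a = representation b (mat_app n n e v) (h a)" if "a < r" for v a
  proof -
    have "mat_app n n e v = (\<Sum>j<n. coord v j *\<^sub>R mat_app n n e (basis_vec j))"
      by (rule fin_seq_eqI)
        (auto simp: lookup_sum mult.commute lookup_single when_def if_distrib sum.delta cong: if_cong)
    moreover have s: "mat_app n n e (basis_vec j) \<in> span b" for j using b(3) by blast
    ultimately have "representation b (mat_app n n e v) = (\<lambda>y. \<Sum>j<n. coord v j * representation b (mat_app n n e (basis_vec j)) y)"
      using representation_sum[OF b(2), of "{..<n}" "\<lambda>j. coord v j *\<^sub>R mat_app n n e (basis_vec j)"]
        representation_scale[OF b(2) s] span_scale[OF s] by auto
    then show ?thesis using that by (simp add: mult.commute)
  qed
  have BK: "mat_app n r ?B (mat_app r n ?K v) = mat_app n n e v" for v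
  proof -
    have "mat_app n r ?B (mat_app r n ?K v) = (\<Sum>a<r. representation b (mat_app n n e v) (h a) *\<^sub>R h a)"
      unfolding B by (rule sum.cong) (use K in auto)
    also have "\<dots> = (\<Sum>y\<in>b. representation b (mat_app n n e v) y *\<^sub>R y)"
      using sum.reindex_bij_betw[OF h] .
    also have "\<dots> = mat_app n n e v"
      by (rule real_vector.sum_representation_eq) (use b fin in auto)
    finally show ?thesis .
  qed
  have KB: "mat_app r n ?K (mat_app n r ?B w) = w" if w: "w \<in> fin_space r" for w
  proof (rule fin_seq_eqI)
    fix a
    let ?u = "mat_app n r ?B w"
    have eu: "mat_app n n e (h a) = h a" if "a < r" for a using hb[OF that] b(1) idem by auto
    have "mat_app n n e ?u = ?u"
    proof -
      have "mat_app n n e (\<Sum>a\<in>R. coord w a *\<^sub>R h a) = (\<Sum>a\<in>R. coord w a *\<^sub>R h a)"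
        if "R \<subseteq> {..<r}" for R
        using that by (induction R rule: infinite_finite_induct) (auto simp: mat_app_add mat_app_scaleR eu)
      then show ?thesis unfolding B by blast
    qed
    moreover have "representation b ?u (h a) = coord w a" if a: "a < r"
    proof -
      have s: "h a \<in> span b" if "a < r" for a using hb[OF that] by (rule span_base)
      have "representation b ?u = (\<lambda>y. \<Sum>c<r. coord w c * representation b (h c) y)"
        unfolding B using representation_sum[OF b(2), of "{..<r}" "\<lambda>c. coord w c *\<^sub>R h c"]
          representation_scale[OF b(2) s] span_scale[OF s] by auto
      then have "representation b ?u (h a) = (\<Sum>c<r. coord w c * (if h a = h c then 1 else 0))"
        using representation_basis[OF b(2) hb] by auto
      also have "\<dots> = (\<Sum>c<r. if c = a then coord w a else 0)"
        by (rule sum.cong) (use h a in \<open>auto simp: bij_betw_def inj_on_def\<close>)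
      finally show ?thesis using a by simp
    qed
    ultimately show "coord (mat_app r n ?K ?u) a = coord w a"
      using K w by (cases "a < r") (auto simp: fin_space_def not_less simp del: coord_mat_app, simp)
  qed
  show thesis
    by (rule that[of r ?B ?K]) (auto simp: section_retraction_def KB mat_app_mult BK)
qed

section \<open>Determinants, inverses and their smooth dependence on the entries\<close>

definition mat_det :: "nat \<Rightarrow> (nat \<Rightarrow> nat \<Rightarrow> real) \<Rightarrow> real" where
  "mat_det n A = Determinant.det (Matrix.mat n n (\<lambda>(i, j). A i j))"

text \<open>The adjugate over the determinant: this formula shows that the inverse depends smoothly
  on the entries wherever the determinant is nonzero.\<close>

definition mat_inv :: "nat \<Rightarrow> (nat \<Rightarrow> nat \<Rightarrow> real) \<Rightarrow> nat \<Rightarrow> nat \<Rightarrow> real" where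
  "mat_inv n A = (\<lambda>i j. adj_mat (Matrix.mat n n (\<lambda>(i, j). A i j)) $$ (i, j) * inverse (mat_det n A))"

lemma mat_inv:
  assumes "mat_det n A \<noteq> 0" "v \<in> fin_space n"
  shows mat_app_inv: "mat_app n n A (mat_app n n (mat_inv n A) v) = v"
    and mat_inv_app: "mat_app n n (mat_inv n A) (mat_app n n A v) = v"
proof -
  let ?A = "Matrix.mat n n (\<lambda>(i, j). A i j)"
  have A: "?A \<in> carrier_mat n n" by simp
  note adj = adj_mat[OF A]
  \<comment> \<open>Because of the cut-off at \<open>n\<close>, the identity matrix acts as the
    identity on \<open>fin_space n\<close> only.\<close>
  have one: "mat_app n n (\<lambda>i j. if i = j then 1 else 0) v = v"
  proof (rule fin_seq_eqI)
    fix i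
    have "(\<Sum>j<n. (if i = j then 1 else 0) * coord v j) = (\<Sum>j<n. if i = j then coord v i else 0)"
      by (rule sum.cong) auto
    then show "coord (mat_app n n (\<lambda>i j. if i = j then 1 else 0) v) i = coord v i"
      using assms(2) by (simp add: fin_space_def)
  qed
  have 1: "mat_mult n A (mat_inv n A) i j = (if i = j then 1 else 0)" if ij: "i < n" "j < n" for i j
  proof -
    have "(?A * adj_mat ?A) $$ (i, j) = (\<Sum>l<n. A i l * adj_mat ?A $$ (l, j))"
      using ij adj(1) by (auto simp: scalar_prod_def atLeast0LessThan intro!: sum.cong)
    moreover have "(?A * adj_mat ?A) $$ (i, j) = (if i = j then mat_det n A else 0)"
      unfolding adj(2) using ij by (simp add: mat_det_def)
    ultimately have "(\<Sum>l<n. A i l * adj_mat ?A $$ (l, j)) * inverse (mat_det n A) = (if i = j then 1 else 0)"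
      using assms(1) by auto
    then show ?thesis by (simp add: mat_mult_def mat_inv_def sum_distrib_right mult.assoc)
  qed
  show "mat_app n n A (mat_app n n (mat_inv n A) v) = v"
    unfolding mat_app_mult[symmetric] by (subst mat_app_cong[OF 1]) (simp_all only: one)
  have 2: "mat_mult n (mat_inv n A) A i j = (if i = j then 1 else 0)" if ij: "i < n" "j < n" for i j
  proof -
    have "(adj_mat ?A * ?A) $$ (i, j) = (\<Sum>l<n. adj_mat ?A $$ (i, l) * A l j)"
      using ij adj(1) by (auto simp: scalar_prod_def atLeast0LessThan intro!: sum.cong)
    moreover have "(adj_mat ?A * ?A) $$ (i, j) = (if i = j then mat_det n A else 0)"
      unfolding adj(3) using ij by (simp add: mat_det_def)
    ultimately have "(\<Sum>l<n. adj_mat ?A $$ (i, l) * A l j) * inverse (mat_det n A) = (if i = j then 1 else 0)"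
      using assms(1) by auto
    moreover have "mat_mult n (mat_inv n A) A i j = (\<Sum>l<n. adj_mat ?A $$ (i, l) * A l j) * inverse (mat_det n A)"
      unfolding mat_mult_def mat_inv_def sum_distrib_right by (rule sum.cong) auto
    ultimately show ?thesis by simp
  qed
  show "mat_app n n (mat_inv n A) (mat_app n n A v) = v"
    unfolding mat_app_mult[symmetric] by (subst mat_app_cong[OF 2]) (simp_all only: one)
qed

text \<open>By the Leibniz formula the determinant is a polynomial in the entries. The side
  condition is that permutations of the indices below \<open>n\<close> keep them below
  \<open>n\<close>.\<close>

lemma smooth_fun_on_det:
  assumes M: "smooth_manifold M" "openin (mtop M) W"
    and A: "\<And>p. A p \<in> carrier_mat n n"
    and s: "\<And>i j. i < n \<Longrightarrow> j < n \<Longrightarrow> smooth_fun_on M W (\<lambda>p. A p $$ (i, j))"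
  shows "smooth_fun_on M W (\<lambda>p. Determinant.det (A p))"
  unfolding det_def'[OF A]
proof (intro smooth_fun_on_sum[OF M] smooth_fun_on_mult[OF M] smooth_fun_on_prod[OF M] smooth_fun_on_const s)
  fix p i assume "p \<in> {p. p permutes {0..<n}}" "i \<in> {0..<n}"
  then show "p i < n" using permutes_in_image[of p "{0..<n}" i] by auto
qed auto

lemma smooth_fun_on_mat_det:
  assumes M: "smooth_manifold M" "openin (mtop M) W"
    and A: "\<And>i j. i < n \<Longrightarrow> j < n \<Longrightarrow> smooth_fun_on M W (\<lambda>p. A p i j)"
  shows "smooth_fun_on M W (\<lambda>p. mat_det n (A p))"
  unfolding mat_det_def by (rule smooth_fun_on_det[OF M]) (use A in auto)

lemma smooth_fun_on_mat_inv:
  assumes M: "smooth_manifold M" "openin (mtop M) W"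
    and A: "\<And>i j. i < n \<Longrightarrow> j < n \<Longrightarrow> smooth_fun_on M W (\<lambda>p. A p i j)"
    and nz: "\<And>p. p \<in> W \<Longrightarrow> mat_det n (A p) \<noteq> 0" and ij: "i < n" "j < n"
  shows "smooth_fun_on M W (\<lambda>p. mat_inv n (A p) i j)"
proof -
  have "smooth_fun_on M W (\<lambda>p. (-1) ^ (j + i) *
      Determinant.det (mat_delete (Matrix.mat n n (\<lambda>(i, j). A p i j)) j i))"
  proof (intro smooth_fun_on_mult[OF M] smooth_fun_on_const smooth_fun_on_det[OF M])
    show "mat_delete (Matrix.mat n n (\<lambda>(i, j). A p i j)) j i \<in> carrier_mat (n - 1) (n - 1)" for p
      by (rule mat_delete_carrier) simp
  qed (use A in \<open>auto simp: mat_delete_def\<close>)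
  from smooth_fun_on_mult[OF M this smooth_fun_on_inverse[OF M smooth_fun_on_mat_det[OF M A] nz]]
  show ?thesis using ij by (simp add: mat_inv_def adj_mat_def cofactor_def)
qed

text \<open>
  For idempotents \<open>e\<close> and \<open>e0\<close> this is \<open>e0 e + (1 - e0) (1 - e)\<close>. It intertwines \<open>e\<close> with \<open>e0\<close> and is
  the identity for \<open>e = e0\<close>; hence it trivializes the images of all \<open>e\<close> near \<open>e0\<close>.
\<close>

definition intertwiner :: "nat \<Rightarrow> (nat \<Rightarrow> nat \<Rightarrow> real) \<Rightarrow> (nat \<Rightarrow> nat \<Rightarrow> real) \<Rightarrow> nat \<Rightarrow> nat \<Rightarrow> real" where
  "intertwiner n e0 e = (\<lambda>i j. (if i = j then 1 else 0) - e i j - e0 i j + 2 * mat_mult n e0 e i j)"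

lemma mat_app_intertwiner:
  assumes "v \<in> fin_space n"
  shows "mat_app n n (intertwiner n e0 e) v =
    v - mat_app n n e v - mat_app n n e0 v + 2 *\<^sub>R mat_app n n e0 (mat_app n n e v)"
proof (rule fin_seq_eqI)
  fix i
  have "(\<Sum>j<n. intertwiner n e0 e i j * coord v j) =
      coord v i - (\<Sum>j<n. e i j * coord v j) - (\<Sum>j<n. e0 i j * coord v j) +
      2 * (\<Sum>j<n. mat_mult n e0 e i j * coord v j)" if "i < n"
  proof -
    have "(\<Sum>j<n. intertwiner n e0 e i j * coord v j) = (\<Sum>j<n. (if i = j then coord v i else 0) -
        e i j * coord v j - e0 i j * coord v j + 2 * (mat_mult n e0 e i j * coord v j))"
      by (rule sum.cong) (auto simp: intertwiner_def algebra_simps)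
    then show ?thesis using that by (simp add: sum.distrib sum_subtractf sum_distrib_left)
  qed
  moreover have "mat_app n n e0 (mat_app n n e v) = mat_app n n (mat_mult n e0 e) v"
    by (simp only: mat_app_mult)
  ultimately show "coord (mat_app n n (intertwiner n e0 e) v) i = coord (v - mat_app n n e v -
      mat_app n n e0 v + 2 *\<^sub>R mat_app n n e0 (mat_app n n e v)) i"
    using assms by (auto simp: lookup_add lookup_minus fin_space_def not_less simp del: mat_app_mult)
qed

lemma mat_det_intertwiner_self:
  assumes "\<And>v. mat_app n n e0 v = mat_app n n e v" "\<And>v. mat_app n n e (mat_app n n e v) = mat_app n n e v"
  shows "mat_det n (intertwiner n e0 e) = 1"
proof -
  have "intertwiner n e0 e i j = (if i = j then 1 else 0)" if ij: "i < n" "j < n" for i j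
  proof -
    have "mat_mult n e0 e i j = e i j"
      by (rule mat_app_eqD[OF _ ij]) (simp add: mat_app_mult assms)
    then show ?thesis using mat_app_eqD[OF assms(1) ij] by (simp add: intertwiner_def)
  qed
  then have "Matrix.mat n n (\<lambda>(i, j). intertwiner n e0 e i j) = 1\<^sub>m n"
    by (intro eq_matI) auto
  then show ?thesis by (simp add: mat_det_def)
qed

section \<open>Image bundles of idempotents\<close>

lemma smooth_fun_on_mat_app:
  assumes M: "smooth_manifold M" "openin (mtop M) W"
    and A: "\<And>i j. i < n \<Longrightarrow> j < m \<Longrightarrow> smooth_fun_on M W (\<lambda>p. A p i j)"
    and v: "\<And>j. j < m \<Longrightarrow> smooth_fun_on M W (\<lambda>p. coord (v p) j)"
  shows "smooth_fun_on M W (\<lambda>p. coord (mat_app n m (A p) (v p)) i)"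
  using A v by (cases "i < n")
    (auto intro!: smooth_fun_on_const smooth_fun_on_sum[OF M] smooth_fun_on_mult[OF M])

definition smooth_idempotent :: "'m manifold \<Rightarrow> nat \<Rightarrow> ('m \<Rightarrow> nat \<Rightarrow> nat \<Rightarrow> real) \<Rightarrow> bool" where
  "smooth_idempotent M n e \<longleftrightarrow>
     (\<forall>i<n. \<forall>j<n. smooth_fun_on M (points M) (\<lambda>p. e p i j)) \<and>
     (\<forall>p\<in>points M. \<forall>v. mat_app n n (e p) (mat_app n n (e p) v) = mat_app n n (e p) v)"

definition idempotent_rank :: "'m manifold \<Rightarrow> nat \<Rightarrow> ('m \<Rightarrow> nat \<Rightarrow> nat \<Rightarrow> real) \<Rightarrow> nat \<Rightarrow> bool" where
  "idempotent_rank M n e r \<longleftrightarrow> (\<forall>p\<in>points M. trace_upto n (e p) = real r)"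

section \<open>Constancy of the rank\<close>

lemma smooth_idempotent_factorization:
  assumes e: "smooth_idempotent M n e" and p: "p \<in> points M"
  obtains r B K where "section_retraction n r B K"
    "\<And>v. mat_app n n (mat_mult r B K) v = mat_app n n (e p) v" "trace_upto n (e p) = real r"
proof -
  obtain r B K where *: "section_retraction n r B K"
    "\<And>v. mat_app n n (mat_mult r B K) v = mat_app n n (e p) v"
    using idempotent_factorization[of n "e p"] e p unfolding smooth_idempotent_def by metis
  have "trace_upto n (e p) = trace_upto n (mat_mult r B K)"
    unfolding trace_upto_def using mat_app_eqD[OF *(2)] by simp
  then show thesis using that[OF *] section_retraction_trace[OF *(1)] by simp
qed

lemma smooth_idempotent_trace_locally_constant:
  assumes M: "smooth_manifold M" and e: "smooth_idempotent M n e" and p: "p \<in> points M"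
  shows "openin (mtop M) {q \<in> points M. trace_upto n (e q) = trace_upto n (e p)}"
proof -
  have "smooth_fun_on M (points M) (\<lambda>p. trace_upto n (e p))"
    using e unfolding trace_upto_def smooth_idempotent_def
    by (intro smooth_fun_on_sum[OF M openin_topspace]) auto
  then have "continuous_map (mtop M) euclidean (\<lambda>p. trace_upto n (e p))"
    using smooth_fun_on_continuous[OF M openin_topspace] by simp
  \<comment> \<open>Radius 1 suffices: the traces are natural numbers, and two of these at distance
    less than 1 are equal.\<close>
  then have "openin (mtop M) {q \<in> points M. trace_upto n (e q) \<in> ball (trace_upto n (e p)) 1}"
    by (rule openin_continuous_map_preimage) simp
  also have "{q \<in> points M. trace_upto n (e q) \<in> ball (trace_upto n (e p)) 1} =
      {q \<in> points M. trace_upto n (e q) = trace_upto n (e p)}"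
  proof (intro Collect_cong conj_cong refl)
    fix q assume q: "q \<in> points M"
    obtain a where "trace_upto n (e p) = real a" using smooth_idempotent_factorization[OF e p] by metis
    moreover obtain b where "trace_upto n (e q) = real b" using smooth_idempotent_factorization[OF e q] by metis
    ultimately show "trace_upto n (e q) \<in> ball (trace_upto n (e p)) 1 \<longleftrightarrow> trace_upto n (e q) = trace_upto n (e p)"
      by (auto simp: dist_real_def)
  qed
  finally show ?thesis .
qed

lemma idempotent_rank_connected:
  assumes M: "smooth_manifold M" and e: "smooth_idempotent M n e" and con: "connected_space (mtop M)"
  obtains r where "idempotent_rank M n e r"
proof (cases "points M = {}")
  case True then show thesis using that[of 0] by (simp add: idempotent_rank_def)
next
  case False
  then obtain p where p: "p \<in> points M" by blast
  obtain r where r: "trace_upto n (e p) = real r" using smooth_idempotent_factorization[OF e p] by metis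
  have "trace_upto n (e q) = trace_upto n (e p)" if "q \<in> points M" for q
  proof (rule connected_locally_constant[OF con _ that p])
    fix x assume x: "x \<in> points M"
    show "\<exists>U. openin (mtop M) U \<and> x \<in> U \<and> (\<forall>q\<in>U. trace_upto n (e q) = trace_upto n (e x))"
      by (rule exI[of _ "{q \<in> points M. trace_upto n (e q) = trace_upto n (e x)}"])
        (use smooth_idempotent_trace_locally_constant[OF M e x] x in simp)
  qed
  then show thesis using that[of r] r by (simp add: idempotent_rank_def)
qed

lemma leaf_of_in:
  assumes "integrable_distribution C D" "p \<in> points C"
  shows "leaf_of C D p \<in> leaves C D" "p \<in> leaf_of C D p"
proof -
  obtain L where L: "maximal_integral_manifold C D L" "p \<in> points L"
    using assms unfolding integrable_distribution_def by blast
  then have S: "points L \<in> leaves C D" unfolding leaves_def by blast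
  show "leaf_of C D p \<in> leaves C D" "p \<in> leaf_of C D p"
    using leaf_of_eq[OF S L(2)] S L(2) by auto
qed

lemma leaves_subset: "S \<in> leaves C D \<Longrightarrow> S \<subseteq> points C"
  unfolding leaves_def maximal_integral_manifold_def integral_manifold_def by auto

lemma leaves_nonempty: "S \<in> leaves C D \<Longrightarrow> S \<noteq> {}"
  unfolding leaves_def maximal_integral_manifold_def integral_manifold_def by auto

definition leafwise_constant_matrix ::
  "'c manifold \<Rightarrow> ('c \<Rightarrow> 'c tangent_vector set) \<Rightarrow> nat \<Rightarrow> ('c \<Rightarrow> nat \<Rightarrow> nat \<Rightarrow> real) \<Rightarrow> bool" where
  "leafwise_constant_matrix C D n e \<longleftrightarrow> (\<forall>i<n. \<forall>j<n. leafwise_constant C D (\<lambda>p. e p i j))"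

lemma idempotent_rank_leafwise:
  assumes C: "smooth_manifold C" and e: "smooth_idempotent C n e"
    and int: "integrable_distribution C D" and lc: "leafwise_constant_matrix C D n e"
    and con: "connected_space (leaf_space C D)"
  obtains r where "idempotent_rank C n e r"
proof (cases "points C = {}")
  case True then show thesis using that[of 0] by (simp add: idempotent_rank_def)
next
  case False
  then obtain p where p: "p \<in> points C" by blast
  \<comment> \<open>The trace as a function on the set of leaves; by leafwise constancy the point
    chosen on the leaf does not matter.\<close>
  define g where "g S = trace_upto n (e (SOME q. q \<in> S))" for S
  have g: "g S = trace_upto n (e q)" if "S \<in> leaves C D" "q \<in> S" for S q
  proof -
    have "(SOME q. q \<in> S) \<in> S" using that(2) by (rule someI)
    then show ?thesis
      using lc that unfolding g_def trace_upto_def leafwise_constant_matrix_def leafwise_constant_def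
      by (intro sum.cong) blast+
  qed
  have gl: "g (leaf_of C D q) = trace_upto n (e q)" if "q \<in> points C" for q
    by (rule g) (use leaf_of_in[OF int that] in auto)
  obtain r where r: "trace_upto n (e p) = real r" using smooth_idempotent_factorization[OF e p] by metis
  have "trace_upto n (e q) = trace_upto n (e p)" if q: "q \<in> points C" for q
  proof -
    have "g (leaf_of C D q) = g (leaf_of C D p)"
    proof (rule connected_locally_constant[OF con])
      fix S assume "S \<in> topspace (leaf_space C D)"
      then have S: "S \<in> leaves C D" by (simp add: topspace_leaf_space[OF int])
      then obtain x where x: "x \<in> S" using leaves_nonempty by blast
      have xC: "x \<in> points C" using leaves_subset[OF S] x by blast
      \<comment> \<open>Openness in the final topology means openness of the preimage in
        \<open>C\<close>, and here the preimage is a level set of the trace.\<close>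
      have "{p \<in> points C. leaf_of C D p \<in> {T \<in> leaves C D. g T = g S}} =
          {q \<in> points C. trace_upto n (e q) = trace_upto n (e x)}"
        using leaf_of_in[OF int] gl g[OF S x] by auto
      then have "openin (leaf_space C D) {T \<in> leaves C D. g T = g S}"
        unfolding openin_leaf_space using smooth_idempotent_trace_locally_constant[OF C e xC] by auto
      then show "\<exists>U. openin (leaf_space C D) U \<and> S \<in> U \<and> (\<forall>T\<in>U. g T = g S)"
        using S by (intro exI[of _ "{T \<in> leaves C D. g T = g S}"]) simp
    qed (use leaf_of_in[OF int] p q in \<open>auto simp: topspace_leaf_space[OF int]\<close>)
    then show ?thesis using gl p q by simp
  qed
  then show thesis using that[of r] r by (simp add: idempotent_rank_def)
qed

section \<open>Trivializations and sections of the image bundle\<close>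

abbreviation trivializes ::
  "nat \<Rightarrow> nat \<Rightarrow> (nat \<Rightarrow> nat \<Rightarrow> real) \<Rightarrow> (nat \<Rightarrow> nat \<Rightarrow> real) \<Rightarrow> (nat \<Rightarrow> nat \<Rightarrow> real) \<Rightarrow> bool" where
  "trivializes n r B K e \<equiv> mat_det n (intertwiner n (mat_mult r B K) e) \<noteq> 0"

definition image_bundle ::
  "'m manifold \<Rightarrow> nat \<Rightarrow> nat \<Rightarrow> ('m \<Rightarrow> nat \<Rightarrow> nat \<Rightarrow> real) \<Rightarrow> ('m, fin_seq) vbundle" where
  "image_bundle M n r e = \<lparr> rank = r, fibre = (\<lambda>p. {v. mat_app n n (e p) v = v}),
     trivs = (\<lambda>(B, K). ({p \<in> points M. trivializes n r B K (e p)},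
       \<lambda>p v. coord (mat_app r n K v))) ` {(B, K). section_retraction n r B K} \<rparr>"

lemma rank_image_bundle [simp]: "rank (image_bundle M n r e) = r"
  and fibre_image_bundle [simp]: "fibre (image_bundle M n r e) p = {v. mat_app n n (e p) v = v}"
  by (simp_all add: image_bundle_def)

lemma pullback_image_bundle:
  assumes "\<And>c. c \<in> points C \<Longrightarrow> \<iota> c \<in> points M"
  shows "pullback_bundle C \<iota> (image_bundle M n r e) = image_bundle C n r (\<lambda>c. e (\<iota> c))"
  unfolding pullback_bundle_def image_bundle_def
  using assms by (auto simp: image_image case_prod_unfold intro!: image_cong)

text \<open>The inverse of the trivialization \<open>K\<close> on a fibre: \<open>B w\<close> lies
  in the image of B K, and the inverse intertwiner carries that image to the image of
  \<open>e\<close>.\<close>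

definition local_lift ::
  "nat \<Rightarrow> nat \<Rightarrow> (nat \<Rightarrow> nat \<Rightarrow> real) \<Rightarrow> (nat \<Rightarrow> nat \<Rightarrow> real) \<Rightarrow> (nat \<Rightarrow> nat \<Rightarrow> real) \<Rightarrow> fin_seq \<Rightarrow> fin_seq" where
  "local_lift n r B K e w = mat_app n n (mat_inv n (intertwiner n (mat_mult r B K) e)) (mat_app n r B w)"

text \<open>With e0 = B K and G the intertwiner, G e = e0 e = e0 G. If e v = v, then G v = B K v,
  which gives the first claim. For u = G^-1 B w one gets G (e u) = e0 (G u) = B w = G u, so e u = u;
  then B K u = e0 e u = G u = B w, and \<open>K\<close> cancels \<open>B\<close>.\<close>

lemma local_lift:
  assumes BK: "section_retraction n r B K"
    and det: "trivializes n r B K e"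
    and idem: "\<And>v. mat_app n n e (mat_app n n e v) = mat_app n n e v"
  shows local_lift_retract: "mat_app n n e v = v \<Longrightarrow> local_lift n r B K e (mat_app r n K v) = v"
    and local_lift_in: "w \<in> fin_space r \<Longrightarrow> mat_app n n e (local_lift n r B K e w) = local_lift n r B K e w"
    and retract_local_lift: "w \<in> fin_space r \<Longrightarrow> mat_app r n K (local_lift n r B K e w) = w"
proof -
  let ?P = "mat_app n n (mat_mult r B K)" and ?e = "mat_app n n e"
  let ?G = "mat_app n n (intertwiner n (mat_mult r B K) e)"
  have e0: "?P v = mat_app n r B (mat_app r n K v)" for v by (rule mat_app_mult)
  have e0B: "?P (mat_app n r B w) = mat_app n r B w" if "w \<in> fin_space r" for w
    using BK that by (simp add: e0 section_retraction_def)
  have e0e0: "?P (?P v) = ?P v" for v unfolding e0[of v] by (rule e0B) simp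
  have Ge: "?G (?e v) = ?P (?e v)" for v
    by (simp add: mat_app_intertwiner idem scaleR_2)
  show "local_lift n r B K e (mat_app r n K v) = v" if v: "?e v = v"
  proof -
    have "v \<in> fin_space n" using mat_app_in[of n n e v] v by simp
    moreover have "?G v = mat_app n r B (mat_app r n K v)" using Ge[of v] v e0 by simp
    ultimately show ?thesis using mat_inv_app[OF det] unfolding local_lift_def by metis
  qed
  let ?u = "local_lift n r B K e w"
  have uE: "?u \<in> fin_space n" by (simp add: local_lift_def)
  have Gu: "?G ?u = mat_app n r B w"
    unfolding local_lift_def by (rule mat_app_inv[OF det]) simp
  show eu: "?e ?u = ?u" if w: "w \<in> fin_space r"
  proof -
    have "?P (?G ?u) = ?P (?e ?u)"
      unfolding mat_app_intertwiner[OF uE] mat_app_add mat_app_diff mat_app_scaleR e0e0 by (simp add: scaleR_2)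
    then have "?G (?e ?u) = ?G ?u" unfolding Ge Gu e0B[OF w] by simp
    then show ?thesis using mat_inv_app[OF det] uE mat_app_in by metis
  qed
  show "mat_app r n K ?u = w" if w: "w \<in> fin_space r"
  proof -
    have "mat_app n r B (mat_app r n K ?u) = mat_app n r B w"
      using Ge[of ?u] eu[OF w] Gu e0 by simp
    then show ?thesis using BK w unfolding section_retraction_def by (metis mat_app_in)
  qed
qed

lemma image_bundle_trivsE:
  assumes "(U, t) \<in> trivs (image_bundle M n r e)"
  obtains B K where "section_retraction n r B K" "t = (\<lambda>p v. coord (mat_app r n K v))"
    "U = {p \<in> points M. trivializes n r B K (e p)}"
  using assms by (auto simp: image_bundle_def)

context
  fixes M :: "'m manifold" and n :: nat and e :: "'m \<Rightarrow> nat \<Rightarrow> nat \<Rightarrow> real"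
  assumes M: "smooth_manifold M" and e: "smooth_idempotent M n e"
begin

lemma idem: "p \<in> points M \<Longrightarrow> mat_app n n (e p) (mat_app n n (e p) v) = mat_app n n (e p) v"
  and smooth_entries: "i < n \<Longrightarrow> j < n \<Longrightarrow> smooth_fun_on M (points M) (\<lambda>p. e p i j)"
  using e by (auto simp: smooth_idempotent_def)

lemma smooth_intertwiner:
  "i < n \<Longrightarrow> j < n \<Longrightarrow> smooth_fun_on M (points M) (\<lambda>p. intertwiner n A (e p) i j)"
  unfolding intertwiner_def mat_mult_def
  by (intro smooth_fun_on_add[OF M openin_topspace] smooth_fun_on_diff[OF M openin_topspace]
      smooth_fun_on_mult[OF M openin_topspace] smooth_fun_on_sum[OF M openin_topspace]
      smooth_fun_on_const smooth_entries) auto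

lemma image_bundle_domain_open:
  assumes "(U, t) \<in> trivs (image_bundle M n r e)"
  shows "openin (mtop M) U"
  using assms
  by (elim image_bundle_trivsE) (auto intro!: smooth_fun_on_nonzero_open[OF M openin_topspace]
      smooth_fun_on_mat_det[OF M openin_topspace] smooth_intertwiner)

lemma smooth_local_lift:
  assumes W: "openin (mtop M) W" "W \<subseteq> {p \<in> points M. trivializes n r B K (e p)}"
    and w: "\<And>j. j < r \<Longrightarrow> smooth_fun_on M W (\<lambda>p. coord (w p) j)"
  shows "smooth_fun_on M W (\<lambda>p. coord (local_lift n r B K (e p) (w p)) i)"
  unfolding local_lift_def
proof (intro smooth_fun_on_mat_app[OF M W(1)] smooth_fun_on_mat_inv[OF M W(1)] smooth_fun_on_const w)
  show "smooth_fun_on M W (\<lambda>p. intertwiner n (mat_mult r B K) (e p) i j)" if "i < n" "j < n" for i j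
    by (rule smooth_fun_on_subset[OF smooth_intertwiner[OF that]]) (use W in auto)
qed (use W(2) in auto)

lemma image_bundle_bij:
  assumes "section_retraction n r B K" "p \<in> points M"
    "trivializes n r B K (e p)"
  shows "bij_betw (\<lambda>v. coord (mat_app r n K v)) {v. mat_app n n (e p) v = v} (topspace (Euclidean_space r))"
proof (rule bij_betwI[where g = "\<lambda>x. local_lift n r B K (e p) (fin_vec r x)"])
  note ll = local_lift[OF assms(1,3) idem[OF assms(2)]]
  show "(\<lambda>v. coord (mat_app r n K v)) \<in> {v. mat_app n n (e p) v = v} \<rightarrow> topspace (Euclidean_space r)"
    by (auto simp: topspace_Euclidean_space)
  show "(\<lambda>x. local_lift n r B K (e p) (fin_vec r x)) \<in> topspace (Euclidean_space r) \<rightarrow> {v. mat_app n n (e p) v = v}"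
    using ll(2) by auto
  show "local_lift n r B K (e p) (fin_vec r (coord (mat_app r n K v))) = v" if "v \<in> {v. mat_app n n (e p) v = v}" for v
    using ll(1) that by (simp add: fin_vec_coord del: coord_mat_app)
  show "coord (mat_app r n K (local_lift n r B K (e p) (fin_vec r y))) = y" if "y \<in> topspace (Euclidean_space r)" for y
    using ll(3) that by (auto simp: topspace_Euclidean_space fun_eq_iff simp del: coord_mat_app)
qed

lemma image_bundle_frame:
  assumes "section_retraction n r B K" "p \<in> points M"
    "trivializes n r B K (e p)" "j < r"
  shows "frame (image_bundle M n r e) (\<lambda>p v. coord (mat_app r n K v)) j p =
    local_lift n r B K (e p) (basis_vec j)"
proof -
  note ll = local_lift[OF assms(1,3) idem[OF assms(2)]]
  have "basis_vec j \<in> fin_space r" using assms(4) by (auto simp: fin_space_def lookup_single when_def)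
  note w = ll(2)[OF this] ll(3)[OF this]
  show ?thesis
    unfolding frame_def fibre_image_bundle
  proof (rule inv_into_f_eq)
    show "inj_on (\<lambda>v. coord (mat_app r n K v)) {v. mat_app n n (e p) v = v}"
      using image_bundle_bij[OF assms(1-3)] by (rule bij_betw_imp_inj_on)
    show "coord (mat_app r n K (local_lift n r B K (e p) (basis_vec j))) = (\<lambda>i. if i = j then 1 else 0)"
      unfolding w(2) by (auto simp: lookup_single when_def)
  qed (use w in simp)
qed

lemma image_bundle_frame_in:
  assumes "(U, t) \<in> trivs (image_bundle M n r e)" "j < r" "p \<in> U"
  shows "mat_app n n (e p) (frame (image_bundle M n r e) t j p) = frame (image_bundle M n r e) t j p"
  using assms(1)
proof (rule image_bundle_trivsE)
  fix B K assume *: "section_retraction n r B K" "t = (\<lambda>p v. coord (mat_app r n K v))"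
    "U = {p \<in> points M. trivializes n r B K (e p)}"
  then have p: "p \<in> points M" "trivializes n r B K (e p)" using assms(3) by auto
  show ?thesis
    unfolding *(2) image_bundle_frame[OF *(1) p assms(2)]
    by (rule local_lift_in[OF *(1) p(2) idem[OF p(1)]])
      (use assms(2) in \<open>auto simp: fin_space_def lookup_single when_def\<close>)
qed

lemma image_bundle_frame_smooth:
  assumes U: "(U, t) \<in> trivs (image_bundle M n r e)" and j: "j < r"
  shows "smooth_fun_on M U (\<lambda>p. coord (frame (image_bundle M n r e) t j p) i)"
  using U
proof (rule image_bundle_trivsE)
  fix B K assume *: "section_retraction n r B K" "t = (\<lambda>p v. coord (mat_app r n K v))"
    "U = {p \<in> points M. trivializes n r B K (e p)}"
  note op = image_bundle_domain_open[OF U]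
  have "smooth_fun_on M U (\<lambda>p. coord (local_lift n r B K (e p) (basis_vec j)) i)"
    by (rule smooth_local_lift[OF op]) (use * in \<open>auto intro: smooth_fun_on_const\<close>)
  then show ?thesis
    by (rule smooth_fun_on_cong[OF M op, rotated]) (use * j in \<open>auto simp: image_bundle_frame\<close>)
qed

text \<open>The factorization of \<open>e p\<close> itself trivializes at \<open>p\<close>, the
  intertwiner being the identity there. The constant trace ensures that its rank is the prescribed
  \<open>r\<close>.\<close>

lemma image_bundle_cover:
  assumes rk: "idempotent_rank M n e r" and p: "p \<in> points M"
  obtains B K where "section_retraction n r B K" "trivializes n r B K (e p)"
proof -
  obtain r' B K where *: "section_retraction n r' B K"
    "\<And>v. mat_app n n (mat_mult r' B K) v = mat_app n n (e p) v" "trace_upto n (e p) = real r'"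
    using smooth_idempotent_factorization[OF e p] by metis
  have "r' = r" using rk p *(3) by (simp add: idempotent_rank_def)
  then show thesis using that[of B K] *(1) mat_det_intertwiner_self[OF *(2) idem[OF p]] by simp
qed

text \<open>Reduces bundle smoothness to smoothness of components in the ambient space. One
  direction holds since \<open>K\<close> is constant; the other recovers \<open>s\<close> locally as
  the \<open>local_lift\<close> of its trivialized form, which depends smoothly on the
  point.\<close>

lemma smooth_section_on_image_bundle:
  assumes rk: "idempotent_rank M n e r" and W: "openin (mtop M) W"
  shows "smooth_section_on M (image_bundle M n r e) W s \<longleftrightarrow>
    (\<forall>p\<in>W. mat_app n n (e p) (s p) = s p) \<and> (\<forall>i. smooth_fun_on M W (\<lambda>p. coord (s p) i))"
proof (intro iffI conjI)
  let ?E = "image_bundle M n r e"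
  assume s: "smooth_section_on M (?E) W s"
  then show in_im: "\<forall>p\<in>W. mat_app n n (e p) (s p) = s p" by (simp add: smooth_section_on_def)
  show "\<forall>i. smooth_fun_on M W (\<lambda>p. coord (s p) i)"
  proof
    fix i
    show "smooth_fun_on M W (\<lambda>p. coord (s p) i)"
    proof (rule smooth_fun_on_local[OF M W])
      fix p assume p: "p \<in> W"
      then have pM: "p \<in> points M" using openin_subset[OF W] by blast
      obtain B K where BK: "section_retraction n r B K" "trivializes n r B K (e p)"
        using image_bundle_cover[OF rk pM] .
      define U where "U = {p \<in> points M. trivializes n r B K (e p)}"
      have U: "(U, \<lambda>p v. coord (mat_app r n K v)) \<in> trivs (?E)"
        unfolding image_bundle_def U_def using BK(1) by (auto intro!: image_eqI[of _ _ "(B, K)"])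
      have op: "openin (mtop M) (U \<inter> W)" using image_bundle_domain_open[OF U] W by (rule openin_Int)
      have "smooth_fun_on M (U \<inter> W) (\<lambda>p. coord (local_lift n r B K (e p) (mat_app r n K (s p))) i)"
      proof (rule smooth_local_lift[OF op])
        show "smooth_fun_on M (U \<inter> W) (\<lambda>p. coord (mat_app r n K (s p)) j)" if "j < r" for j
        proof -
          have "\<forall>(U, t)\<in>trivs (?E). \<forall>i<r. smooth_fun_on M (U \<inter> W) (\<lambda>p. t p (s p) i)"
            using s by (simp add: smooth_section_on_def)
          from bspec[OF this U] that show ?thesis by (simp del: coord_mat_app)
        qed
      qed (simp add: U_def Int_absorb2)
      then have "smooth_fun_on M (U \<inter> W) (\<lambda>p. coord (s p) i)"
        by (rule smooth_fun_on_cong[OF M op, rotated])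
          (use in_im in \<open>auto simp: U_def local_lift_retract[OF BK(1) _ idem]\<close>)
      then show "\<exists>W'. p \<in> W' \<and> openin (mtop M) W' \<and> smooth_fun_on M W' (\<lambda>p. coord (s p) i)"
        using op p pM BK(2) by (intro exI[of _ "U \<inter> W"]) (simp add: U_def)
    qed
  qed
next
  let ?E = "image_bundle M n r e"
  assume s: "(\<forall>p\<in>W. mat_app n n (e p) (s p) = s p) \<and> (\<forall>i. smooth_fun_on M W (\<lambda>p. coord (s p) i))"
  show "smooth_section_on M (?E) W s"
    unfolding smooth_section_on_def
  proof safe
    fix U t i assume U: "(U, t) \<in> trivs (?E)" and i: "i < rank (?E)"
    obtain K where t: "t = (\<lambda>p v. coord (mat_app r n K v))" using U by (rule image_bundle_trivsE)
    have op: "openin (mtop M) (U \<inter> W)" using image_bundle_domain_open[OF U] W by (rule openin_Int)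
    have "smooth_fun_on M (U \<inter> W) (\<lambda>p. coord (s p) j)" for j
      by (rule smooth_fun_on_subset[of M W]) (use s in auto)
    then show "smooth_fun_on M (U \<inter> W) (\<lambda>p. t p (s p) i)"
      unfolding t by (intro smooth_fun_on_mat_app[OF M op] smooth_fun_on_const)
  qed (use s in auto)
qed

lemma sections_image_bundle:
  assumes rk: "idempotent_rank M n e r"
  shows "s \<in> sections M (image_bundle M n r e) \<longleftrightarrow>
    (\<forall>p\<in>points M. mat_app n n (e p) (s p) = s p) \<and> (\<forall>i. (\<lambda>p. coord (s p) i) \<in> smooth_functions M)"
proof -
  have "(\<forall>p. p \<notin> points M \<longrightarrow> s p = 0) \<longleftrightarrow> (\<forall>i p. p \<notin> points M \<longrightarrow> coord (s p) i = 0)"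
    using fin_seq_eqI[of _ 0] by fastforce
  then show ?thesis
    unfolding sections_def smooth_section_on_image_bundle[OF rk openin_topspace] smooth_functions_def by auto
qed

lemma vector_bundle_image_bundle:
  assumes rk: "idempotent_rank M n e r"
  shows "vector_bundle M (image_bundle M n r e)"
  unfolding vector_bundle_def
proof (intro conjI)
  let ?E = "image_bundle M n r e"
  show "\<forall>p\<in>points M. subspace (fibre (?E) p)"
    by (auto simp: subspace_def mat_app_add mat_app_scaleR)
  show "(\<Union>(U, t)\<in>trivs (?E). U) = points M"
  proof
    show "points M \<subseteq> (\<Union>(U, t)\<in>trivs (?E). U)"
    proof
      fix p assume p: "p \<in> points M"
      obtain B K where "section_retraction n r B K" "trivializes n r B K (e p)"
        using image_bundle_cover[OF rk p] .
      then show "p \<in> (\<Union>(U, t)\<in>trivs (?E). U)"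
        using p by (auto simp: image_bundle_def)
    qed
  qed (auto simp: image_bundle_def)
  show "\<forall>(U, t)\<in>trivs (?E). openin (mtop M) U \<and>
      (\<forall>p\<in>U. bij_betw (t p) (fibre (?E) p) (topspace (Euclidean_space (rank (?E)))) \<and>
        (\<forall>v\<in>fibre (?E) p. \<forall>w\<in>fibre (?E) p. \<forall>a b i.
           t p (a *\<^sub>R v + b *\<^sub>R w) i = a * t p v i + b * t p w i))"
  proof (safe intro!: image_bundle_domain_open)
    fix U t p assume U: "(U, t) \<in> trivs (?E)" and p: "p \<in> U"
    from U obtain B K where *: "section_retraction n r B K" "t = (\<lambda>p v. coord (mat_app r n K v))"
      "U = {p \<in> points M. trivializes n r B K (e p)}"
      by (rule image_bundle_trivsE)
    show "bij_betw (t p) (fibre (?E) p) (topspace (Euclidean_space (rank (?E))))"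
      unfolding *(2) fibre_image_bundle rank_image_bundle
      by (rule image_bundle_bij[OF *(1)]) (use p *(3) in auto)
    show "t p (a *\<^sub>R v + b *\<^sub>R w) i = a * t p v i + b * t p w i" for v w a b i
      unfolding *(2) by (simp only: mat_app_add mat_app_scaleR lookup_add coord_scaleR)
  qed
  show "\<forall>(U, t)\<in>trivs (?E). \<forall>(U', t')\<in>trivs (?E).
      \<forall>j<rank (?E). \<forall>i<rank (?E).
      smooth_fun_on M (U \<inter> U') (\<lambda>p. t' p (frame (?E) t j p) i)"
  proof safe
    fix U t U' t' i j assume U: "(U, t) \<in> trivs (?E)"
      and U': "(U', t') \<in> trivs (?E)"
      and ij: "j < rank (?E)" "i < rank (?E)"
    obtain K where t': "t' = (\<lambda>p v. coord (mat_app r n K v))" using U' by (rule image_bundle_trivsE)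
    have op: "openin (mtop M) (U \<inter> U')"
      using image_bundle_domain_open[OF U] image_bundle_domain_open[OF U'] by (rule openin_Int)
    have "smooth_fun_on M (U \<inter> U') (\<lambda>p. coord (frame (?E) t j p) l)" for l
      by (rule smooth_fun_on_subset[OF image_bundle_frame_smooth[OF U]]) (use ij in auto)
    then show "smooth_fun_on M (U \<inter> U') (\<lambda>p. t' p (frame (?E) t j p) i)"
      unfolding t' by (intro smooth_fun_on_mat_app[OF M op] smooth_fun_on_const)
  qed
qed

end

text \<open>Smoothness of the inclusion is automatic: the frames of the smaller bundle have smooth
  ambient components, and that is the criterion for smooth sections of the larger one.\<close>

lemma subbundle_image_bundle:
  assumes M: "smooth_manifold M" and e: "smooth_idempotent M n e" "idempotent_rank M n e r"
    and f: "smooth_idempotent M n f" "idempotent_rank M n f r'"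
    and sub: "\<And>p v. p \<in> points M \<Longrightarrow> mat_app n n (f p) v = v \<Longrightarrow> mat_app n n (e p) v = v"
  shows "subbundle M (image_bundle M n r' f) (image_bundle M n r e)"
  unfolding subbundle_def
proof (intro conjI)
  show "vector_bundle M (image_bundle M n r' f)" by (rule vector_bundle_image_bundle[OF M f])
  show "\<forall>p\<in>points M. fibre (image_bundle M n r' f) p \<subseteq> fibre (image_bundle M n r e) p" using sub by auto
  show "\<forall>(U, t)\<in>trivs (image_bundle M n r' f). \<forall>j<rank (image_bundle M n r' f).
      smooth_section_on M (image_bundle M n r e) U (frame (image_bundle M n r' f) t j)"
  proof safe
    fix U t j assume U: "(U, t) \<in> trivs (image_bundle M n r' f)" and j: "j < rank (image_bundle M n r' f)"
    have op: "openin (mtop M) U" by (rule image_bundle_domain_open[OF M f(1) U])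
    show "smooth_section_on M (image_bundle M n r e) U (frame (image_bundle M n r' f) t j)"
      unfolding smooth_section_on_image_bundle[OF M e op]
      using image_bundle_frame_smooth[OF M f(1) U] image_bundle_frame_in[OF M f(1) U] j sub openin_subset[OF op]
      by auto
  qed
qed

section \<open>The projected connection and its parallel transport\<close>

definition deriv_coords :: "nat \<Rightarrow> (('c \<Rightarrow> real) \<Rightarrow> real) \<Rightarrow> ('c \<Rightarrow> fin_seq) \<Rightarrow> fin_seq" where
  "deriv_coords n v s = fin_vec n (\<lambda>j. v (\<lambda>q. coord (s q) j))"

text \<open>The Grassmann connection: the trivial connection of the ambient space followed by
  projection to the fibre.\<close>

definition image_connection :: "nat \<Rightarrow> ('c \<Rightarrow> nat \<Rightarrow> nat \<Rightarrow> real) \<Rightarrow> ('c, fin_seq) connection" where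
  "image_connection n e p v s = mat_app n n (e p) (deriv_coords n v s)"

lemma deriv_coords_add:
  assumes "v \<in> tangent_space C p" "\<And>i. (\<lambda>p. coord (s p) i) \<in> smooth_functions C"
    "\<And>i. (\<lambda>p. coord (s' p) i) \<in> smooth_functions C"
  shows "deriv_coords n v (\<lambda>q. s q + s' q) = deriv_coords n v s + deriv_coords n v s'"
  by (rule fin_seq_eqI) (simp add: deriv_coords_def lookup_add tangent_space_add[OF assms(1,2,3)])

lemma deriv_coords_scale:
  assumes "v \<in> tangent_space C p" "\<And>i. (\<lambda>p. coord (s p) i) \<in> smooth_functions C"
  shows "deriv_coords n v (\<lambda>q. a *\<^sub>R s q) = a *\<^sub>R deriv_coords n v s"
  by (rule fin_seq_eqI) (simp add: deriv_coords_def tangent_space_scale[OF assms])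

context
  fixes C :: "'c manifold" and n r :: nat and e :: "'c \<Rightarrow> nat \<Rightarrow> nat \<Rightarrow> real"
  assumes C: "smooth_manifold C" and e: "smooth_idempotent C n e" and rk: "idempotent_rank C n e r"
begin

lemma covariant_derivative_image_connection:
  "covariant_derivative C (image_bundle C n r e) (image_connection n e)"
  unfolding covariant_derivative_def
proof (intro conjI ballI allI)
  let ?E = "image_bundle C n r e"
  note sec = sections_image_bundle[OF C e rk]
  fix p v s assume p: "p \<in> points C" and v: "v \<in> tangent_space C p" and s: "s \<in> sections C (?E)"
  have sm: "\<And>i. (\<lambda>p. coord (s p) i) \<in> smooth_functions C" using s sec by blast
  show "image_connection n e p v s \<in> fibre (?E) p"
    using idem[OF C e p] by (simp add: image_connection_def)
  show "image_connection n e p (\<lambda>f. a * v f + b * w f) s =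
      a *\<^sub>R image_connection n e p v s + b *\<^sub>R image_connection n e p w s" for w a b
  proof -
    have "deriv_coords n (\<lambda>f. a * v f + b * w f) s = a *\<^sub>R deriv_coords n v s + b *\<^sub>R deriv_coords n w s"
      by (rule fin_seq_eqI) (simp add: deriv_coords_def lookup_add)
    then show ?thesis by (simp add: image_connection_def mat_app_add mat_app_scaleR)
  qed
  show "image_connection n e p v (\<lambda>q. a *\<^sub>R s q + b *\<^sub>R s' q) =
      a *\<^sub>R image_connection n e p v s + b *\<^sub>R image_connection n e p v s'"
    if s': "s' \<in> sections C (?E)" for s' a b
  proof -
    have sm': "\<And>i. (\<lambda>p. coord (s' p) i) \<in> smooth_functions C" using s' sec by blast
    have "deriv_coords n v (\<lambda>q. a *\<^sub>R s q + b *\<^sub>R s' q) =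
        deriv_coords n v (\<lambda>q. a *\<^sub>R s q) + deriv_coords n v (\<lambda>q. b *\<^sub>R s' q)"
      by (rule deriv_coords_add[OF v]) (auto intro: smooth_functions_scale[OF C] sm sm')
    then show ?thesis
      by (simp add: image_connection_def mat_app_add mat_app_scaleR deriv_coords_scale[OF v sm] deriv_coords_scale[OF v sm'])
  qed
  show "image_connection n e p v (\<lambda>q. f q *\<^sub>R s q) = v f *\<^sub>R s p + f p *\<^sub>R image_connection n e p v s"
    if f: "f \<in> smooth_functions C" for f
  proof -
    have es: "mat_app n n (e p) (s p) = s p" using s sec p by blast
    have sp: "s p \<in> fin_space n" using mat_app_in[of n n "e p" "s p"] es by simp
    \<comment> \<open>As \<open>deriv_coords\<close> cuts off at \<open>n\<close>, the term
      \<open>v f *\<^sub>R s p\<close> comes out right only because \<open>s p\<close> lies in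
      \<open>fin_space n\<close>.\<close>
    have "deriv_coords n v (\<lambda>q. f q *\<^sub>R s q) = v f *\<^sub>R s p + f p *\<^sub>R deriv_coords n v s"
      by (rule fin_seq_eqI)
        (use sp in \<open>auto simp: deriv_coords_def lookup_add tangent_space_mult[OF v f sm] fin_space_def not_less\<close>)
    then show ?thesis by (simp add: image_connection_def mat_app_add mat_app_scaleR es)
  qed
next
  let ?E = "image_bundle C n r e"
  note sec = sections_image_bundle[OF C e rk]
  fix Y s assume Y: "Y \<in> vector_fields C" and s: "s \<in> sections C (?E)"
  show "(\<lambda>p. if p \<in> points C then image_connection n e p (Y p) s else 0) \<in> sections C (?E)"
    unfolding sec
  proof (intro conjI ballI allI)
    fix p assume "p \<in> points C"
    then show "mat_app n n (e p) (if p \<in> points C then image_connection n e p (Y p) s else 0) =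
        (if p \<in> points C then image_connection n e p (Y p) s else 0)"
      using idem[OF C e] by (simp add: image_connection_def)
  next
    fix i
    have d: "smooth_fun_on C (points C) (\<lambda>p. coord (deriv_coords n (Y p) s) j)" for j
    proof (cases "j < n")
      case True
      have "(\<lambda>p. coord (s p) j) \<in> smooth_functions C" using s sec by blast
      then have "(\<lambda>p. if p \<in> points C then Y p (\<lambda>p. coord (s p) j) else 0) \<in> smooth_functions C"
        using Y unfolding vector_fields_def by blast
      then have "smooth_fun_on C (points C) (\<lambda>p. if p \<in> points C then Y p (\<lambda>p. coord (s p) j) else 0)"
        by (simp add: smooth_functions_def)
      then show ?thesis
        by (rule smooth_fun_on_cong[OF C openin_topspace, rotated]) (use True in \<open>simp add: deriv_coords_def\<close>)
    qed (simp add: deriv_coords_def smooth_fun_on_const)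
    have "smooth_fun_on C (points C) (\<lambda>p. coord (image_connection n e p (Y p) s) i)"
      unfolding image_connection_def
      by (intro smooth_fun_on_mat_app[OF C openin_topspace] smooth_entries[OF C e] d)
    from smooth_fun_on_restrict[OF C this]
    show "(\<lambda>p. coord (if p \<in> points C then image_connection n e p (Y p) s else 0) i) \<in> smooth_functions C"
      by (simp add: if_distrib[of "\<lambda>v. coord v i"] cong: if_cong)
  qed
qed

lemma D_connection_image_connection:
  "D_connection C D (image_bundle C n r e) (image_connection n e)"
  unfolding D_connection_def using covariant_derivative_image_connection by blast

context
  fixes D :: "'c \<Rightarrow> 'c tangent_vector set"
  assumes dist: "smooth_distribution C D" and int: "integrable_distribution C D"
    and lc: "leafwise_constant_matrix C D n e"
begin

lemma deriv_coords_in_image: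
  assumes p: "p \<in> points C" and v: "v \<in> D p" and s: "s \<in> sections C (image_bundle C n r e)"
  shows "mat_app n n (e p) (deriv_coords n v s) = deriv_coords n v s"
proof (rule fin_seq_eqI)
  fix i
  have vT: "v \<in> tangent_space C p" using dist p v unfolding smooth_distribution_def by blast
  have s': "\<And>p. p \<in> points C \<Longrightarrow> mat_app n n (e p) (s p) = s p" "\<And>i. (\<lambda>p. coord (s p) i) \<in> smooth_functions C"
    using s sections_image_bundle[OF C e rk] by blast+
  \<comment> \<open>The entries of \<open>e\<close>, cut off outside \<open>C\<close>: tangent
    vectors are zero by convention on anything outside \<open>smooth_functions C\<close>.\<close>
  define E where "E i j = (\<lambda>q. if q \<in> points C then e q i j else 0)" for i j
  have E: "E i j \<in> smooth_functions C" "v (E i j) = 0" if ij: "i < n" "j < n" for i j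
  proof -
    show Esm: "E i j \<in> smooth_functions C"
      unfolding E_def by (rule smooth_fun_on_restrict[OF C smooth_entries[OF C e ij]])
    show "v (E i j) = 0"
    proof (rule leafwise_constant_derivative[OF C int Esm _ p v])
      show "leafwise_constant C D (E i j)"
        unfolding leafwise_constant_def
      proof (intro ballI)
        fix S x y assume S: "S \<in> leaves C D" "x \<in> S" "y \<in> S"
        then have "e x i j = e y i j"
          using lc ij unfolding leafwise_constant_matrix_def leafwise_constant_def by blast
        then show "E i j x = E i j y" using leaves_subset[OF S(1)] S(2,3) by (auto simp: E_def)
      qed
    qed
  qed
  show "coord (mat_app n n (e p) (deriv_coords n v s)) i = coord (deriv_coords n v s) i"
  proof (cases "i < n")
    case True
    have "coord (s q) i = (\<Sum>j<n. E i j q * coord (s q) j)" for q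
    proof (cases "q \<in> points C")
      case q: True
      have "coord (mat_app n n (e q) (s q)) i = (\<Sum>j<n. E i j q * coord (s q) j)"
        using True q by (simp add: E_def)
      then show ?thesis unfolding s'(1)[OF q] .
    next
      case False
      then show ?thesis using s'(2)[of i] by (simp add: E_def smooth_functions_def)
    qed
    then have "v (\<lambda>q. coord (s q) i) = v (\<lambda>q. \<Sum>j<n. E i j q * coord (s q) j)" by (intro arg_cong[of _ _ v]) auto
    also have "\<dots> = (\<Sum>j<n. v (\<lambda>q. E i j q * coord (s q) j))"
      by (rule tangent_space_sum[OF C vT]) (use True in \<open>auto intro!: smooth_functions_mult[OF C] E s'(2)\<close>)
    also have "\<dots> = (\<Sum>j<n. e p i j * v (\<lambda>q. coord (s q) j))"
    proof (rule sum.cong)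
      fix j assume "j \<in> {..<n}"
      then have j: "j < n" by simp
      have "E i j p = e p i j" using p by (simp add: E_def)
      then show "v (\<lambda>q. E i j q * coord (s q) j) = e p i j * v (\<lambda>q. coord (s q) j)"
        using tangent_space_mult[OF vT E(1)[OF True j] s'(2)[of j]] E(2)[OF True j] by simp
    qed simp
    finally show ?thesis using True by (simp add: deriv_coords_def)
  qed (simp add: deriv_coords_def)
qed

lemma image_connection_eq:
  assumes p: "p \<in> points C" and v: "v \<in> D p" and s: "s \<in> sections C (image_bundle C n r e)"
  shows "image_connection n e p v s = deriv_coords n v s"
  unfolding image_connection_def by (rule deriv_coords_in_image[OF assms])

lemma invariant_iff_leafwise_constant:
  assumes s: "s \<in> sections C (image_bundle C n r e)"
  shows "(\<forall>Y\<in>dist_sections C D. \<forall>p\<in>points C. image_connection n e p (Y p) s = 0) \<longleftrightarrow>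
    (\<forall>i. leafwise_constant C D (\<lambda>p. coord (s p) i))"
proof -
  have s': "\<And>p. p \<in> points C \<Longrightarrow> mat_app n n (e p) (s p) = s p" "\<And>i. (\<lambda>p. coord (s p) i) \<in> smooth_functions C"
    using s sections_image_bundle[OF C e rk] by blast+
  show ?thesis
  proof (intro iffI allI ballI)
    fix i assume inv: "\<forall>Y\<in>dist_sections C D. \<forall>p\<in>points C. image_connection n e p (Y p) s = 0"
    show "leafwise_constant C D (\<lambda>p. coord (s p) i)"
    proof (cases "i < n")
      case True
      show ?thesis
      proof (rule leafwise_constantI[OF C dist s'(2)])
        fix Y p assume Y: "Y \<in> dist_sections C D" and p: "p \<in> points C"
        then have "deriv_coords n (Y p) s = 0"
          using inv image_connection_eq[OF p _ s, of "Y p"] by (auto simp: dist_sections_def)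
        then have "coord (deriv_coords n (Y p) s) i = 0" by simp
        then show "Y p (\<lambda>p. coord (s p) i) = 0" using True by (simp add: deriv_coords_def)
      qed
    next
      case False
      have "coord (s p) i = 0" if "p \<in> points C" for p
      proof -
        have "s p \<in> fin_space n" using mat_app_in[of n n "e p" "s p"] s'(1)[OF that] by simp
        then show ?thesis using False by (simp add: fin_space_def)
      qed
      then show ?thesis using leaves_subset unfolding leafwise_constant_def by (metis subsetD)
    qed
  next
    fix Y p assume lcs: "\<forall>i. leafwise_constant C D (\<lambda>p. coord (s p) i)"
      and Y: "Y \<in> dist_sections C D" and p: "p \<in> points C"
    have "Y p (\<lambda>q. coord (s q) i) = 0" for i
      by (rule leafwise_constant_derivative[OF C int s'(2) _ p]) (use lcs Y p in \<open>auto simp: dist_sections_def\<close>)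
    then have "deriv_coords n (Y p) s = 0" by (intro fin_seq_eqI) (simp add: deriv_coords_def)
    then show "image_connection n e p (Y p) s = 0" by (simp add: image_connection_def)
  qed
qed

text \<open>Parallel transport is the identity on components, whatever the curve in the leaf. The
  computation is made along the curve, where the entries of \<open>e\<close> do not depend on time;
  \<open>deriv_coords_in_image\<close> would ask for the velocity to lie in
  \<open>D\<close>.\<close>

lemma parallel_transport_image_connection:
  assumes L: "maximal_integral_manifold C D L" and \<gamma>: "curve_in L \<gamma>"
    and pt: "parallel_transport C (image_bundle C n r e) (image_connection n e) \<gamma> v w"
  shows "v = w"
proof -
  let ?E = "image_bundle C n r e"
  have Lm: "smooth_manifold L" and inc: "smooth_map_on L (points L) C (\<lambda>p. p)" and LC: "points L \<subseteq> points C"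
    using L unfolding maximal_integral_manifold_def integral_manifold_def injective_immersion_def by auto
  have leaf: "points L \<in> leaves C D" using L unfolding leaves_def by blast
  obtain I where I: "open I" "{0..1} \<subseteq> I" "smooth_map_on real_line I L \<gamma>"
    using \<gamma> unfolding curve_in_def by blast
  have \<gamma>L: "\<gamma> u \<in> points L" if "u \<in> I" for u
    by (rule smooth_map_on_points[OF I(3) _ that]) (use I(1) in \<open>simp add: real_line_def\<close>)
  have dcurve: "((\<lambda>u. f (\<gamma> u)) has_real_derivative deriv (\<lambda>u. f (\<gamma> u)) t) (at t)"
    if "f \<in> smooth_functions C" "t \<in> I" for f t
    by (rule curve_derivative[OF C Lm inc I(1,3) that])
  obtain s where s: "\<And>t. t \<in> {0..1} \<Longrightarrow> covariant_derivative_along C (?E) (image_connection n e) \<gamma> s t 0"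
    "s 0 = v" "s 1 = w"
    using pt unfolding parallel_transport_def by blast
  have *: "((\<lambda>u. coord (s u) j) has_real_derivative 0) (at t)" if j: "j < n" and t: "t \<in> {0..1}" for j t
  proof -
    have tI: "t \<in> I" using t I(2) by blast
    obtain J m \<sigma> a where J: "open J" "t \<in> J"
      and \<sigma>: "\<And>i. i < (m::nat) \<Longrightarrow> \<sigma> i \<in> sections C (?E)"
      and a: "\<And>i. i < m \<Longrightarrow> smooth_fun_on real_line J (a i)"
      and su: "\<And>u. u \<in> J \<Longrightarrow> s u = (\<Sum>i<m. a i u *\<^sub>R \<sigma> i (\<gamma> u))"
      and zero: "0 = (\<Sum>i<m. deriv (a i) t *\<^sub>R \<sigma> i (\<gamma> t) +
          a i t *\<^sub>R image_connection n e (\<gamma> t) (velocity C \<gamma> t) (\<sigma> i))"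
      using s(1)[OF t] unfolding covariant_derivative_along_def by blast
    have \<sigma>sm: "(\<lambda>p. coord (\<sigma> i p) k) \<in> smooth_functions C" if "i < m" for i k
      using \<sigma>[OF that] sections_image_bundle[OF C e rk] by blast
    have \<sigma>im: "mat_app n n (e p) (\<sigma> i p) = \<sigma> i p" if "i < m" "p \<in> points C" for i p
      using \<sigma>[OF that(1)] sections_image_bundle[OF C e rk] that(2) by blast
    let ?d = "\<lambda>i k. deriv (\<lambda>u. coord (\<sigma> i (\<gamma> u)) k) t"
    \<comment> \<open>Differentiating the fixed-point equation of \<open>\<sigma> i\<close> along
      the curve, with \<open>e\<close> frozen at time \<open>t\<close>, shows that the projection
      leaves the componentwise derivative unchanged.\<close>
    have nab: "coord (image_connection n e (\<gamma> t) (velocity C \<gamma> t) (\<sigma> i)) j = ?d i j" if i: "i < m" for i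
    proof -
      have d: "((\<lambda>u. \<Sum>k<n. e (\<gamma> t) j k * coord (\<sigma> i (\<gamma> u)) k) has_real_derivative
          (\<Sum>k<n. e (\<gamma> t) j k * ?d i k)) (at t)"
        by (intro DERIV_sum DERIV_cmult dcurve[OF \<sigma>sm[OF i] tI])
      have ev: "\<forall>\<^sub>F u in nhds t. (\<Sum>k<n. e (\<gamma> t) j k * coord (\<sigma> i (\<gamma> u)) k) = coord (\<sigma> i (\<gamma> u)) j"
        using eventually_nhds_in_open[OF I(1) tI]
      proof eventually_elim
        case (elim u)
        have "e (\<gamma> t) j k = e (\<gamma> u) j k" if "k < n" for k
          using lc j that leaf \<gamma>L[OF elim] \<gamma>L[OF tI] unfolding leafwise_constant_matrix_def leafwise_constant_def by blast
        then have "(\<Sum>k<n. e (\<gamma> t) j k * coord (\<sigma> i (\<gamma> u)) k) = coord (mat_app n n (e (\<gamma> u)) (\<sigma> i (\<gamma> u))) j"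
          using j by simp
        also have "mat_app n n (e (\<gamma> u)) (\<sigma> i (\<gamma> u)) = \<sigma> i (\<gamma> u)"
          by (rule \<sigma>im[OF i]) (use \<gamma>L[OF elim] LC in blast)
        finally show ?case .
      qed
      have "((\<lambda>u. coord (\<sigma> i (\<gamma> u)) j) has_real_derivative (\<Sum>k<n. e (\<gamma> t) j k * ?d i k)) (at t)"
        by (rule iffD1[OF DERIV_cong_ev[OF refl ev refl] d])
      then have "?d i j = (\<Sum>k<n. e (\<gamma> t) j k * ?d i k)" by (rule DERIV_imp_deriv)
      then show ?thesis
        using j \<sigma>sm[OF i] by (simp add: image_connection_def deriv_coords_def velocity_def)
    qed
    have d: "((\<lambda>u. \<Sum>i<m. a i u * coord (\<sigma> i (\<gamma> u)) j) has_real_derivative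
        (\<Sum>i<m. deriv (a i) t * coord (\<sigma> i (\<gamma> t)) j + ?d i j * a i t)) (at t)"
      by (intro DERIV_sum DERIV_mult smooth_fun_on_real_line[OF J(1) a J(2)] dcurve[OF \<sigma>sm tI]) auto
    \<comment> \<open>The left side is the derivative of the \<open>j\<close>-th component of
      \<open>s\<close>, the right side that component of its covariant derivative, which is
      zero.\<close>
    have z: "(\<Sum>i<m. deriv (a i) t * coord (\<sigma> i (\<gamma> t)) j + ?d i j * a i t) = coord (0::fin_seq) j"
      by (subst zero) (simp add: lookup_sum lookup_add nab mult.commute)
    have ev: "\<forall>\<^sub>F u in nhds t. (\<Sum>i<m. a i u * coord (\<sigma> i (\<gamma> u)) j) = coord (s u) j"
      using eventually_nhds_in_open[OF J] by eventually_elim (simp add: su lookup_sum)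
    from iffD1[OF DERIV_cong_ev[OF refl ev refl] d] show ?thesis unfolding z by simp
  qed
  show "v = w"
  proof (rule fin_seq_eqI)
    fix j
    show "coord v j = coord w j"
    proof (cases "j < n")
      case True
      have "coord (s 1) j = coord (s 0) j"
        by (intro DERIV_isconst_end[of 0 1 "\<lambda>u. coord (s u) j"] continuous_at_imp_continuous_on)
          (auto intro!: *[OF True] DERIV_isCont[OF *[OF True]])
      then show ?thesis using s by simp
    next
      case False
      \<comment> \<open>The connection does not see components from \<open>n\<close> on; these
        vanish because \<open>s t\<close> is a combination of vectors of a fibre.\<close>
      have "coord (s t) j = 0" if t: "t \<in> {0..1}" for t
      proof -
        obtain J m \<sigma> a where J: "t \<in> J"
          and \<sigma>: "\<And>i. i < (m::nat) \<Longrightarrow> \<sigma> i \<in> sections C (?E)"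
          and su: "\<And>u. u \<in> J \<Longrightarrow> s u = (\<Sum>i<m. a i u *\<^sub>R \<sigma> i (\<gamma> u))"
          using s(1)[OF t] unfolding covariant_derivative_along_def by blast
        have "coord (\<sigma> i (\<gamma> t)) j = 0" if "i < m" for i
        proof -
          have "mat_app n n (e (\<gamma> t)) (\<sigma> i (\<gamma> t)) = \<sigma> i (\<gamma> t)"
            using \<sigma>[OF that] sections_image_bundle[OF C e rk] \<gamma>L t I(2) LC by blast
          then have "\<sigma> i (\<gamma> t) \<in> fin_space n" using mat_app_in by metis
          then show ?thesis using False by (simp add: fin_space_def)
        qed
        then show ?thesis by (simp add: su[OF J] lookup_sum)
      qed
      then show ?thesis using s(2,3) by force
    qed
  qed
qed

lemma holonomy_free_image_connection:
  "holonomy_free C D (image_bundle C n r e) (image_connection n e)"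
  unfolding holonomy_free_def using parallel_transport_image_connection by metis

end

end

section \<open>Free modules over algebras of functions\<close>

lemma module_mapsD:
  assumes "h \<in> module_maps R U V"
  shows module_maps_closed: "x \<in> carrier U \<Longrightarrow> h x \<in> carrier V"
    and module_maps_add: "x \<in> carrier U \<Longrightarrow> y \<in> carrier U \<Longrightarrow> h (x \<oplus>\<^bsub>U\<^esub> y) = h x \<oplus>\<^bsub>V\<^esub> h y"
    and module_maps_smult: "a \<in> carrier R \<Longrightarrow> x \<in> carrier U \<Longrightarrow> h (a \<odot>\<^bsub>U\<^esub> x) = a \<odot>\<^bsub>V\<^esub> h x"
  using assms by (auto simp: module_maps_def)

lemma module_maps_comp:
  "g \<in> module_maps R U V \<Longrightarrow> h \<in> module_maps R V W \<Longrightarrow> (\<lambda>x. h (g x)) \<in> module_maps R U W"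
  by (auto simp: module_maps_def Pi_iff)

lemma module_maps_fst: "fst \<in> module_maps R (module_sum U V) U"
  by (auto simp: module_maps_def module_sum_def)

lemma right_module_smult_zero:
  assumes "right_module R V" "a \<in> carrier R"
  shows "a \<odot>\<^bsub>V\<^esub> \<zero>\<^bsub>V\<^esub> = \<zero>\<^bsub>V\<^esub>"
proof -
  interpret right_module R V by fact
  have "a \<odot>\<^bsub>V\<^esub> (\<zero>\<^bsub>V\<^esub> \<oplus>\<^bsub>V\<^esub> \<zero>\<^bsub>V\<^esub>) = a \<odot>\<^bsub>V\<^esub> \<zero>\<^bsub>V\<^esub> \<oplus>\<^bsub>V\<^esub> a \<odot>\<^bsub>V\<^esub> \<zero>\<^bsub>V\<^esub>"
    using assms(2) by (intro rsmult_add) auto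
  then show ?thesis
    using rsmult_closed[OF assms(2) M.zero_closed] by simp
qed

lemma module_maps_inl:
  assumes "right_module R V"
  shows "(\<lambda>x. (x, \<zero>\<^bsub>V\<^esub>)) \<in> module_maps R U (module_sum U V)"
proof -
  interpret right_module R V by fact
  show ?thesis
    using right_module_smult_zero[OF assms] by (auto simp: module_maps_def module_sum_def)
qed

text \<open>\<open>\<phi>\<close> is the isomorphism followed by the first projection,
  \<open>\<psi>\<close> the inclusion of the first summand followed by the inverse. That the
  inclusion is a morphism amounts to zero lying in \<open>mod_0 E\<close> and being preserved by
  \<open>mod_map E\<close>.\<close>

lemma coisotropic_summand_retract:
  assumes E: "coisotropic_module A E" and iso: "coiso_isomorphic A F (coiso_sum P E)"
  obtains \<phi> \<psi> where "coiso_morphism A F P \<phi>" "coiso_morphism A P F \<psi>"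
    "\<And>y. y \<in> carrier (mod_tot P) \<Longrightarrow> fst \<phi> (fst \<psi> y) = y"
    "\<And>y. y \<in> carrier (mod_N P) \<Longrightarrow> snd \<phi> (snd \<psi> y) = y"
proof -
  obtain \<Phi> \<Psi> where \<Phi>: "coiso_morphism A F (coiso_sum P E) \<Phi>" and \<Psi>: "coiso_morphism A (coiso_sum P E) F \<Psi>"
    and inv: "\<And>y. y \<in> carrier (mod_tot (coiso_sum P E)) \<Longrightarrow> fst \<Phi> (fst \<Psi> y) = y"
      "\<And>y. y \<in> carrier (mod_N (coiso_sum P E)) \<Longrightarrow> snd \<Phi> (snd \<Psi> y) = y"
    using iso unfolding coiso_isomorphic_def by blast
  have Et: "right_module (alg_tot A) (mod_tot E)" and EN: "right_module (alg_N A) (mod_N E)"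
    and E0: "submodule (mod_0 E) (alg_N A) (mod_N E)"
    and Emap: "mod_map E \<in> carrier (mod_N E) \<rightarrow> carrier (mod_tot E)"
    and Eadd: "\<And>x y. x \<in> carrier (mod_N E) \<Longrightarrow> y \<in> carrier (mod_N E) \<Longrightarrow>
        mod_map E (x \<oplus>\<^bsub>mod_N E\<^esub> y) = mod_map E x \<oplus>\<^bsub>mod_tot E\<^esub> mod_map E y"
    using E unfolding coisotropic_module_def by auto
  interpret t: right_module "alg_tot A" "mod_tot E" by fact
  interpret N: right_module "alg_N A" "mod_N E" by fact
  have zN: "\<zero>\<^bsub>mod_N E\<^esub> \<in> carrier (mod_N E)" "\<zero>\<^bsub>mod_tot E\<^esub> \<in> carrier (mod_tot E)" by auto
  have z0: "\<zero>\<^bsub>mod_N E\<^esub> \<in> mod_0 E"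
    using subgroup.one_closed[OF submodule.axioms(1)[OF E0]] by simp
  have zmap: "mod_map E \<zero>\<^bsub>mod_N E\<^esub> = \<zero>\<^bsub>mod_tot E\<^esub>"
    using Eadd[OF zN(1) zN(1)] funcset_mem[OF Emap zN(1)] by simp
  have sumsel: "mod_tot (coiso_sum P E) = module_sum (mod_tot P) (mod_tot E)"
    "mod_N (coiso_sum P E) = module_sum (mod_N P) (mod_N E)" "mod_0 (coiso_sum P E) = mod_0 P \<times> mod_0 E"
    "mod_map (coiso_sum P E) = map_prod (mod_map P) (mod_map E)"
    by (simp_all add: coiso_sum_def)
  have sumcar: "carrier (module_sum U V) = carrier U \<times> carrier V" for U :: "('x, 'y) module" and V :: "('x, 'z) module"
    by (simp add: module_sum_def)
  define \<phi> where "\<phi> = (\<lambda>x. fst (fst \<Phi> x), \<lambda>x. fst (snd \<Phi> x))"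
  define \<psi> where "\<psi> = (\<lambda>y. fst \<Psi> (y, \<zero>\<^bsub>mod_tot E\<^esub>), \<lambda>y. snd \<Psi> (y, \<zero>\<^bsub>mod_N E\<^esub>))"
  show thesis
  proof (rule that[of \<phi> \<psi>])
    show "coiso_morphism A F P \<phi>"
      unfolding coiso_morphism_def
    proof (intro conjI ballI)
      show "fst \<phi> \<in> module_maps (alg_tot A) (mod_tot F) (mod_tot P)"
        using \<Phi> module_maps_comp[OF _ module_maps_fst] unfolding coiso_morphism_def sumsel \<phi>_def by force
      show "snd \<phi> \<in> module_maps (alg_N A) (mod_N F) (mod_N P)"
        using \<Phi> module_maps_comp[OF _ module_maps_fst] unfolding coiso_morphism_def sumsel \<phi>_def by force
      fix x assume "x \<in> carrier (mod_N F)"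
      then have "fst \<Phi> (mod_map F x) = map_prod (mod_map P) (mod_map E) (snd \<Phi> x)"
        using \<Phi> unfolding coiso_morphism_def sumsel by blast
      then show "fst \<phi> (mod_map F x) = mod_map P (snd \<phi> x)" by (simp add: \<phi>_def)
    next
      show "snd \<phi> ` mod_0 F \<subseteq> mod_0 P"
        using \<Phi> unfolding coiso_morphism_def sumsel \<phi>_def by force
    qed
    show "coiso_morphism A P F \<psi>"
      unfolding coiso_morphism_def
    proof (intro conjI ballI)
      show "fst \<psi> \<in> module_maps (alg_tot A) (mod_tot P) (mod_tot F)"
        using \<Psi> module_maps_comp[OF module_maps_inl[OF Et]] unfolding coiso_morphism_def sumsel \<psi>_def by force
      show "snd \<psi> \<in> module_maps (alg_N A) (mod_N P) (mod_N F)"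
        using \<Psi> module_maps_comp[OF module_maps_inl[OF EN]] unfolding coiso_morphism_def sumsel \<psi>_def by force
      fix x assume x: "x \<in> carrier (mod_N P)"
      have "fst \<Psi> (mod_map (coiso_sum P E) (x, \<zero>\<^bsub>mod_N E\<^esub>)) = mod_map F (snd \<Psi> (x, \<zero>\<^bsub>mod_N E\<^esub>))"
        using \<Psi> x zN unfolding coiso_morphism_def by (auto simp: sumsel sumcar)
      then show "fst \<psi> (mod_map P x) = mod_map F (snd \<psi> x)"
        by (simp add: sumsel \<psi>_def zmap)
    next
      show "snd \<psi> ` mod_0 P \<subseteq> mod_0 F"
        using \<Psi> z0 unfolding coiso_morphism_def sumsel \<psi>_def by force
    qed
    show "fst \<phi> (fst \<psi> y) = y" if "y \<in> carrier (mod_tot P)" for y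
      using inv(1)[of "(y, \<zero>\<^bsub>mod_tot E\<^esub>)"] that zN by (simp add: sumsel sumcar \<phi>_def \<psi>_def)
    show "snd \<phi> (snd \<psi> y) = y" if "y \<in> carrier (mod_N P)" for y
      using inv(2)[of "(y, \<zero>\<^bsub>mod_N E\<^esub>)"] that zN by (simp add: sumsel sumcar \<phi>_def \<psi>_def)
  qed
qed

section \<open>Matrices of maps between free modules\<close>

definition free_unit :: "'m manifold \<Rightarrow> 'i \<Rightarrow> 'i \<Rightarrow> 'm \<Rightarrow> real" where
  "free_unit M j = (\<lambda>i. if i = j then (\<lambda>p. if p \<in> points M then 1 else 0) else (\<lambda>p. 0))"

abbreviation fun_free :: "'m manifold \<Rightarrow> ('m \<Rightarrow> real) set \<Rightarrow> 'i set \<Rightarrow> ('m \<Rightarrow> real, 'i \<Rightarrow> 'm \<Rightarrow> real) module" where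
  "fun_free M B I \<equiv> free_module (function_algebra M B) I"

lemma carrier_free_function_module:
  assumes "finite I"
  shows "x \<in> carrier (fun_free M B I) \<longleftrightarrow> (\<forall>i\<in>I. x i \<in> B) \<and> (\<forall>i. i \<notin> I \<longrightarrow> x i = (\<lambda>p. 0))"
proof -
  have "finite {i. x i \<noteq> (\<lambda>p. 0)}" if "\<forall>i. i \<notin> I \<longrightarrow> x i = (\<lambda>p. 0)"
    by (rule finite_subset[OF _ assms]) (use that in auto)
  then show ?thesis by (auto simp: free_module_def function_algebra_def)
qed

lemma free_function_module_ops:
  "x \<oplus>\<^bsub>fun_free M B I\<^esub> y = (\<lambda>i p. x i p + y i p)"
  "a \<odot>\<^bsub>fun_free M B I\<^esub> x = (\<lambda>i p. x i p * a p)"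
  by (simp_all add: free_module_def function_algebra_def)

lemma free_unit_in:
  assumes "finite I" "j \<in> I" "(\<lambda>p. 0) \<in> B" "(\<lambda>p. if p \<in> points M then 1 else 0) \<in> B"
  shows "free_unit M j \<in> carrier (fun_free M B I)"
  using assms by (auto simp: carrier_free_function_module free_unit_def)

lemma free_function_module_map:
  assumes fin: "finite I" and B: "(\<lambda>p. 0) \<in> B" "(\<lambda>p. if p \<in> points M then 1 else 0) \<in> B"
    and off: "\<And>f p. f \<in> B \<Longrightarrow> p \<notin> points M \<Longrightarrow> f p = 0"
    and h: "h \<in> module_maps (function_algebra M B) (fun_free M B I) (fun_free M B J)"
    and x: "x \<in> carrier (fun_free M B I)"
  shows "h x i p = (\<Sum>j\<in>I. h (free_unit M j) i p * x j p)"
proof -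
  let ?F = "fun_free M B I"
  note car = carrier_free_function_module[OF fin]
  \<comment> \<open>The induction treats the truncations of \<open>x\<close> to subsets of
    \<open>I\<close>, adding one basis element at a time.\<close>
  have "T \<subseteq> I \<Longrightarrow> h (\<lambda>i. if i \<in> T then x i else (\<lambda>p. 0)) i p = (\<Sum>j\<in>T. h (free_unit M j) i p * x j p)" if "finite T" for T
    using that
  proof (induction T)
    case empty
    have z: "(\<lambda>i p. 0) \<in> carrier ?F" using B by (simp add: car)
    have "h (\<lambda>i p. 0) = (\<lambda>i p. h (\<lambda>i p. 0) i p + h (\<lambda>i p. 0) i p)"
      using module_maps_add[OF h z z] by (simp add: free_function_module_ops)
    then have "h (\<lambda>i p. 0) i p = h (\<lambda>i p. 0) i p + h (\<lambda>i p. 0) i p" by meson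
    then show ?case by simp
  next
    case (insert j T)
    let ?y = "\<lambda>i. if i \<in> T then x i else (\<lambda>p. 0)"
    have xj: "x j \<in> B" using x insert by (simp add: car)
    have y: "?y \<in> carrier ?F" using x insert B by (auto simp: car)
    have u: "free_unit M j \<in> carrier ?F" using insert.prems by (intro free_unit_in[OF fin _ B]) simp
    \<comment> \<open>The unit function is cut off outside \<open>M\<close>; multiplying by it does
      not change \<open>x j\<close>, which vanishes there as well.\<close>
    have xu: "x j \<odot>\<^bsub>?F\<^esub> free_unit M j = (\<lambda>i. if i = j then x j else (\<lambda>p. 0))"
      using off[OF xj] by (auto simp: free_function_module_ops free_unit_def fun_eq_iff)
    have xu_in: "x j \<odot>\<^bsub>?F\<^esub> free_unit M j \<in> carrier ?F"
      unfolding xu car using xj insert.prems B by auto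
    have "(\<lambda>i. if i \<in> insert j T then x i else (\<lambda>p. 0)) = ?y \<oplus>\<^bsub>?F\<^esub> (x j \<odot>\<^bsub>?F\<^esub> free_unit M j)"
      unfolding xu using insert.hyps by (auto simp: free_function_module_ops fun_eq_iff)
    then have "h (\<lambda>i. if i \<in> insert j T then x i else (\<lambda>p. 0)) i p =
        h ?y i p + h (x j \<odot>\<^bsub>?F\<^esub> free_unit M j) i p"
      using module_maps_add[OF h y xu_in] by (simp add: free_function_module_ops)
    also have "h (x j \<odot>\<^bsub>?F\<^esub> free_unit M j) i p = h (free_unit M j) i p * x j p"
    proof -
      have "x j \<in> carrier (function_algebra M B)" using xj by (simp add: function_algebra_def)
      from module_maps_smult[OF h this u] show ?thesis by (simp add: free_function_module_ops)
    qed
    finally show ?case using insert by simp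
  qed
  from this[OF fin subset_refl] have "h (\<lambda>i. if i \<in> I then x i else (\<lambda>p. 0)) i p = (\<Sum>j\<in>I. h (free_unit M j) i p * x j p)" .
  moreover have "(\<lambda>i. if i \<in> I then x i else (\<lambda>p. 0)) = x" using x by (auto simp: car)
  ultimately show ?thesis by simp
qed

text \<open>Splitting a tuple into its parts inside and outside \<open>I0\<close> turns the sum of
  submodules into a condition on the entries outside \<open>I0\<close> alone.\<close>

lemma mod_0_free_function_module:
  assumes fin: "finite I" and sub: "I0 \<subseteq> I" and B: "(\<lambda>p. 0) \<in> B" "(\<lambda>p. 0) \<in> B0" "B0 \<subseteq> B"
    and add: "\<And>f g. f \<in> B \<Longrightarrow> g \<in> B \<Longrightarrow> (\<lambda>p. f p + g p) \<in> B"
  shows "carrier (fun_free M B I0) <+>\<^bsub>fun_free M B I\<^esub>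
      {f \<in> carrier (fun_free M B I). \<forall>j\<in>I. f j \<in> B0} =
    {f \<in> carrier (fun_free M B I). \<forall>j\<in>I - I0. f j \<in> B0}" (is "?l = ?r")
proof -
  have fin0: "finite I0" using finite_subset[OF sub fin] .
  note car = carrier_free_function_module[OF fin] carrier_free_function_module[OF fin0]
  show ?thesis
  proof (intro equalityI subsetI)
    fix f assume "f \<in> ?l"
    then obtain x y where x: "x \<in> carrier (fun_free M B I0)"
      and y: "y \<in> carrier (fun_free M B I)" "\<forall>j\<in>I. y j \<in> B0"
      and f: "f = x \<oplus>\<^bsub>fun_free M B I\<^esub> y"
      unfolding set_add_def' by blast
    have "f j = y j" if "j \<notin> I0" for j using that x by (simp add: f free_function_module_ops car)
    moreover have "f j = (\<lambda>p. x j p + y j p)" for j by (simp add: f free_function_module_ops)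
    ultimately show "f \<in> ?r" using x y sub add B by (auto simp: car) (metis subset_iff)
  next
    fix f assume f: "f \<in> ?r"
    let ?x = "\<lambda>i. if i \<in> I0 then f i else (\<lambda>p. 0)" and ?y = "\<lambda>i. if i \<in> I0 then (\<lambda>p. 0) else f i"
    have "?x \<in> carrier (fun_free M B I0)" using f sub by (auto simp: car)
    moreover have "?y \<in> {f \<in> carrier (fun_free M B I). \<forall>j\<in>I. f j \<in> B0}"
      using f B by (auto simp: car)
    moreover have "f = ?x \<oplus>\<^bsub>fun_free M B I\<^esub> ?y"
      by (auto simp: free_function_module_ops fun_eq_iff)
    ultimately show "f \<in> ?l" unfolding set_add_def' by blast
  qed
qed

section \<open>The idempotents of a retract of a free module\<close>

text \<open>\<open>\<phi> \<psi>\<close> is the identity of \<open>P\<close>, so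
  \<open>\<psi> \<phi>\<close> is an idempotent endomorphism of the free module whose image is a
  copy of \<open>P\<close>.\<close>

locale free_retract =
  fixes M :: "'m manifold" and C :: "'c manifold" and \<iota> :: "'c \<Rightarrow> 'm"
    and D :: "'c \<Rightarrow> 'c tangent_vector set"
    and P :: "('m \<Rightarrow> real, 'm \<Rightarrow> real, 'p, 'q) coiso_mod"
    and S :: "(nat, nat) coiso_index" and \<phi> \<psi>
  assumes M: "smooth_manifold M" and C: "smooth_manifold C"
    and imm: "injective_immersion C M \<iota>"
    and dist: "smooth_distribution C D" and int: "integrable_distribution C D"
    and P: "coisotropic_module (coiso_functions M C \<iota> D) P"
    and S: "coisotropic_index_set S" "finite (idx_tot S)" "finite (idx_N S)" "inj_on (idx_map S) (idx_N S)"
    and \<phi>: "coiso_morphism (coiso_functions M C \<iota> D) (free_coiso_module (coiso_functions M C \<iota> D) S) P \<phi>"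
    and \<psi>: "coiso_morphism (coiso_functions M C \<iota> D) P (free_coiso_module (coiso_functions M C \<iota> D) S) \<psi>"
    and retr_tot: "\<And>y. y \<in> carrier (mod_tot P) \<Longrightarrow> fst \<phi> (fst \<psi> y) = y"
    and retr_N: "\<And>y. y \<in> carrier (mod_N P) \<Longrightarrow> snd \<phi> (snd \<psi> y) = y"
    and conM: "connected_space (mtop M)" and conC: "connected_space (leaf_space C D)"
begin

lemma alg: "coisotropic_algebra (coiso_functions M C \<iota> D)"
  and mod_0_P_subset: "y \<in> mod_0 P \<Longrightarrow> y \<in> carrier (mod_N P)"
  using P subgroup.subset[of "mod_0 P" "add_monoid (mod_N P)"]
  by (auto simp: coisotropic_module_def submodule_def)

abbreviation "\<A> \<equiv> coiso_functions M C \<iota> D"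
abbreviation "F \<equiv> free_coiso_module \<A> S"
abbreviation "\<kappa> \<equiv> idx_map S"
abbreviation "Bt \<equiv> smooth_functions M"
abbreviation "BN \<equiv> {f \<in> smooth_functions M. pullback C \<iota> f \<in> leafwise_constant_functions C D}"
abbreviation "B0 \<equiv> {f \<in> smooth_functions M. pullback C \<iota> f = (\<lambda>c. 0)}"

text \<open>One ambient dimension for all bundles: \<open>Suc\<close> makes every index of
  \<open>idx_tot S\<close> smaller than \<open>N\<close>, and \<open>insert 0\<close> keeps
  \<open>Max\<close> meaningful for an empty index set.\<close>

definition N :: nat where "N = Suc (Max (insert 0 (idx_tot S)))"

lemma less_N: "i \<in> idx_tot S \<Longrightarrow> i < N"
  unfolding N_def using S(2) by (simp add: less_Suc_eq_le)

lemma \<kappa>_in: "j \<in> idx_N S \<Longrightarrow> \<kappa> j \<in> idx_tot S"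
  using S(1) by (auto simp: coisotropic_index_set_def)

lemma idx_0_subset: "idx_0 S \<subseteq> idx_N S"
  using S(1) by (simp add: coisotropic_index_set_def)

lemma \<iota>_smooth: "smooth_map_on C (points C) M \<iota>"
  using imm by (simp add: injective_immersion_def)

lemma \<iota>_in: "c \<in> points C \<Longrightarrow> \<iota> c \<in> points M"
  by (rule smooth_map_on_points[OF \<iota>_smooth openin_topspace])

lemma pullback_smooth: "f \<in> Bt \<Longrightarrow> pullback C \<iota> f \<in> smooth_functions C"
  by (rule pullback_smooth_functions[OF C M \<iota>_smooth])

lemma alg_simps:
  "alg_tot \<A> = function_algebra M Bt" "alg_N \<A> = function_algebra M BN" "alg_0 \<A> = B0" "alg_map \<A> = (\<lambda>f. f)"
  by (simp_all add: coiso_functions_def)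

lemma leafwise_constant_functions_iff:
  "f \<in> leafwise_constant_functions C D \<longleftrightarrow> f \<in> smooth_functions C \<and> leafwise_constant C D f"
  by (simp add: leafwise_constant_functions_def leafwise_constant_def)

lemma ring_N: "ring (function_algebra M BN)" and ring_tot: "ring (function_algebra M Bt)"
  using alg by (simp_all add: coisotropic_algebra_def real_algebra_def alg_simps)

lemma BN_closed: "(\<lambda>p. 0) \<in> BN" "(\<lambda>p. if p \<in> points M then 1 else 0) \<in> BN"
  "f \<in> BN \<Longrightarrow> g \<in> BN \<Longrightarrow> (\<lambda>p. f p + g p) \<in> BN"
proof -
  interpret ring "function_algebra M BN" by (rule ring_N)
  have car: "carrier (function_algebra M BN) = BN" by (simp add: function_algebra_def)
  show "(\<lambda>p. 0) \<in> BN" using zero_closed unfolding car by (simp add: function_algebra_def)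
  show "(\<lambda>p. if p \<in> points M then 1 else 0) \<in> BN" using one_closed unfolding car by (simp add: function_algebra_def)
  assume "f \<in> BN" "g \<in> BN"
  then have "f \<in> carrier (function_algebra M BN)" "g \<in> carrier (function_algebra M BN)"
    unfolding car .
  from a_closed[OF this] have "f \<oplus>\<^bsub>function_algebra M BN\<^esub> g \<in> BN" unfolding car .
  then show "(\<lambda>p. f p + g p) \<in> BN" by (simp add: function_algebra_def)
qed

lemma Bt_closed: "(\<lambda>p. 0) \<in> Bt" "(\<lambda>p. if p \<in> points M then c else 0) \<in> Bt"
  using smooth_functions_const[OF M] smooth_functions_const[OF M, of 0] by auto

lemma Bt_off: "f \<in> Bt \<Longrightarrow> p \<notin> points M \<Longrightarrow> f p = 0"
  by (simp add: smooth_functions_def)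

lemma F_simps:
  "mod_tot F = free_module (function_algebra M Bt) (idx_tot S)"
  "mod_N F = free_module (function_algebra M BN) (idx_N S)"
  by (simp_all add: free_coiso_module_def alg_simps)

lemma carrier_F_tot: "x \<in> carrier (mod_tot F) \<longleftrightarrow> (\<forall>i\<in>idx_tot S. x i \<in> Bt) \<and> (\<forall>i. i \<notin> idx_tot S \<longrightarrow> x i = (\<lambda>p. 0))"
  unfolding F_simps by (rule carrier_free_function_module[OF S(2)])

lemma carrier_F_N: "x \<in> carrier (mod_N F) \<longleftrightarrow> (\<forall>i\<in>idx_N S. x i \<in> BN) \<and> (\<forall>i. i \<notin> idx_N S \<longrightarrow> x i = (\<lambda>p. 0))"
  unfolding F_simps by (rule carrier_free_function_module[OF S(3)])

lemma mod_0_F: "mod_0 F = {x \<in> carrier (mod_N F). \<forall>j\<in>idx_N S - idx_0 S. x j \<in> B0}"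
proof -
  have "(\<lambda>p. 0) \<in> B0" using Bt_closed by (auto simp: pullback_def)
  moreover have "B0 \<subseteq> BN"
  proof -
    have "(\<lambda>c. 0) \<in> leafwise_constant_functions C D"
      using smooth_functions_const[OF C, of 0] by (simp add: leafwise_constant_functions_iff leafwise_constant_def)
    then show ?thesis by auto
  qed
  ultimately show ?thesis
    unfolding F_simps unfolding free_coiso_module_def alg_simps coiso_mod.simps
    by (intro mod_0_free_function_module S idx_0_subset BN_closed)
qed

text \<open>The structure map of the free module: as \<open>\<kappa>\<close> is injective, its
  defining sum has at most one term, and only a reindexing remains.\<close>

definition push :: "(nat \<Rightarrow> 'm \<Rightarrow> real) \<Rightarrow> nat \<Rightarrow> 'm \<Rightarrow> real" where
  "push y i = (if i \<in> \<kappa> ` idx_N S then y (inv_into (idx_N S) \<kappa> i) else (\<lambda>p. 0))"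

lemma push_\<kappa>: "j \<in> idx_N S \<Longrightarrow> push y (\<kappa> j) = y j"
  using S(4) by (simp add: push_def)

lemma push_outside: "i \<notin> \<kappa> ` idx_N S \<Longrightarrow> push y i = (\<lambda>p. 0)"
  by (simp add: push_def)

lemma mod_map_F:
  assumes y: "y \<in> carrier (mod_N F)"
  shows "mod_map F y = push y"
proof
  fix i
  interpret ring "function_algebra M Bt" by (rule ring_tot)
  have z: "\<zero>\<^bsub>function_algebra M Bt\<^esub> = (\<lambda>p. 0)" "\<zero>\<^bsub>function_algebra M BN\<^esub> = (\<lambda>p. 0)"
    by (simp_all add: function_algebra_def)
  have eq: "mod_map F y i = (\<Oplus>\<^bsub>function_algebra M Bt\<^esub>j\<in>{j \<in> idx_N S. \<kappa> j = i \<and> y j \<noteq> (\<lambda>p. 0)}. y j)"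
    by (simp add: free_coiso_module_def alg_simps z)
  show "mod_map F y i = push y i"
  proof (cases "i \<in> \<kappa> ` idx_N S")
    case True
    then obtain j where j: "j \<in> idx_N S" "i = \<kappa> j" by blast
    have yj: "y j \<in> carrier (function_algebra M Bt)"
      using y j by (auto simp: carrier_F_N function_algebra_def)
    show ?thesis
    proof (cases "y j = (\<lambda>p. 0)")
      case z0: True
      \<comment> \<open>The structure map sums over nonzero entries only, so a zero entry yields the
        empty sum and not a one-term sum.\<close>
      then have empty: "{j \<in> idx_N S. \<kappa> j = i \<and> y j \<noteq> (\<lambda>p. 0)} = {}" using j inj_onD[OF S(4)] by blast
      have "mod_map F y i = (\<lambda>p. 0)" unfolding eq empty by (simp only: finsum_empty z)
      then show ?thesis using z0 j(2) push_\<kappa>[OF j(1)] by simp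
    next
      case False
      then have "{j \<in> idx_N S. \<kappa> j = i \<and> y j \<noteq> (\<lambda>p. 0)} = insert j {}" using j inj_onD[OF S(4)] by blast
      then show ?thesis unfolding eq using finsum_insert[of "{}" j y] yj j push_\<kappa>[OF j(1)] by simp
    qed
  next
    case False
    then have "{j \<in> idx_N S. \<kappa> j = i \<and> y j \<noteq> (\<lambda>p. 0)} = {}" by blast
    then show ?thesis unfolding eq using push_outside[OF False] by (simp only: finsum_empty z)
  qed
qed

lemma \<phi>D:
  "fst \<phi> \<in> module_maps (function_algebra M Bt) (mod_tot F) (mod_tot P)"
  "snd \<phi> \<in> module_maps (function_algebra M BN) (mod_N F) (mod_N P)"
  "x \<in> carrier (mod_N F) \<Longrightarrow> fst \<phi> (push x) = mod_map P (snd \<phi> x)"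
  "snd \<phi> ` mod_0 F \<subseteq> mod_0 P"
  using \<phi> mod_map_F unfolding coiso_morphism_def alg_simps by auto

lemma \<psi>D:
  "fst \<psi> \<in> module_maps (function_algebra M Bt) (mod_tot P) (mod_tot F)"
  "snd \<psi> \<in> module_maps (function_algebra M BN) (mod_N P) (mod_N F)"
  "snd \<psi> ` mod_0 P \<subseteq> mod_0 F"
  using \<psi> unfolding coiso_morphism_def alg_simps by auto

lemma \<psi>_map:
  assumes "z \<in> carrier (mod_N P)"
  shows "fst \<psi> (mod_map P z) = push (snd \<psi> z)"
proof -
  have "fst \<psi> (mod_map P z) = mod_map F (snd \<psi> z)"
    using \<psi> assms unfolding coiso_morphism_def by blast
  then show ?thesis using mod_map_F[OF module_maps_closed[OF \<psi>D(2) assms]] by simp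
qed

section \<open>Tuples as sections, and the idempotent matrices\<close>

definition sec :: "(nat \<Rightarrow> 'm \<Rightarrow> real) \<Rightarrow> 'm \<Rightarrow> fin_seq" where
  "sec x p = fin_vec N (\<lambda>i. x i p)"

definition comp :: "('m \<Rightarrow> fin_seq) \<Rightarrow> nat \<Rightarrow> 'm \<Rightarrow> real" where
  "comp s i p = coord (s p) i"

definition compN :: "('m \<Rightarrow> fin_seq) \<Rightarrow> nat \<Rightarrow> 'm \<Rightarrow> real" where
  "compN s j = (if j \<in> idx_N S then comp s (\<kappa> j) else (\<lambda>p. 0))"

definition proj :: "nat set \<Rightarrow> fin_seq \<Rightarrow> fin_seq" where
  "proj I v = fin_vec N (\<lambda>i. if i \<in> I then coord v i else 0)"

text \<open>Column \<open>j\<close> is the image of the \<open>j\<close>-th basis element under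
  \<open>\<psi> \<phi>\<close>, padded by zeros to size \<open>N\<close>.\<close>

definition et :: "'m \<Rightarrow> nat \<Rightarrow> nat \<Rightarrow> real" where
  "et p i j = (if i \<in> idx_tot S \<and> j \<in> idx_tot S then fst \<psi> (fst \<phi> (free_unit M j)) i p else 0)"

definition eN :: "'m \<Rightarrow> nat \<Rightarrow> nat \<Rightarrow> real" where
  "eN p i j = (if j \<in> \<kappa> ` idx_N S then et p i j else 0)"

definition eC :: "'c \<Rightarrow> nat \<Rightarrow> nat \<Rightarrow> real" where
  "eC c = eN (\<iota> c)"

definition q :: "'c \<Rightarrow> nat \<Rightarrow> nat \<Rightarrow> real" where
  "q c i j = (\<Sum>k<N. (if k \<in> \<kappa> ` idx_0 S then eC c i k else 0) * eC c k j)"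

definition qperp :: "'c \<Rightarrow> nat \<Rightarrow> nat \<Rightarrow> real" where
  "qperp c i j = eC c i j - q c i j"

abbreviation "ap \<equiv> mat_app N N"

lemma coord_sec: "x \<in> carrier (mod_tot F) \<Longrightarrow> coord (sec x p) i = x i p"
  using less_N[of i] by (cases "i \<in> idx_tot S") (auto simp: sec_def carrier_F_tot)

lemma push_in: "y \<in> carrier (mod_N F) \<Longrightarrow> push y \<in> carrier (mod_tot F)"
  using \<kappa>_in push_\<kappa> push_outside Bt_closed(1) unfolding carrier_F_tot carrier_F_N by (auto simp: push_def)

lemma ap_et:
  assumes x: "x \<in> carrier (mod_tot F)"
  shows "ap (et p) (sec x p) = sec (fst \<psi> (fst \<phi> x)) p"
proof (rule fin_seq_eqI)
  fix i
  have h: "(\<lambda>x. fst \<psi> (fst \<phi> x)) \<in> module_maps (function_algebra M Bt)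
      (free_module (function_algebra M Bt) (idx_tot S)) (free_module (function_algebra M Bt) (idx_tot S))"
    using module_maps_comp[OF \<phi>D(1) \<psi>D(1)] unfolding F_simps .
  have hx: "fst \<psi> (fst \<phi> x) \<in> carrier (mod_tot F)"
    by (rule module_maps_closed[OF \<psi>D(1) module_maps_closed[OF \<phi>D(1) x]])
  show "coord (ap (et p) (sec x p)) i = coord (sec (fst \<psi> (fst \<phi> x)) p) i"
  proof (cases "i \<in> idx_tot S")
    case True
    have "coord (ap (et p) (sec x p)) i = (\<Sum>j<N. et p i j * x j p)"
      using less_N[OF True] by (simp add: coord_sec[OF x])
    also have "\<dots> = (\<Sum>j\<in>idx_tot S. et p i j * x j p)"
      by (rule sum.mono_neutral_right) (use less_N in \<open>auto simp: et_def\<close>)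
    also have "\<dots> = (\<Sum>j\<in>idx_tot S. fst \<psi> (fst \<phi> (free_unit M j)) i p * x j p)"
      using True by (simp add: et_def)
    also have "\<dots> = fst \<psi> (fst \<phi> x) i p"
    proof (rule free_function_module_map[symmetric, where h = "\<lambda>x. fst \<psi> (fst \<phi> x)" and B = Bt and I = "idx_tot S"])
      show "finite (idx_tot S)" by (rule S(2))
      show "f p = 0" if "f \<in> Bt" "p \<notin> points M" for f p using Bt_off that .
    qed (use h x Bt_closed in \<open>simp_all add: F_simps\<close>)
    finally show ?thesis by (simp add: coord_sec[OF hx])
  next
    case False
    then show ?thesis using hx by (simp add: coord_sec[OF hx] et_def) (simp add: carrier_F_tot)
  qed
qed

text \<open>Every vector agrees, up to coordinates that \<open>et p\<close> ignores, with the value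
  at \<open>p\<close> of a tuple of constants. Identities for module elements thereby become
  pointwise matrix identities.\<close>

lemma ap_et_pick:
  assumes p: "p \<in> points M"
  obtains x where "x \<in> carrier (mod_tot F)" "ap (et p) v = ap (et p) (sec x p)"
proof -
  define x where "x = (\<lambda>i. if i \<in> idx_tot S then (\<lambda>p. if p \<in> points M then coord v i else 0) else (\<lambda>p. 0))"
  have x: "x \<in> carrier (mod_tot F)" using Bt_closed by (auto simp: carrier_F_tot x_def)
  have "ap (et p) v = ap (et p) (sec x p)"
    by (rule fin_seq_eqI) (auto simp: coord_sec[OF x] intro!: sum.cong, auto simp: et_def x_def p)
  then show thesis using that x by blast
qed

lemma et_idem: "p \<in> points M \<Longrightarrow> ap (et p) (ap (et p) v) = ap (et p) v"
proof -
  assume p: "p \<in> points M"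
  obtain x where x: "x \<in> carrier (mod_tot F)" and v: "ap (et p) v = ap (et p) (sec x p)"
    using ap_et_pick[OF p] .
  have \<phi>x: "fst \<phi> x \<in> carrier (mod_tot P)" by (rule module_maps_closed[OF \<phi>D(1) x])
  show ?thesis
    unfolding v ap_et[OF x] ap_et[OF module_maps_closed[OF \<psi>D(1) \<phi>x]] retr_tot[OF \<phi>x] ..
qed

lemma free_unit_N: "j \<in> idx_N S \<Longrightarrow> free_unit M j \<in> carrier (mod_N F)"
  unfolding F_simps by (rule free_unit_in[OF S(3) _ BN_closed(1,2)])

lemma free_unit_tot: "j \<in> idx_tot S \<Longrightarrow> free_unit M j \<in> carrier (mod_tot F)"
  unfolding F_simps by (rule free_unit_in[OF S(2) _ Bt_closed])

lemma push_free_unit: "j \<in> idx_N S \<Longrightarrow> push (free_unit M j) = free_unit M (\<kappa> j)"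
  using inj_on_eq_iff[OF S(4)] S(4) by (force simp: push_def free_unit_def fun_eq_iff)

lemma \<psi>\<phi>_push:
  assumes "y \<in> carrier (mod_N F)"
  shows "fst \<psi> (fst \<phi> (push y)) = push (snd \<psi> (snd \<phi> y))"
  unfolding \<phi>D(3)[OF assms] by (rule \<psi>_map[OF module_maps_closed[OF \<phi>D(2) assms]])

lemma et_\<kappa>: "j \<in> idx_N S \<Longrightarrow> et p i (\<kappa> j) = (if i \<in> idx_tot S then push (snd \<psi> (snd \<phi> (free_unit M j))) i p else 0)"
  using \<psi>\<phi>_push[OF free_unit_N] \<kappa>_in by (simp add: et_def push_free_unit)

lemma \<psi>\<phi>_N_in: "y \<in> carrier (mod_N F) \<Longrightarrow> snd \<psi> (snd \<phi> y) \<in> carrier (mod_N F)"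
  by (intro module_maps_closed[OF \<psi>D(2)] module_maps_closed[OF \<phi>D(2)])

text \<open>Only columns were deleted; the rows vanish because \<open>\<psi> \<phi>\<close> sends
  pushed tuples to pushed tuples.\<close>

lemma eN_zero: "i \<notin> \<kappa> ` idx_N S \<or> j \<notin> \<kappa> ` idx_N S \<Longrightarrow> eN p i j = 0"
  by (auto simp: eN_def et_\<kappa> push_outside)

text \<open>Up to reindexing, the matrix also represents the N-component of
  \<open>\<psi> \<phi>\<close>, so its entries lie in the N-part of the algebra. This is the source
  of leafwise constancy.\<close>

lemma eN_BN:
  assumes "i \<in> \<kappa> ` idx_N S" "j \<in> \<kappa> ` idx_N S"
  shows "(\<lambda>p. eN p i j) \<in> BN"
proof -
  obtain i' j' where ij: "i' \<in> idx_N S" "i = \<kappa> i'" "j' \<in> idx_N S" "j = \<kappa> j'" using assms by blast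
  have "(\<lambda>p. eN p i j) = snd \<psi> (snd \<phi> (free_unit M j')) i'"
    using ij \<kappa>_in by (auto simp: eN_def et_\<kappa> push_\<kappa>)
  also have "\<dots> \<in> BN" using \<psi>\<phi>_N_in[OF free_unit_N[OF ij(3)]] ij(1) by (simp add: carrier_F_N)
  finally show ?thesis .
qed

text \<open>A basis element indexed by \<open>idx_0 S\<close> lies in \<open>mod_0 F\<close>, which
  \<open>\<psi> \<phi>\<close> preserves. Its image therefore has entries vanishing on
  \<open>C\<close> at all other indices.\<close>

lemma eC_zero:
  assumes c: "c \<in> points C" and j: "j \<in> \<kappa> ` idx_0 S" and i: "i \<notin> \<kappa> ` idx_0 S"
  shows "eC c i j = 0"
proof (cases "i \<in> \<kappa> ` idx_N S")
  case True
  then obtain i' j' where ij: "i' \<in> idx_N S - idx_0 S" "i = \<kappa> i'" "j' \<in> idx_0 S" "j = \<kappa> j'" using i j by blast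
  then have jN: "j' \<in> idx_N S" using idx_0_subset by blast
  have "free_unit M j' \<in> mod_0 F"
    using free_unit_N[OF jN] ij Bt_closed by (auto simp: mod_0_F free_unit_def pullback_def)
  then have "snd \<psi> (snd \<phi> (free_unit M j')) \<in> mod_0 F" using \<phi>D(4) \<psi>D(3) by blast
  then have "pullback C \<iota> (snd \<psi> (snd \<phi> (free_unit M j')) i') = (\<lambda>c. 0)" using ij(1) by (simp add: mod_0_F)
  then have "snd \<psi> (snd \<phi> (free_unit M j')) i' (\<iota> c) = 0" using c by (auto simp: pullback_def fun_eq_iff split: if_splits)
  then show ?thesis using ij jN \<kappa>_in by (auto simp: eC_def eN_def et_\<kappa> push_\<kappa>)
qed (simp add: eC_def eN_zero)

lemma ap_eN: "ap (eN p) v = ap (et p) (proj (\<kappa> ` idx_N S) v)"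
  by (rule fin_seq_eqI) (auto simp: proj_def eN_def intro!: sum.cong)

lemma proj_ap_eN: "proj (\<kappa> ` idx_N S) (ap (eN p) v) = ap (eN p) v"
  by (rule fin_seq_eqI) (auto simp: proj_def eN_zero)

text \<open>\<open>eN\<close> is \<open>et\<close> after the projection, and the projection fixes
  the image of \<open>eN\<close>; the outer factor may thus be replaced by \<open>et\<close>, which
  is idempotent.\<close>

lemma eN_idem: "p \<in> points M \<Longrightarrow> ap (eN p) (ap (eN p) v) = ap (eN p) v"
  unfolding ap_eN[of p "ap (eN p) v"] proj_ap_eN unfolding ap_eN by (rule et_idem)

lemma eN_image_et: "p \<in> points M \<Longrightarrow> ap (eN p) v = v \<Longrightarrow> ap (et p) v = v"
  using et_idem ap_eN by metis

lemma ap_eC_idem: "c \<in> points C \<Longrightarrow> ap (eC c) (ap (eC c) v) = ap (eC c) v"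
  unfolding eC_def by (rule eN_idem[OF \<iota>_in])

lemma proj_ap_eC_proj:
  "c \<in> points C \<Longrightarrow> proj (\<kappa> ` idx_0 S) (ap (eC c) (proj (\<kappa> ` idx_0 S) v)) = ap (eC c) (proj (\<kappa> ` idx_0 S) v)"
  by (rule fin_seq_eqI) (auto simp: proj_def eC_zero intro!: sum.neutral)

lemma ap_q: "ap (q c) v = ap (eC c) (proj (\<kappa> ` idx_0 S) (ap (eC c) v))"
proof -
  have "ap (q c) v = ap (mat_mult N (\<lambda>i k. if k \<in> \<kappa> ` idx_0 S then eC c i k else 0) (eC c)) v"
    by (rule mat_app_cong) (simp add: q_def mat_mult_def)
  also have "\<dots> = ap (\<lambda>i k. if k \<in> \<kappa> ` idx_0 S then eC c i k else 0) (ap (eC c) v)" by (rule mat_app_mult)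
  also have "\<dots> = ap (eC c) (proj (\<kappa> ` idx_0 S) (ap (eC c) v))"
    by (rule fin_seq_eqI) (auto simp: proj_def intro!: sum.cong)
  finally show ?thesis .
qed

lemma ap_qperp: "ap (qperp c) v = ap (eC c) v - ap (q c) v"
  by (rule fin_seq_eqI) (auto simp: qperp_def lookup_minus algebra_simps sum_subtractf)

lemma eC_q: "c \<in> points C \<Longrightarrow> ap (eC c) (ap (q c) v) = ap (q c) v"
  by (simp add: ap_q ap_eC_idem)

lemma q_eC: "c \<in> points C \<Longrightarrow> ap (q c) (ap (eC c) v) = ap (q c) v"
  by (simp add: ap_q ap_eC_idem)

lemma q_idem: "c \<in> points C \<Longrightarrow> ap (q c) (ap (q c) v) = ap (q c) v"
  unfolding ap_q[of c "ap (q c) v"] eC_q unfolding ap_q by (simp add: ap_eC_idem proj_ap_eC_proj)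

lemma qperp_idem: "c \<in> points C \<Longrightarrow> ap (qperp c) (ap (qperp c) v) = ap (qperp c) v"
  by (simp add: ap_qperp mat_app_diff ap_eC_idem eC_q q_eC q_idem)

text \<open>Describes the fibres of the zero bundle without \<open>q\<close>: they are the vectors
  of the N-fibre supported on the coordinates from \<open>idx_0 S\<close>. This is the form compared
  with \<open>mod_0 F\<close>.\<close>

lemma q_fixed_iff:
  assumes c: "c \<in> points C"
  shows "ap (q c) v = v \<longleftrightarrow> ap (eC c) v = v \<and> proj (\<kappa> ` idx_0 S) v = v"
proof
  assume qv: "ap (q c) v = v"
  have "proj (\<kappa> ` idx_0 S) (ap (q c) v) = ap (q c) v" unfolding ap_q by (rule proj_ap_eC_proj[OF c])
  then show "ap (eC c) v = v \<and> proj (\<kappa> ` idx_0 S) v = v" using eC_q[OF c, of v] unfolding qv by simp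
qed (simp add: ap_q)

section \<open>Smoothness and leafwise constancy of the idempotents\<close>

lemma smooth_et: "smooth_idempotent M N et"
  unfolding smooth_idempotent_def
proof (intro conjI allI impI ballI et_idem)
  fix i j
  show "smooth_fun_on M (points M) (\<lambda>p. et p i j)"
  proof (cases "i \<in> idx_tot S \<and> j \<in> idx_tot S")
    case True
    then have "fst \<psi> (fst \<phi> (free_unit M j)) \<in> carrier (mod_tot F)"
      by (intro module_maps_closed[OF \<psi>D(1)] module_maps_closed[OF \<phi>D(1)] free_unit_tot) simp
    then have "fst \<psi> (fst \<phi> (free_unit M j)) i \<in> Bt" using True by (simp add: carrier_F_tot)
    then show ?thesis using True by (simp add: et_def smooth_functions_def)
  next
    case False
    then have "(\<lambda>p. et p i j) = (\<lambda>p. 0)" by (auto simp: et_def)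
    then show ?thesis using smooth_fun_on_const[of M "points M" 0] by simp
  qed
qed

lemma smooth_eN: "smooth_idempotent M N eN"
  unfolding smooth_idempotent_def
proof (intro conjI allI impI ballI eN_idem)
  fix i j assume "i < N" "j < N"
  then show "smooth_fun_on M (points M) (\<lambda>p. eN p i j)"
    using smooth_et smooth_fun_on_const[of M "points M" 0]
    by (cases "j \<in> \<kappa> ` idx_N S") (simp_all add: eN_def smooth_idempotent_def)
qed

lemma smooth_eC: "smooth_idempotent C N eC"
  unfolding smooth_idempotent_def
proof (intro conjI allI impI ballI ap_eC_idem)
  fix i j assume "i < N" "j < N"
  then have "smooth_fun_on M (points M) (\<lambda>p. eN p i j)" using smooth_eN by (simp add: smooth_idempotent_def)
  then show "smooth_fun_on C (points C) (\<lambda>c. eC c i j)"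
    unfolding eC_def by (rule smooth_fun_on_compose[OF C M \<iota>_smooth openin_topspace])
qed

lemma leafwise_eC: "leafwise_constant_matrix C D N eC"
  unfolding leafwise_constant_matrix_def leafwise_constant_def
proof (intro allI impI ballI)
  fix i j L x y assume L: "L \<in> leaves C D" "x \<in> L" "y \<in> L"
  then have xy: "x \<in> points C" "y \<in> points C" using leaves_subset by blast+
  show "eC x i j = eC y i j"
  proof (cases "i \<in> \<kappa> ` idx_N S \<and> j \<in> \<kappa> ` idx_N S")
    case True
    then have "pullback C \<iota> (\<lambda>p. eN p i j) \<in> leafwise_constant_functions C D" using eN_BN by blast
    then have "pullback C \<iota> (\<lambda>p. eN p i j) x = pullback C \<iota> (\<lambda>p. eN p i j) y"
      using L unfolding leafwise_constant_functions_def by blast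
    then show ?thesis using xy by (simp add: pullback_def eC_def)
  next
    case False
    then show ?thesis using eN_zero by (auto simp: eC_def)
  qed
qed

lemma smooth_q: "smooth_idempotent C N q"
  unfolding smooth_idempotent_def
proof (intro conjI allI impI ballI q_idem)
  fix i j assume "i < N" "j < N"
  moreover have "smooth_fun_on C (points C) (\<lambda>c. if k \<in> \<kappa> ` idx_0 S then eC c i k else 0)" if "i < N" "k < N" for i k
    using smooth_eC that smooth_fun_on_const[of C "points C" 0]
    by (cases "k \<in> \<kappa> ` idx_0 S") (simp_all add: smooth_idempotent_def)
  ultimately show "smooth_fun_on C (points C) (\<lambda>c. q c i j)"
    using smooth_eC unfolding q_def smooth_idempotent_def
    by (intro smooth_fun_on_sum[OF C openin_topspace] smooth_fun_on_mult[OF C openin_topspace]) auto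
qed

lemma leafwise_q: "leafwise_constant_matrix C D N q"
proof -
  have e: "eC x i j = eC y i j" if "L \<in> leaves C D" "x \<in> L" "y \<in> L" "i < N" "j < N" for L x y i j
    using leafwise_eC that unfolding leafwise_constant_matrix_def leafwise_constant_def by blast
  show ?thesis
    unfolding leafwise_constant_matrix_def leafwise_constant_def
  proof (intro allI impI ballI)
    fix i j L x y assume *: "i < N" "j < N" "L \<in> leaves C D" "x \<in> L" "y \<in> L"
    have "eC x i k = eC y i k" "eC x k j = eC y k j" if "k < N" for k
      using e[OF *(3-5)] *(1,2) that by blast+
    then show "q x i j = q y i j" unfolding q_def by (intro sum.cong) auto
  qed
qed

lemma smooth_qperp: "smooth_idempotent C N qperp"
  unfolding smooth_idempotent_def
proof (intro conjI allI impI ballI qperp_idem)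
  fix i j assume "i < N" "j < N"
  then show "smooth_fun_on C (points C) (\<lambda>c. qperp c i j)"
    using smooth_eC smooth_q unfolding qperp_def smooth_idempotent_def
    by (intro smooth_fun_on_diff[OF C openin_topspace]) auto
qed

lemma leafwise_qperp: "leafwise_constant_matrix C D N qperp"
  using leafwise_eC leafwise_q
  unfolding leafwise_constant_matrix_def leafwise_constant_def qperp_def by metis

end

section \<open>The triple of invariant sections\<close>

lemma section_module_simps:
  "carrier (section_module U) = U"
  "s \<oplus>\<^bsub>section_module U\<^esub> s' = (\<lambda>p. s p + s' p)"
  "f \<odot>\<^bsub>section_module U\<^esub> s = (\<lambda>p. f p *\<^sub>R s p)"
  by (simp_all add: section_module_def)

context free_retract
begin

lemma sec_add: "sec (\<lambda>i p. x i p + y i p) = (\<lambda>p. sec x p + sec y p)"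
  by (intro ext fin_seq_eqI) (simp add: sec_def lookup_add)

lemma sec_smult: "sec (\<lambda>i p. x i p * a p) = (\<lambda>p. a p *\<^sub>R sec x p)"
  by (intro ext fin_seq_eqI) (simp add: sec_def)

lemma push_add: "push (\<lambda>i p. x i p + y i p) = (\<lambda>i p. push x i p + push y i p)"
  by (intro ext) (simp add: push_def)

lemma push_smult: "push (\<lambda>i p. x i p * a p) = (\<lambda>i p. push x i p * a p)"
  by (intro ext) (simp add: push_def)

lemma comp_add: "comp (\<lambda>p. s p + s' p) = (\<lambda>i p. comp s i p + comp s' i p)"
  by (intro ext) (simp add: comp_def lookup_add)

lemma comp_smult: "comp (\<lambda>p. a p *\<^sub>R s p) = (\<lambda>i p. comp s i p * a p)"
  by (intro ext) (simp add: comp_def)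

lemma compN_add: "compN (\<lambda>p. s p + s' p) = (\<lambda>i p. compN s i p + compN s' i p)"
  by (intro ext) (simp add: compN_def comp_def lookup_add)

lemma compN_smult: "compN (\<lambda>p. a p *\<^sub>R s p) = (\<lambda>i p. compN s i p * a p)"
  by (intro ext) (simp add: compN_def comp_def)

context
  fixes rt rN r0 rp :: nat
  assumes rt: "idempotent_rank M N et rt" and rN: "idempotent_rank M N eN rN"
    and r0: "idempotent_rank C N q r0" and rp: "idempotent_rank C N qperp rp"
begin

definition "Etot = image_bundle M N rt et"
definition "EN = image_bundle M N rN eN"
definition "E0 = image_bundle C N r0 q"
definition "Eperp = image_bundle C N rp qperp"
definition "nabla = image_connection N eC"
abbreviation "Inv \<equiv> invariant_sections M C \<iota> D EN nabla"
definition "T = section_triple M C \<iota> D Etot EN E0 nabla"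

lemma rC: "idempotent_rank C N eC rN"
  using rN \<iota>_in by (simp add: idempotent_rank_def eC_def)

lemma pullback_EN: "pullback_bundle C \<iota> EN = image_bundle C N rN eC"
  unfolding EN_def eC_def[abs_def] by (rule pullback_image_bundle) (rule \<iota>_in)

lemma sections_Etot: "s \<in> sections M Etot \<longleftrightarrow> (\<forall>p\<in>points M. ap (et p) (s p) = s p) \<and> (\<forall>i. comp s i \<in> Bt)"
  unfolding Etot_def comp_def[abs_def] by (rule sections_image_bundle[OF M smooth_et rt])

lemma sections_EN: "s \<in> sections M EN \<longleftrightarrow> (\<forall>p\<in>points M. ap (eN p) (s p) = s p) \<and> (\<forall>i. comp s i \<in> Bt)"
  unfolding EN_def comp_def[abs_def] by (rule sections_image_bundle[OF M smooth_eN rN])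

lemma sections_EN_Etot: "s \<in> sections M EN \<Longrightarrow> s \<in> sections M Etot"
  unfolding sections_EN sections_Etot using eN_image_et by blast

lemma coord_pullback: "coord (pullback C \<iota> s c) i = pullback C \<iota> (comp s i) c"
  by (simp add: pullback_def comp_def)

lemma pullback_section:
  assumes s: "s \<in> sections M EN"
  shows "pullback C \<iota> s \<in> sections C (image_bundle C N rN eC)"
  unfolding sections_image_bundle[OF C smooth_eC rC] coord_pullback
proof (intro conjI ballI allI)
  show "ap (eC c) (pullback C \<iota> s c) = pullback C \<iota> s c" if "c \<in> points C" for c
    using s \<iota>_in[OF that] that by (simp add: sections_EN eC_def pullback_def)
  show "(\<lambda>c. pullback C \<iota> (comp s i) c) \<in> smooth_functions C" for i
    using s pullback_smooth by (simp add: sections_EN)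
qed

lemma invariant_sections_iff:
  "s \<in> Inv \<longleftrightarrow>
    s \<in> sections M EN \<and> (\<forall>i. leafwise_constant C D (pullback C \<iota> (comp s i)))"
  using invariant_iff_leafwise_constant[OF C smooth_eC rC dist int leafwise_eC pullback_section]
  unfolding invariant_sections_def nabla_def coord_pullback by auto

lemma comp_in: "s \<in> sections M Etot \<Longrightarrow> comp s \<in> carrier (mod_tot F)"
  unfolding carrier_F_tot
proof (intro conjI ballI allI impI ext)
  assume s: "s \<in> sections M Etot"
  show "comp s i \<in> Bt" for i using s by (simp add: sections_Etot)
  fix i p assume i: "i \<notin> idx_tot S"
  show "comp s i p = 0"
  proof (cases "p \<in> points M")
    case True
    then have "ap (et p) (s p) = s p" using s by (simp add: sections_Etot)
    moreover have "coord (ap (et p) (s p)) i = 0" using i by (simp add: et_def)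
    ultimately show ?thesis by (simp add: comp_def)
  next
    case False then show ?thesis using s Bt_off by (simp add: sections_Etot)
  qed
qed

lemma sec_in: "y \<in> carrier (mod_tot P) \<Longrightarrow> sec (fst \<psi> y) \<in> sections M Etot"
  unfolding sections_Etot
proof (intro conjI ballI allI)
  assume y: "y \<in> carrier (mod_tot P)"
  have x: "fst \<psi> y \<in> carrier (mod_tot F)" by (rule module_maps_closed[OF \<psi>D(1) y])
  show "ap (et p) (sec (fst \<psi> y) p) = sec (fst \<psi> y) p" for p
    unfolding ap_et[OF x] retr_tot[OF y] ..
  have "comp (sec (fst \<psi> y)) i = fst \<psi> y i" for i by (simp add: comp_def fun_eq_iff coord_sec[OF x])
  then show "comp (sec (fst \<psi> y)) i \<in> Bt" for i
    using x Bt_closed(1) by (cases "i \<in> idx_tot S") (simp_all add: carrier_F_tot)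
qed

lemma comp_sec: "x \<in> carrier (mod_tot F) \<Longrightarrow> comp (sec x) = x"
  by (simp add: comp_def fun_eq_iff coord_sec)

text \<open>On tuples \<open>\<psi> \<phi>\<close> acts as the matrix \<open>et\<close>, which fixes
  the values of sections of \<open>Etot\<close>.\<close>

lemma sec_comp:
  assumes s: "s \<in> sections M Etot"
  shows "sec (fst \<psi> (fst \<phi> (comp s))) = s"
proof
  fix p
  note x = comp_in[OF s]
  have z: "fst \<psi> (fst \<phi> (comp s)) \<in> carrier (mod_tot F)"
    by (intro module_maps_closed[OF \<psi>D(1)] module_maps_closed[OF \<phi>D(1)] x)
  show "sec (fst \<psi> (fst \<phi> (comp s))) p = s p"
  proof (cases "p \<in> points M")
    case True
    have "sec (comp s) p = s p" by (rule fin_seq_eqI) (simp add: coord_sec[OF x], simp add: comp_def)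
    then show ?thesis using ap_et[OF x, of p] s True by (simp add: sections_Etot)
  next
    case False
    have "s p = 0" using s False by (simp add: sections_def)
    moreover have "fst \<psi> (fst \<phi> (comp s)) i p = 0" for i
      using z False Bt_off by (cases "i \<in> idx_tot S") (auto simp: carrier_F_tot)
    ultimately show ?thesis by (intro fin_seq_eqI) (simp add: coord_sec[OF z])
  qed
qed

lemma push_BN: "y \<in> carrier (mod_N F) \<Longrightarrow> push y i \<in> BN"
proof (cases "i \<in> \<kappa> ` idx_N S")
  case True
  then obtain j where j: "j \<in> idx_N S" "i = \<kappa> j" by blast
  assume "y \<in> carrier (mod_N F)"
  then show ?thesis unfolding j(2) push_\<kappa>[OF j(1)] using j(1) unfolding carrier_F_N by blast
next
  case False then show ?thesis unfolding push_outside[OF False] by (intro BN_closed)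
qed

lemma secN_in:
  assumes y: "y \<in> carrier (mod_N P)"
  shows "sec (push (snd \<psi> y)) \<in> Inv"
  unfolding invariant_sections_iff sections_EN
proof (intro conjI ballI allI)
  let ?z = "snd \<psi> y"
  have z: "?z \<in> carrier (mod_N F)" by (rule module_maps_closed[OF \<psi>D(2) y])
  note x = push_in[OF z]
  have "push ?z i = (\<lambda>p. 0)" if "i \<notin> \<kappa> ` idx_N S" for i using that by (rule push_outside)
  then have pr: "proj (\<kappa> ` idx_N S) (sec (push ?z) p) = sec (push ?z) p" for p
    by (intro fin_seq_eqI) (auto simp: proj_def sec_def)
  show "ap (eN p) (sec (push ?z) p) = sec (push ?z) p" for p
    unfolding ap_eN pr ap_et[OF x] \<psi>\<phi>_push[OF z] retr_N[OF y] ..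
  show "comp (sec (push ?z)) i \<in> Bt" for i using push_BN[OF z] by (simp add: comp_sec[OF x])
  show "leafwise_constant C D (pullback C \<iota> (comp (sec (push ?z)) i))" for i
    using push_BN[OF z] by (simp add: comp_sec[OF x] leafwise_constant_functions_iff)
qed

lemma comp_EN_outside:
  assumes s: "s \<in> sections M EN" and i: "i \<notin> \<kappa> ` idx_N S"
  shows "comp s i = (\<lambda>p. 0)"
proof
  fix p
  show "comp s i p = 0"
  proof (cases "p \<in> points M")
    case True
    then have "ap (eN p) (s p) = s p" using s by (simp add: sections_EN)
    moreover have "coord (ap (eN p) (s p)) i = 0" using i by (simp add: eN_zero)
    ultimately show ?thesis by (simp add: comp_def)
  next
    case False then show ?thesis using s Bt_off by (simp add: sections_EN)
  qed
qed

lemma push_compN: "s \<in> sections M EN \<Longrightarrow> push (compN s) = comp s"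
proof
  fix i assume s: "s \<in> sections M EN"
  show "push (compN s) i = comp s i"
  proof (cases "i \<in> \<kappa> ` idx_N S")
    case True then show ?thesis by (auto simp: push_\<kappa> compN_def)
  next
    case False then show ?thesis using comp_EN_outside[OF s False] push_outside[OF False] by simp
  qed
qed

lemma compN_in:
  assumes s: "s \<in> Inv"
  shows "compN s \<in> carrier (mod_N F)"
  unfolding carrier_F_N
proof (intro conjI ballI allI impI)
  fix j assume j: "j \<in> idx_N S"
  have "comp s (\<kappa> j) \<in> Bt" "leafwise_constant C D (pullback C \<iota> (comp s (\<kappa> j)))"
    using s unfolding invariant_sections_iff sections_EN by blast+
  then show "compN s j \<in> BN"
    using j pullback_smooth by (simp add: compN_def leafwise_constant_functions_iff)
qed (simp add: compN_def)

lemma secN_compN: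
  assumes s: "s \<in> Inv"
  shows "sec (push (snd \<psi> (snd \<phi> (compN s)))) = s"
proof -
  have sE: "s \<in> sections M EN" using s by (simp add: invariant_sections_iff)
  show ?thesis
    using sec_comp[OF sections_EN_Etot[OF sE]] \<psi>\<phi>_push[OF compN_in[OF s]] push_compN[OF sE] by simp
qed

lemma compN_secN: "y \<in> carrier (mod_N F) \<Longrightarrow> compN (sec (push y)) = y"
  using comp_sec[OF push_in] by (auto simp: compN_def push_\<kappa> carrier_F_N fun_eq_iff)

text \<open>Over \<open>C\<close>, lying in the fibres of \<open>E0\<close> means having no
  components outside \<open>\<kappa>\<close> idx_0 S\<open>. Components outside\<close>\<kappa>
  \<open>idx_N S\<close> vanish anyway, and the others are the entries that \<open>mod_0_F\<close>
  constrains.\<close>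

lemma zero_component_iff:
  assumes s: "s \<in> Inv"
  shows "pullback C \<iota> s \<in> sections C E0 \<longleftrightarrow> compN s \<in> mod_0 F"
proof -
  have sE: "s \<in> sections M EN" using s by (simp add: invariant_sections_iff)
  note pb = pullback_section[OF sE, unfolded sections_image_bundle[OF C smooth_eC rC]]
  have pin: "pullback C \<iota> s c \<in> fin_space N" if "c \<in> points C" for c
    using pb that mat_app_in by metis
  have "pullback C \<iota> s \<in> sections C E0 \<longleftrightarrow>
      (\<forall>c\<in>points C. proj (\<kappa> ` idx_0 S) (pullback C \<iota> s c) = pullback C \<iota> s c)"
    using pb q_fixed_iff unfolding E0_def sections_image_bundle[OF C smooth_q r0] by blast
  also have "\<dots> \<longleftrightarrow> (\<forall>c\<in>points C. \<forall>i. i \<notin> \<kappa> ` idx_0 S \<longrightarrow> coord (pullback C \<iota> s c) i = 0)"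
  proof (intro ball_cong refl)
    fix c assume c: "c \<in> points C"
    show "proj (\<kappa> ` idx_0 S) (pullback C \<iota> s c) = pullback C \<iota> s c \<longleftrightarrow>
        (\<forall>i. i \<notin> \<kappa> ` idx_0 S \<longrightarrow> coord (pullback C \<iota> s c) i = 0)"
    proof
      assume pr: "proj (\<kappa> ` idx_0 S) (pullback C \<iota> s c) = pullback C \<iota> s c"
      show "\<forall>i. i \<notin> \<kappa> ` idx_0 S \<longrightarrow> coord (pullback C \<iota> s c) i = 0"
      proof (intro allI impI)
        fix i assume "i \<notin> \<kappa> ` idx_0 S"
        then have "coord (proj (\<kappa> ` idx_0 S) (pullback C \<iota> s c)) i = 0" by (simp add: proj_def)
        then show "coord (pullback C \<iota> s c) i = 0" unfolding pr .
      qed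
    next
      assume "\<forall>i. i \<notin> \<kappa> ` idx_0 S \<longrightarrow> coord (pullback C \<iota> s c) i = 0"
      then show "proj (\<kappa> ` idx_0 S) (pullback C \<iota> s c) = pullback C \<iota> s c"
        using pin[OF c] by (intro fin_seq_eqI) (auto simp: proj_def fin_space_def)
    qed
  qed
  also have "\<dots> \<longleftrightarrow> (\<forall>i. i \<notin> \<kappa> ` idx_0 S \<longrightarrow> pullback C \<iota> (comp s i) = (\<lambda>c. 0))"
    unfolding coord_pullback by (auto simp: fun_eq_iff pullback_def)
  also have "\<dots> \<longleftrightarrow> (\<forall>j\<in>idx_N S - idx_0 S. pullback C \<iota> (comp s (\<kappa> j)) = (\<lambda>c. 0))"
  proof (intro iffI ballI allI impI)
    fix j assume *: "\<forall>i. i \<notin> \<kappa> ` idx_0 S \<longrightarrow> pullback C \<iota> (comp s i) = (\<lambda>c. 0)" and j: "j \<in> idx_N S - idx_0 S"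
    \<comment> \<open>Injectivity of \<open>\<kappa>\<close> keeps indices outside
      \<open>idx_0 S\<close> from landing in its image.\<close>
    have "\<kappa> j \<notin> \<kappa> ` idx_0 S" using j idx_0_subset inj_on_image_mem_iff[OF S(4)] by blast
    then show "pullback C \<iota> (comp s (\<kappa> j)) = (\<lambda>c. 0)" using * by blast
  next
    fix i assume *: "\<forall>j\<in>idx_N S - idx_0 S. pullback C \<iota> (comp s (\<kappa> j)) = (\<lambda>c. 0)" and i: "i \<notin> \<kappa> ` idx_0 S"
    show "pullback C \<iota> (comp s i) = (\<lambda>c. 0)"
    proof (cases "i \<in> \<kappa> ` idx_N S")
      case True then show ?thesis using * i by blast
    next
      case False then show ?thesis using comp_EN_outside[OF sE False] by (simp add: pullback_def)
    qed
  qed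
  also have "\<dots> \<longleftrightarrow> compN s \<in> mod_0 F"
    using compN_in[OF s] sE by (auto simp: mod_0_F compN_def sections_EN)
  finally show ?thesis .
qed

section \<open>The isomorphism with the triple of invariant sections\<close>

lemma T_simps:
  "mod_tot T = section_module (sections M Etot)"
  "mod_N T = section_module (Inv)"
  "mod_0 T = {s \<in> Inv. pullback C \<iota> s \<in> sections C E0}"
  "mod_map T = (\<lambda>s. s)"
  by (simp_all add: T_def section_triple_def)

lemma T_iso: "coiso_isomorphic \<A> P T"
  unfolding coiso_isomorphic_def
proof (intro exI conjI ballI)
  \<comment> \<open>\<open>\<psi>\<close> identifies \<open>P\<close> with the tuples fixed by
    \<open>\<psi> \<phi>\<close>, and read pointwise these are sections of the image bundle. The
    inverse takes components and applies \<open>\<phi>\<close>.\<close>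
  let ?\<Theta> = "(\<lambda>y. sec (fst \<psi> y), \<lambda>y. sec (push (snd \<psi> y)))"
  let ?\<Xi> = "(\<lambda>s. fst \<phi> (comp s), \<lambda>s. snd \<phi> (compN s))"
  have alg: "alg_tot \<A> = function_algebra M Bt" "alg_N \<A> = function_algebra M BN" by (rule alg_simps)+
  show "coiso_morphism \<A> P T ?\<Theta>"
    unfolding coiso_morphism_def alg T_simps fst_conv snd_conv
  proof (intro conjI ballI)
    show "(\<lambda>y. sec (fst \<psi> y)) \<in> module_maps (function_algebra M Bt) (mod_tot P) (section_module (sections M Etot))"
      unfolding module_maps_def section_module_simps
      using sec_in module_maps_add[OF \<psi>D(1)] module_maps_smult[OF \<psi>D(1)]
      by (auto simp: F_simps free_function_module_ops sec_add sec_smult)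
    show "(\<lambda>y. sec (push (snd \<psi> y))) \<in> module_maps (function_algebra M BN) (mod_N P)
        (section_module (Inv))"
      unfolding module_maps_def section_module_simps
      using secN_in module_maps_add[OF \<psi>D(2)] module_maps_smult[OF \<psi>D(2)]
      by (auto simp: F_simps free_function_module_ops sec_add sec_smult push_add push_smult)
    show "sec (fst \<psi> (mod_map P y)) = sec (push (snd \<psi> y))" if "y \<in> carrier (mod_N P)" for y
      using \<psi>_map[OF that] by simp
    show "(\<lambda>y. sec (push (snd \<psi> y))) ` mod_0 P \<subseteq>
        {s \<in> Inv. pullback C \<iota> s \<in> sections C E0}"
    proof (rule image_subsetI)
      fix y assume y: "y \<in> mod_0 P"
      have z: "snd \<psi> y \<in> mod_0 F" using y \<psi>D(3) by blast
      then have zN: "snd \<psi> y \<in> carrier (mod_N F)" by (simp add: mod_0_F)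
      have yN: "y \<in> carrier (mod_N P)" by (rule mod_0_P_subset[OF y])
      show "sec (push (snd \<psi> y)) \<in> {s \<in> Inv. pullback C \<iota> s \<in> sections C E0}"
        using secN_in[OF yN] zero_component_iff[OF secN_in[OF yN]] z by (simp add: compN_secN[OF zN])
    qed
  qed
  show "coiso_morphism \<A> T P ?\<Xi>"
    unfolding coiso_morphism_def alg T_simps fst_conv snd_conv section_module_simps
  proof (intro conjI ballI)
    show "(\<lambda>s. fst \<phi> (comp s)) \<in> module_maps (function_algebra M Bt) (section_module (sections M Etot)) (mod_tot P)"
      unfolding module_maps_def section_module_simps
      using comp_in module_maps_add[OF \<phi>D(1)] module_maps_smult[OF \<phi>D(1)] module_maps_closed[OF \<phi>D(1)]
      by (auto simp: F_simps free_function_module_ops comp_add comp_smult)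
    show "(\<lambda>s. snd \<phi> (compN s)) \<in> module_maps (function_algebra M BN)
        (section_module (Inv)) (mod_N P)"
      unfolding module_maps_def section_module_simps
      using compN_in module_maps_add[OF \<phi>D(2)] module_maps_smult[OF \<phi>D(2)] module_maps_closed[OF \<phi>D(2)]
      by (auto simp: F_simps free_function_module_ops compN_add compN_smult)
    show "fst \<phi> (comp s) = mod_map P (snd \<phi> (compN s))" if s: "s \<in> Inv" for s
    proof -
      have "s \<in> sections M EN" using s by (simp add: invariant_sections_iff)
      then show ?thesis using \<phi>D(3)[OF compN_in[OF s]] push_compN by simp
    qed
    show "(\<lambda>s. snd \<phi> (compN s)) ` {s \<in> Inv. pullback C \<iota> s \<in> sections C E0} \<subseteq> mod_0 P"
      using zero_component_iff \<phi>D(4) by blast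
  qed
  show "fst ?\<Xi> (fst ?\<Theta> y) = y" if "y \<in> carrier (mod_tot P)" for y
    using comp_sec[OF module_maps_closed[OF \<psi>D(1) that]] retr_tot[OF that] by simp
  show "snd ?\<Xi> (snd ?\<Theta> y) = y" if "y \<in> carrier (mod_N P)" for y
    using compN_secN[OF module_maps_closed[OF \<psi>D(2) that]] retr_N[OF that] by simp
  show "fst ?\<Theta> (fst ?\<Xi> s) = s" if "s \<in> carrier (mod_tot T)" for s
    using sec_comp that by (simp add: T_simps section_module_simps)
  show "snd ?\<Theta> (snd ?\<Xi> s) = s" if "s \<in> carrier (mod_N T)" for s
    using secN_compN that by (simp add: T_simps section_module_simps)
qed

section \<open>Splitting of the bundle and the connection\<close>

lemma eC_qperp: "c \<in> points C \<Longrightarrow> ap (eC c) (ap (qperp c) v) = ap (qperp c) v"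
  by (simp add: ap_qperp mat_app_diff ap_eC_idem eC_q)

text \<open>Along \<open>D\<close> the componentwise derivative of such a section is fixed by
  \<open>q\<close>, hence also by \<open>eC\<close>, so both projections return it
  unchanged.\<close>

lemma nabla_q:
  assumes "p \<in> points C" "v \<in> D p" "s \<in> sections C E0"
  shows "nabla p v s = image_connection N q p v s"
proof -
  have "ap (q p) (deriv_coords N v s) = deriv_coords N v s"
    using deriv_coords_in_image[OF C smooth_q r0 dist int leafwise_q assms[unfolded E0_def]] .
  then show ?thesis unfolding nabla_def image_connection_def using eC_q[OF assms(1)] by metis
qed

lemma nabla_qperp:
  assumes "p \<in> points C" "v \<in> D p" "s \<in> sections C Eperp"
  shows "nabla p v s = image_connection N qperp p v s"
proof -
  have "ap (qperp p) (deriv_coords N v s) = deriv_coords N v s"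
    using deriv_coords_in_image[OF C smooth_qperp rp dist int leafwise_qperp assms[unfolded Eperp_def]] .
  then show ?thesis unfolding nabla_def image_connection_def using eC_qperp[OF assms(1)] by metis
qed

lemma closed_under_nabla: "closed_under C D nabla E0"
  unfolding closed_under_def
proof (intro ballI)
  fix Y s assume Y: "Y \<in> dist_sections C D" and s: "s \<in> sections C E0"
  have "(\<lambda>p. if p \<in> points C then nabla p (Y p) s else 0) =
      (\<lambda>p. if p \<in> points C then image_connection N q p (Y p) s else 0)"
    using Y nabla_q[OF _ _ s] by (auto simp: dist_sections_def)
  also have "\<dots> \<in> sections C E0"
    using covariant_derivative_image_connection[OF C smooth_q r0] Y s
    unfolding covariant_derivative_def E0_def dist_sections_def by blast
  finally show "(\<lambda>p. if p \<in> points C then nabla p (Y p) s else 0) \<in> sections C E0" .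
qed

lemma direct_sum: "bundle_direct_sum C (pullback_bundle C \<iota> EN) E0 Eperp"
  unfolding bundle_direct_sum_def pullback_EN
proof (intro conjI ballI)
  show "subbundle C E0 (image_bundle C N rN eC)"
    unfolding E0_def by (rule subbundle_image_bundle[OF C smooth_eC rC smooth_q r0]) (metis eC_q)
  show "subbundle C Eperp (image_bundle C N rN eC)"
    unfolding Eperp_def by (rule subbundle_image_bundle[OF C smooth_eC rC smooth_qperp rp]) (metis eC_qperp)
  fix c assume c: "c \<in> points C"
  \<comment> \<open>A vector fixed by \<open>q\<close> is fixed by \<open>eC\<close>, and then
    \<open>qperp\<close>, the difference of the two, annihilates it.\<close>
  have "v = 0" if "ap (q c) v = v" "ap (qperp c) v = v" for v
  proof -
    have "ap (eC c) v = v" using eC_q[OF c, of v] that by simp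
    then show ?thesis using that by (simp add: ap_qperp)
  qed
  then show "fibre E0 c \<inter> fibre Eperp c = {0}" by (auto simp: E0_def Eperp_def)
  show "fibre (image_bundle C N rN eC) c = {v + w |v w. v \<in> fibre E0 c \<and> w \<in> fibre Eperp c}"
  proof (intro equalityI subsetI)
    fix v assume "v \<in> fibre (image_bundle C N rN eC) c"
    then have "v = ap (q c) v + ap (qperp c) v" by (simp add: ap_qperp)
    then show "v \<in> {v + w |v w. v \<in> fibre E0 c \<and> w \<in> fibre Eperp c}"
      using q_idem[OF c] qperp_idem[OF c] unfolding E0_def Eperp_def fibre_image_bundle by blast
  next
    fix x assume "x \<in> {v + w |v w. v \<in> fibre E0 c \<and> w \<in> fibre Eperp c}"
    then obtain v w where x: "x = v + w" "ap (q c) v = v" "ap (qperp c) w = w"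
      by (auto simp: E0_def Eperp_def)
    then have "ap (eC c) v = v" "ap (eC c) w = w" using eC_q[OF c, of v] eC_qperp[OF c, of w] by simp_all
    then show "x \<in> fibre (image_bundle C N rN eC) c" by (simp add: x(1) mat_app_add)
  qed
qed

lemma connection_sum:
  "connection_direct_sum C D E0 Eperp nabla (image_connection N q) (image_connection N qperp)"
  unfolding connection_direct_sum_def
proof (intro ballI)
  fix p v s s' assume p: "p \<in> points C" and v: "v \<in> D p" and s: "s \<in> sections C E0" and s': "s' \<in> sections C Eperp"
  have vT: "v \<in> tangent_space C p" using dist p v unfolding smooth_distribution_def by blast
  have sm: "(\<lambda>p. coord (s p) i) \<in> smooth_functions C" "(\<lambda>p. coord (s' p) i) \<in> smooth_functions C" for i
    using s s' unfolding E0_def Eperp_def sections_image_bundle[OF C smooth_q r0]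
      sections_image_bundle[OF C smooth_qperp rp] by blast+
  have "nabla p v (\<lambda>q. s q + s' q) = nabla p v s + nabla p v s'"
    unfolding nabla_def image_connection_def deriv_coords_add[OF vT sm] mat_app_add ..
  then show "nabla p v (\<lambda>q. s q + s' q) = image_connection N q p v s + image_connection N qperp p v s'"
    unfolding nabla_q[OF p v s] nabla_qperp[OF p v s'] .
qed

lemma section_triple_realization:
  "vector_bundle M Etot \<and> subbundle M EN Etot \<and> subbundle C E0 (pullback_bundle C \<iota> EN) \<and>
     D_connection C D (pullback_bundle C \<iota> EN) nabla \<and>
     holonomy_free C D (pullback_bundle C \<iota> EN) nabla \<and>
     closed_under C D nabla E0 \<and>
     coiso_isomorphic \<A> P (section_triple M C \<iota> D Etot EN E0 nabla) \<and>
     (bundle_direct_sum C (pullback_bundle C \<iota> EN) E0 Eperp \<and>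
        D_connection C D E0 (image_connection N q) \<and> holonomy_free C D E0 (image_connection N q) \<and>
        D_connection C D Eperp (image_connection N qperp) \<and> holonomy_free C D Eperp (image_connection N qperp) \<and>
        connection_direct_sum C D E0 Eperp nabla (image_connection N q) (image_connection N qperp))"
proof (intro conjI)
  show "vector_bundle M Etot" unfolding Etot_def by (rule vector_bundle_image_bundle[OF M smooth_et rt])
  show "subbundle M EN Etot" unfolding EN_def Etot_def
    by (rule subbundle_image_bundle[OF M smooth_et rt smooth_eN rN]) (rule eN_image_et)
  show "subbundle C E0 (pullback_bundle C \<iota> EN)" using direct_sum by (simp add: bundle_direct_sum_def)
  show "D_connection C D (pullback_bundle C \<iota> EN) nabla"
    unfolding pullback_EN nabla_def by (rule D_connection_image_connection[OF C smooth_eC rC])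
  show "holonomy_free C D (pullback_bundle C \<iota> EN) nabla"
    unfolding pullback_EN nabla_def by (rule holonomy_free_image_connection[OF C smooth_eC rC dist int leafwise_eC])
  show "closed_under C D nabla E0" by (rule closed_under_nabla)
  show "coiso_isomorphic \<A> P (section_triple M C \<iota> D Etot EN E0 nabla)" using T_iso unfolding T_def .
  show "D_connection C D E0 (image_connection N q)"
    unfolding E0_def by (rule D_connection_image_connection[OF C smooth_q r0])
  show "holonomy_free C D E0 (image_connection N q)"
    unfolding E0_def by (rule holonomy_free_image_connection[OF C smooth_q r0 dist int leafwise_q])
  show "D_connection C D Eperp (image_connection N qperp)"
    unfolding Eperp_def by (rule D_connection_image_connection[OF C smooth_qperp rp])
  show "holonomy_free C D Eperp (image_connection N qperp)"
    unfolding Eperp_def by (rule holonomy_free_image_connection[OF C smooth_qperp rp dist int leafwise_qperp])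
qed (fact direct_sum connection_sum)+

end

end

theorem theorem4p6:
  fixes M :: "'m manifold" and C :: "'c manifold" and \<iota> :: "'c \<Rightarrow> 'm"
    and D :: "'c \<Rightarrow> 'c tangent_vector set"
    and P :: "('m \<Rightarrow> real, 'm \<Rightarrow> real, 'p, 'q) coiso_mod"
  assumes "smooth_manifold M" and "smooth_manifold C"
    and "injective_immersion C M \<iota>"
    and "smooth_distribution C D" and "integrable_distribution C D"
    and "fin_gen_regular_projective (coiso_functions M C \<iota> D) P"
    and "connected_space (mtop M)"
    and "connected_space (leaf_space C D)"
  shows "\<exists>(Etot :: ('m, fin_seq) vbundle) (EN :: ('m, fin_seq) vbundle)
           (E0 :: ('c, fin_seq) vbundle) (nabla :: ('c, fin_seq) connection).
     vector_bundle M Etot \<and> subbundle M EN Etot \<and> subbundle C E0 (pullback_bundle C \<iota> EN) \<and>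
     D_connection C D (pullback_bundle C \<iota> EN) nabla \<and>
     holonomy_free C D (pullback_bundle C \<iota> EN) nabla \<and>
     closed_under C D nabla E0 \<and>
     coiso_isomorphic (coiso_functions M C \<iota> D) P (section_triple M C \<iota> D Etot EN E0 nabla) \<and>
     (\<exists>(Eperp :: ('c, fin_seq) vbundle) nabla0 nabla_perp.
        bundle_direct_sum C (pullback_bundle C \<iota> EN) E0 Eperp \<and>
        D_connection C D E0 nabla0 \<and> holonomy_free C D E0 nabla0 \<and>
        D_connection C D Eperp nabla_perp \<and> holonomy_free C D Eperp nabla_perp \<and>
        connection_direct_sum C D E0 Eperp nabla nabla0 nabla_perp)"
proof -
  let ?A = "coiso_functions M C \<iota> D"
  obtain S :: "(nat, nat) coiso_index" and E :: "('m \<Rightarrow> real, 'm \<Rightarrow> real, nat \<Rightarrow> 'm \<Rightarrow> real, nat \<Rightarrow> 'm \<Rightarrow> real) coiso_mod"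
    where S: "coisotropic_index_set S" "finite (idx_tot S)" "finite (idx_N S)" "inj_on (idx_map S) (idx_N S)"
      and E: "coisotropic_module ?A E" "coiso_isomorphic ?A (free_coiso_module ?A S) (coiso_sum P E)"
    using assms(6) unfolding fin_gen_regular_projective_def by blast
  have P: "coisotropic_module ?A P"
    using assms(6) unfolding fin_gen_regular_projective_def regular_projective_def by blast
  obtain \<phi> \<psi> where *: "coiso_morphism ?A (free_coiso_module ?A S) P \<phi>" "coiso_morphism ?A P (free_coiso_module ?A S) \<psi>"
    "\<And>y. y \<in> carrier (mod_tot P) \<Longrightarrow> fst \<phi> (fst \<psi> y) = y"
    "\<And>y. y \<in> carrier (mod_N P) \<Longrightarrow> snd \<phi> (snd \<psi> y) = y"
    using coisotropic_summand_retract[OF E] by blast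
  interpret free_retract M C \<iota> D P S \<phi> \<psi>
    by unfold_locales (use assms S * P in \<open>auto simp: coisotropic_module_def\<close>)
  obtain rt where rt: "idempotent_rank M N et rt"
    using idempotent_rank_connected[OF M smooth_et conM] .
  obtain rN where rN: "idempotent_rank M N eN rN"
    using idempotent_rank_connected[OF M smooth_eN conM] .
  \<comment> \<open>\<open>E0\<close> and its complement live on \<open>C\<close> only, so their
    ranks need the leaf space; the restriction of \<open>EN\<close> inherits its rank from
    \<open>M\<close>.\<close>
  obtain r0 where r0: "idempotent_rank C N q r0"
    using idempotent_rank_leafwise[OF C smooth_q int leafwise_q conC] .
  obtain rp where rp: "idempotent_rank C N qperp rp"
    using idempotent_rank_leafwise[OF C smooth_qperp int leafwise_qperp conC] .
  show ?thesis using section_triple_realization[OF rt rN r0 rp] by blast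
qed

end
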